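(* Let $a\ge0$ and let $(q,r)$ be $a$-admissible. There is $C(a,r)>0$ such that for every $F\in\mathbb S^+$, $$\Big(\int_0^\infty\Big|\widetilde{\mathcal H}_{\frac{a-1}2}(F)\Big(\xi,-\frac{\xi^2}{2\pi}\Big)\Big|^2d\omega_a(\xi)\Big)^{1/2}\le C(a,r)\|F\|_{L^{q'}_tL^{r'}_a}.$$ In particular (taking $q=r=\frac{2(a+3)}{a+1}$), there is $C(a)>0$ with $$\Big(\int_0^\infty\Big|\widetilde{\mathcal H}_{\frac{a-1}2}(F)\Big(\xi,-\frac{\xi^2}{2\pi}\Big)\Big|^2d\omega_a(\xi)\Big)^{1/2}\le C(a)\Big(\int_{\mathbb R}\int_0^\infty|F(x,t)|^{\frac{2(a+3)}{a+5}}\,d\omega_a(x)\,dt\Big)^{\frac{a+5}{2(a+3)}}.$$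
   Context: $\mathbb R^+=(0,\infty)$, $d\omega_a(x)=x^a\,dx$, $L^r_a=L^r(\mathbb R^+,d\omega_a)$, $\|u\|_{L^q_tL^r_a}=(\int_{\mathbb R}\|u(\cdot,t)\|_{L^r_a}^q\,dt)^{1/q}$; primes denote conjugate exponents. A pair $(q,r)$ is $a$-admissible if $r>2$, additionally $r<\frac{2(a+1)}{a-1}$ when $a>1$, and $\frac2q=(a+1)(\frac12-\frac1r)$. $\mathbb S^+$: $F\in C^\infty(\mathbb R^+\times\mathbb R;\mathbb C)$ with $\sup_{k+\ell\le p}\sup_{(x,t)}(1+x^2+t^2)^{p/2}|(x^{-1}\partial_x)^k\partial_t^\ell F(x,t)|<\infty$ for every $p\in\mathbb N_0$. Modified Hankel transform: $\mathcal H_\nu(\varphi)(\xi)=\xi^{-\nu}\int_0^\infty\varphi(y)J_\nu(\xi y)y^{\nu+1}\,dy$ ($J_\nu$ the Bessel function of the first kind). Fourier–Hankel transform: $\widetilde{\mathcal H}_\nu(F)(\xi,\tau)=\int_{\mathbb R}e^{-2\pi i\tau t}\mathcal H_\nu(F(\cdot,t))(\xi)\,dt$. *)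

theory Defs
  imports "HOL-Analysis.Analysis"
begin

definition conj_exp :: "real \<Rightarrow> real" where
  "conj_exp p = p / (p - 1)"

definition admissible :: "real \<Rightarrow> real \<Rightarrow> real \<Rightarrow> bool" where
  "admissible a q r \<longleftrightarrow> r > 2 \<and> (a > 1 \<longrightarrow> r < 2 * (a + 1) / (a - 1))
     \<and> 2 / q = (a + 1) * (1/2 - 1/r)"

text \<open>Functions F(x,t) are curried: F x t, with x in (0,infinity), t real.\<close>

definition pdt :: "(real \<Rightarrow> real \<Rightarrow> complex) \<Rightarrow> real \<Rightarrow> real \<Rightarrow> complex" where
  "pdt G = (\<lambda>x t. vector_derivative (\<lambda>s. G x s) (at t))"

definition pdx :: "(real \<Rightarrow> real \<Rightarrow> complex) \<Rightarrow> real \<Rightarrow> real \<Rightarrow> complex" where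
  "pdx G = (\<lambda>x t. vector_derivative (\<lambda>y. G y t) (at x))"

definition mdx :: "(real \<Rightarrow> real \<Rightarrow> complex) \<Rightarrow> real \<Rightarrow> real \<Rightarrow> complex" where
  "mdx G = (\<lambda>x t. complex_of_real (inverse x) * pdx G x t)"

fun pderivs :: "bool list \<Rightarrow> (real \<Rightarrow> real \<Rightarrow> complex) \<Rightarrow> real \<Rightarrow> real \<Rightarrow> complex" where
  "pderivs [] G = G"
| "pderivs (b # ws) G = (if b then pdx else pdt) (pderivs ws G)"

definition smooth_plus :: "(real \<Rightarrow> real \<Rightarrow> complex) \<Rightarrow> bool" where
  "smooth_plus F \<longleftrightarrow>
     (\<forall>ws. (\<lambda>(x, t). pderivs ws F x t) differentiable_on ({0<..} \<times> UNIV))"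

definition Splus :: "(real \<Rightarrow> real \<Rightarrow> complex) set" where
  "Splus = {F. smooth_plus F \<and>
     (\<forall>p::nat. \<exists>M. \<forall>k l. k + l \<le> p \<longrightarrow> (\<forall>x>0. \<forall>t.
        (1 + x\<^sup>2 + t\<^sup>2) powr (real p / 2) * cmod ((mdx ^^ k) ((pdt ^^ l) F) x t) \<le> M))}"

text \<open>Bessel function of the first kind (for z > 0), via its power series.\<close>
definition besselJ :: "real \<Rightarrow> real \<Rightarrow> real" where
  "besselJ \<nu> z = (\<Sum>k. (-1) ^ k / (fact k * Gamma (real k + \<nu> + 1)) * (z / 2) powr (2 * real k + \<nu>))"

definition hankel :: "real \<Rightarrow> (real \<Rightarrow> complex) \<Rightarrow> real \<Rightarrow> complex" where
  "hankel \<nu> \<phi> \<xi> = complex_of_real (\<xi> powr (- \<nu>)) *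
     (LINT y:{0<..}|lborel. \<phi> y * complex_of_real (besselJ \<nu> (\<xi> * y) * y powr (\<nu> + 1)))"

definition fourier_hankel :: "real \<Rightarrow> (real \<Rightarrow> real \<Rightarrow> complex) \<Rightarrow> real \<Rightarrow> real \<Rightarrow> complex" where
  "fourier_hankel \<nu> F \<xi> \<tau> =
     (LINT t|lborel. exp (- 2 * pi * \<i> * complex_of_real (\<tau> * t)) * hankel \<nu> (\<lambda>y. F y t) \<xi>)"

definition mixed_norm :: "real \<Rightarrow> real \<Rightarrow> real \<Rightarrow> (real \<Rightarrow> real \<Rightarrow> complex) \<Rightarrow> real" where
  "mixed_norm a q r F =
     (LINT t|lborel. (LINT x:{0<..}|lborel. cmod (F x t) powr r * x powr a) powr (q / r)) powr (1 / q)"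

end

theory Submission
  imports Defs
begin

text \<open>
  Squaring the left-hand side (the TT* method) leads to a bilinear form in the time slices of \<open>F\<close>
  whose kernel is the integral of \<open>exp (i (t - u) \<xi>\<^sup>2) j(\<xi> x) j(\<xi> y)\<close> against \<open>d\<omega>\<^sub>a(\<xi>)\<close>, where
  \<open>j(r)\<close> is \<open>J\<^sub>\<nu>(r)\<close> divided by the power \<open>r\<^sup>\<nu>\<close>. After inserting the factor \<open>exp (- \<epsilon> \<xi>\<^sup>2)\<close>, which makes
  all integrals absolutely convergent and is removed at the end by Fatou's lemma, the kernel is given
  in closed form by Weber's second exponential integral at \<open>z = \<epsilon> - i (t - u)\<close>. With Poisson's
  integral for the modified Bessel function it is bounded by a multiple of \<open>\<bar>z\<bar>\<close> to the power
  \<open>- (a + 1) / 2\<close>. At real \<open>z\<close> it is nonnegative with constant marginals, so Schur's test yields an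
  \<open>L\<^sup>2\<close> bound for the Hankel transform without any inversion formula. A layer-cake argument
  interpolates the two bounds to a decay \<open>\<bar>t - u\<bar>\<close> to the power \<open>- 2 / q\<close> between the dual mixed
  Lebesgue spaces, and the Hardy--Littlewood--Sobolev inequality in \<open>t\<close> concludes.
\<close>

section \<open>Power weights and real interpolation\<close>

text \<open>Two thresholds shape the proof. The bounds on \<open>jbess\<close> and
  \<open>weber\<close> rest on Poisson's density
  \<open>t powr (- 1 / 2) * (1 - t) powr (s - 3 / 2)\<close>, which is integrable for
  \<open>s > 1 / 2\<close> and degenerates to a point mass at \<open>s = 1 / 2\<close>; this is the
  range a \<ge> 0. The Hardy--Littlewood--Sobolev step needs \<beta> = 2 / q in (0, 1): r > 2 gives
  \<beta> > 0, and the upper limit on r for a > 1 is exactly \<beta> < 1. The damping can be removed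
  because no constant depends on \<epsilon>: the dispersive bound only sees the modulus of z, which
  is at least the distance of t and u, and the energy bound is uniform in the real part of z, since
  the marginals at real z do not depend on z. No complex interpolation is used. Each function is cut
  into slices \<open>layer f a\<close> of modulus 0 or 1. The L1 norm and the squared L2 norm of a
  slice are the same number, the measure of the set where |f| exceeds a. Hence both endpoint
  estimates speak of the same two distribution functions, and integrating over all pairs of levels
  yields a strong-type bound at once.\<close>

definition pmeas :: "real \<Rightarrow> real measure" where
  "pmeas c = density lborel (\<lambda>x. ennreal (indicator {0<..} x * x powr c))"

lemma sets_pmeas [measurable_cong, simp]: "sets (pmeas c) = sets borel"
  by (simp add: pmeas_def)

lemma space_pmeas [simp]: "space (pmeas c) = UNIV"
  by (simp add: pmeas_def)

interpretation pmeas: sigma_finite_measure "pmeas c"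
  unfolding pmeas_def by (subst sigma_finite_measure.sigma_finite_iff_density_finite[OF sigma_finite_lborel]) auto

interpretation pmeas_pair: pair_sigma_finite "pmeas c" "pmeas d" ..
interpretation pmeas_lborel_pair: pair_sigma_finite "pmeas c" lborel ..
interpretation lborel_pmeas_pair: pair_sigma_finite lborel "pmeas c" ..

text \<open>The measure sits on the whole line and its density vanishes off the half-line.
  Restrictions to positive points or positive levels are imposed through this fact instead of
  through a smaller space.\<close>

lemma AE_pmeas_pos: "AE x in pmeas c. 0 < x"
  unfolding pmeas_def by (subst AE_density) (auto simp: indicator_def)

lemma nn_integral_pmeas:
  assumes [measurable]: "f \<in> borel_measurable borel"
  shows "(\<integral>\<^sup>+x. f x \<partial>pmeas c) = (\<integral>\<^sup>+x. ennreal (indicator {0<..} x * x powr c) * f x \<partial>lborel)"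
  unfolding pmeas_def by (rule nn_integral_density) auto

lemma nn_integral_pmeas_shift:
  assumes [measurable]: "f \<in> borel_measurable borel"
  shows "(\<integral>\<^sup>+x. f x \<partial>pmeas (c + d)) = (\<integral>\<^sup>+x. ennreal (x powr c) * f x \<partial>pmeas d)"
  by (simp add: nn_integral_pmeas) (intro nn_integral_cong,
      auto simp: indicator_def powr_add ennreal_mult mult_ac)

lemma nn_integral_pmeas_lessThan:
  assumes "c > -1" "R \<ge> 0"
  shows "(\<integral>\<^sup>+x. indicator {..<R} x \<partial>pmeas c) = ennreal (R powr (c + 1) / (c + 1))"
proof -
  have "((\<lambda>x. if x \<in> {0..R} then x powr c else 0) has_integral (R powr (c + 1) / (c + 1))) UNIV"
    using has_integral_powr_from_0[OF assms] by (subst has_integral_restrict_UNIV)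
  moreover have ae: "AE x in lborel. x \<noteq> 0 \<and> x \<noteq> R"
    using AE_lborel_singleton[of 0] AE_lborel_singleton[of R] by (rule eventually_conj)
  ultimately have "(\<integral>\<^sup>+x. ennreal (if x \<in> {0..R} then x powr c else 0) \<partial>lborel) = ennreal (R powr (c + 1) / (c + 1))"
    by (intro nn_integral_has_integral_lborel) auto
  moreover have "(\<integral>\<^sup>+x. ennreal (if x \<in> {0..R} then x powr c else 0) \<partial>lborel)
      = (\<integral>\<^sup>+x. indicator {..<R} x \<partial>pmeas c)"
    by (subst nn_integral_pmeas, simp, intro nn_integral_cong_AE eventually_mono[OF ae])
       (auto simp: indicator_def)
  ultimately show ?thesis by simp
qed

section \<open>Layer-cake formula and bilinear interpolation between levels\<close>

lemma nn_integral_layer_cake: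
  assumes "sigma_finite_measure M" and [measurable]: "f \<in> borel_measurable M"
    and "\<And>x. x \<in> space M \<Longrightarrow> f x \<ge> 0" and "p > (0::real)"
  shows "(\<integral>\<^sup>+a. emeasure M {x \<in> space M. a < f x} \<partial>pmeas (p - 1)) = (\<integral>\<^sup>+x. ennreal (f x powr p / p) \<partial>M)"
proof -
  interpret M: sigma_finite_measure M by fact
  interpret P: pair_sigma_finite M "pmeas (p - 1)" ..
  have "(\<integral>\<^sup>+a. emeasure M {x \<in> space M. a < f x} \<partial>pmeas (p - 1))
      = (\<integral>\<^sup>+a. \<integral>\<^sup>+x. indicator {..<f x} a \<partial>M \<partial>pmeas (p - 1))"
    by (intro nn_integral_cong, subst nn_integral_indicator[symmetric], simp)
       (intro nn_integral_cong, auto simp: indicator_def)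
  also have "\<dots> = (\<integral>\<^sup>+x. \<integral>\<^sup>+a. indicator {..<f x} a \<partial>pmeas (p - 1) \<partial>M)"
  proof (rule P.Fubini')
    have "(\<lambda>(x, y). indicator {..<f x} y) = (\<lambda>z. if snd z < f (fst z) then 1 else 0::ennreal)"
      by (auto simp: fun_eq_iff)
    then show "(\<lambda>(x, y). indicator {..<f x} y :: ennreal) \<in> borel_measurable (M \<Otimes>\<^sub>M pmeas (p - 1))"
      by simp
  qed
  also have "\<dots> = (\<integral>\<^sup>+x. ennreal (f x powr p / p) \<partial>M)"
    using assms by (intro nn_integral_cong) (subst nn_integral_pmeas_lessThan, auto)
  finally show ?thesis .
qed

text \<open>The first bound is used where \<open>a * b \<ge> L\<close>, the second one elsewhere with \<open>\<theta>\<close> proportional to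
  \<open>(a / b) powr (p / 2)\<close>.\<close>

lemma bilinear_interpolation:
  fixes p A V W :: real and v w :: "real \<Rightarrow> ennreal"
  assumes p: "1 < p" "p < 2" and pos: "A > 0" "V > 0" "W > 0"
    and [measurable]: "v \<in> borel_measurable borel" "w \<in> borel_measurable borel"
    and V: "(\<integral>\<^sup>+a. v a \<partial>pmeas (p - 1)) \<le> ennreal V"
    and W: "(\<integral>\<^sup>+a. w a \<partial>pmeas (p - 1)) \<le> ennreal W"
    and \<Phi>1: "\<And>a b. a > 0 \<Longrightarrow> b > 0 \<Longrightarrow> \<Phi> a b \<le> ennreal A * v a * w b"
    and \<Phi>2: "\<And>a b \<theta>. a > 0 \<Longrightarrow> b > 0 \<Longrightarrow> \<theta> > 0 \<Longrightarrow> \<Phi> a b \<le> ennreal \<theta> * v a + ennreal (1 / \<theta>) * w b"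
  shows "(\<integral>\<^sup>+a. \<integral>\<^sup>+b. \<Phi> a b \<partial>pmeas 0 \<partial>pmeas 0)
           \<le> ennreal ((1 + 4 / (2 - p)) * A powr (2 / p - 1) * (V * W) powr (1 / p))"
proof -
  \<comment> \<open>The threshold \<open>L\<close> and the factor \<open>\<theta>0\<close> balance
    the three resulting terms: \<open>\<theta>0 * V\<close> and \<open>W / \<theta>0\<close> both
    equal \<open>sqrt (V * W)\<close>, while \<open>A * L powr (1 - p) * V * W\<close> and
    \<open>L powr (1 - p/2) * sqrt (V * W)\<close> both equal
    \<open>D powr (2 / p - 1) * sqrt (V * W)\<close>.\<close>
  define D where "D = A * sqrt (V * W)"
  have D: "D > 0" using pos by (simp add: D_def)
  define L where "L = D powr (2 / p)"
  have l: "L > 0" using D by (simp add: L_def)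
  define \<theta>0 where "\<theta>0 = sqrt (W / V)"
  have t0: "\<theta>0 > 0" using pos by (simp add: \<theta>0_def)
  \<comment> \<open>With the exponent \<open>p/2\<close> the integral of
    \<open>b powr (-(p/2))\<close> over \<open>b < L / a\<close> converges since
    \<open>p < 2\<close>, and together with the factor \<open>a powr (p/2)\<close> it leaves
    \<open>a powr (p - 1)\<close>, the weight under which \<open>v\<close> is controlled. The same
    happens for \<open>w\<close> with the roles exchanged.\<close>
  define m where "m = (\<lambda>a b::real. a powr (p/2) * b powr (-(p/2)))"
  let ?X = "\<lambda>a b. ennreal (A * L powr (1 - p)) * (ennreal (a powr (p - 1)) * v a) * (ennreal (b powr (p - 1)) * w b)"
  let ?Y = "\<lambda>a b. ennreal (\<theta>0 * a powr (p/2)) * v a * (ennreal (b powr (-(p/2))) * indicator {..<L/a} b)"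
  let ?Z = "\<lambda>a b. ennreal (1 / \<theta>0 * b powr (p/2)) * w b * (ennreal (a powr (-(p/2))) * indicator {..<L/b} a)"
  have main: "\<Phi> a b \<le> ?X a b + (?Y a b + ?Z a b)" if "a > 0" "b > 0" for a b
  proof (cases "a * b < L")
    case True
    have "m a b > 0" using that by (simp add: m_def)
    then have "\<Phi> a b \<le> ennreal (\<theta>0 * m a b) * v a + ennreal (1 / (\<theta>0 * m a b)) * w b"
      using t0 that by (intro \<Phi>2) auto
    also have "\<dots> = ?Y a b + ?Z a b"
    proof -
      have e1: "ennreal (\<theta>0 * m a b) = ennreal (\<theta>0 * a powr (p/2)) * ennreal (b powr (-(p/2)))"
        using t0 by (simp add: m_def mult_ac flip: ennreal_mult)
      have e2: "ennreal (1 / (\<theta>0 * m a b)) = ennreal (1 / \<theta>0 * b powr (p/2)) * ennreal (a powr (-(p/2)))"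
        using t0 by (simp add: m_def powr_minus field_simps flip: ennreal_mult)
      have "b < L / a" "a < L / b" using True that by (simp_all add: field_simps)
      then show ?thesis unfolding e1 e2 by (simp add: mult_ac)
    qed
    also have "\<dots> \<le> ?X a b + (?Y a b + ?Z a b)" by simp
    finally show ?thesis .
  next
    case False
    \<comment> \<open>On \<open>a * b \<ge> L\<close> the factor
      \<open>(a * b / L) powr (p - 1)\<close> is at least 1. Inserting it makes the double integral
      split into a product of the two weighted integrals, with no indicator left.\<close>
    have "1 \<le> L powr (1 - p) * (a powr (p - 1) * b powr (p - 1))"
    proof -
      have "1 \<le> (a * b / L) powr (p - 1)"
        using False l p that by (intro ge_one_powr_ge_zero) auto
      also have "\<dots> = L powr (1 - p) * (a powr (p - 1) * b powr (p - 1))"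
      proof -
        have "L powr (1 - p) = inverse (L powr (p - 1))"
          by (simp flip: powr_minus)
        then show ?thesis using that l by (simp add: powr_divide powr_mult field_simps)
      qed
      finally show ?thesis .
    qed
    then have "A \<le> A * L powr (1 - p) * (a powr (p - 1) * b powr (p - 1))"
      using pos by (simp add: mult.assoc)
    then have "ennreal A * v a * w b \<le> ennreal (A * L powr (1 - p) * (a powr (p - 1) * b powr (p - 1))) * v a * w b"
      by (intro mult_right_mono ennreal_leI) auto
    also have "\<dots> = ?X a b"
      using pos by (simp add: ennreal_mult mult_ac)
    finally have "\<Phi> a b \<le> ?X a b" using \<Phi>1[OF that] by (rule order_trans[rotated])
    then show ?thesis by (simp add: add_increasing2)
  qed
  have X: "(\<integral>\<^sup>+a. \<integral>\<^sup>+b. ?X a b \<partial>pmeas 0 \<partial>pmeas 0) \<le> ennreal (A * L powr (1 - p) * V * W)"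
  proof -
    have "(\<integral>\<^sup>+a. \<integral>\<^sup>+b. ?X a b \<partial>pmeas 0 \<partial>pmeas 0)
      = ennreal (A * L powr (1 - p)) * (\<integral>\<^sup>+a. v a \<partial>pmeas (p - 1)) * (\<integral>\<^sup>+a. w a \<partial>pmeas (p - 1))"
      using nn_integral_pmeas_shift[of v "p - 1" 0] nn_integral_pmeas_shift[of w "p - 1" 0]
      by (simp add: nn_integral_cmult nn_integral_multc)
    also have "\<dots> \<le> ennreal (A * L powr (1 - p)) * ennreal V * ennreal W"
      by (intro mult_mono V W order_refl) auto
    also have "\<dots> = ennreal (A * L powr (1 - p) * V * W)"
      using pos by (simp add: ennreal_mult)
    finally show ?thesis .
  qed
  have ennm: "ennreal x * e * ennreal y = ennreal (x * y) * e" if "x \<ge> 0" "y \<ge> 0" for x y e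
    using that by (simp add: ennreal_mult mult_ac)
  \<comment> \<open>Stated for arbitrary \<open>\<theta>\<close>, \<open>U\<close> and
    \<open>u\<close>, because it is used a second time for \<open>?Z\<close> once the order of
    integration there has been exchanged.\<close>
  have Y: "(\<integral>\<^sup>+a. \<integral>\<^sup>+b. ennreal (\<theta> * a powr (p/2)) * u a * (ennreal (b powr (-(p/2))) * indicator {..<L/a} b) \<partial>pmeas 0 \<partial>pmeas 0)
       \<le> ennreal (\<theta> * (L powr (1 - p/2) / (1 - p/2)) * U)"
    if U: "(\<integral>\<^sup>+a. u a \<partial>pmeas (p - 1)) \<le> ennreal U" "U > 0" "\<theta> > 0"
      and [measurable]: "u \<in> borel_measurable borel" for \<theta> U u
  proof -
    have "(\<integral>\<^sup>+b. ennreal (\<theta> * a powr (p/2)) * u a * (ennreal (b powr (-(p/2))) * indicator {..<L/a} b) \<partial>pmeas 0)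
         = ennreal (\<theta> * (L powr (1 - p/2) / (1 - p/2))) * (ennreal (a powr (p - 1)) * u a)" if "a > 0" for a
    proof -
      have "(\<integral>\<^sup>+b. ennreal (b powr (-(p/2))) * indicator {..<L/a} b \<partial>pmeas 0) = (\<integral>\<^sup>+b. indicator {..<L/a} b \<partial>pmeas (-(p/2)))"
        using nn_integral_pmeas_shift[of "indicator {..<L/a}" "-(p/2)" 0] by simp
      also have "\<dots> = ennreal ((L/a) powr (1 - p/2) / (1 - p/2))"
        using that l p by (subst nn_integral_pmeas_lessThan) (auto simp: algebra_simps)
      finally have "(\<integral>\<^sup>+b. ennreal (\<theta> * a powr (p/2)) * u a * (ennreal (b powr (-(p/2))) * indicator {..<L/a} b) \<partial>pmeas 0)
        = ennreal (\<theta> * a powr (p/2)) * u a * ennreal ((L/a) powr (1 - p/2) / (1 - p/2))"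
        by (subst nn_integral_cmult) auto
      also have "\<dots> = ennreal (\<theta> * a powr (p/2) * ((L/a) powr (1 - p/2) / (1 - p/2))) * u a"
        using U p by (intro ennm) auto
      also have "\<theta> * a powr (p/2) * ((L/a) powr (1 - p/2) / (1 - p/2))
          = \<theta> * (L powr (1 - p/2) / (1 - p/2)) * a powr (p - 1)"
      proof -
        have "a powr (p/2) * (L/a) powr (1 - p/2) = L powr (1 - p/2) * a powr (p/2 - (1 - p/2))"
          using that l by (simp only: powr_divide powr_diff) (simp add: mult_ac)
        also have "p/2 - (1 - p/2) = p - 1" by simp
        finally show ?thesis by (simp add: field_simps)
      qed
      also have "ennreal (\<theta> * (L powr (1 - p/2) / (1 - p/2)) * a powr (p - 1)) * u a
         = ennreal (\<theta> * (L powr (1 - p/2) / (1 - p/2))) * (ennreal (a powr (p - 1)) * u a)"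
        using U p by (subst ennreal_mult) (auto simp: mult.assoc)
      finally show ?thesis .
    qed
    then have "(\<integral>\<^sup>+a. \<integral>\<^sup>+b. ennreal (\<theta> * a powr (p/2)) * u a * (ennreal (b powr (-(p/2))) * indicator {..<L/a} b) \<partial>pmeas 0 \<partial>pmeas 0)
       = (\<integral>\<^sup>+a. ennreal (\<theta> * (L powr (1 - p/2) / (1 - p/2))) * (ennreal (a powr (p - 1)) * u a) \<partial>pmeas 0)"
      by (intro nn_integral_cong_AE eventually_mono[OF AE_pmeas_pos]) auto
    also have "\<dots> = ennreal (\<theta> * (L powr (1 - p/2) / (1 - p/2))) * (\<integral>\<^sup>+a. u a \<partial>pmeas (p - 1))"
      using nn_integral_pmeas_shift[of u "p - 1" 0] by (simp add: nn_integral_cmult)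
    also have "\<dots> \<le> ennreal (\<theta> * (L powr (1 - p/2) / (1 - p/2))) * ennreal U"
      by (intro mult_mono U) auto
    also have "\<dots> = ennreal (\<theta> * (L powr (1 - p/2) / (1 - p/2)) * U)"
      using U p by (intro ennreal_mult[symmetric]) auto
    finally show ?thesis .
  qed
  have ind: "(\<lambda>x. indicator {..<L / f x} (g x) :: ennreal) \<in> borel_measurable N"
    if [measurable]: "f \<in> borel_measurable N" "g \<in> borel_measurable N" for f g and N :: "'z measure"
  proof -
    have "(\<lambda>x. indicator {..<L / f x} (g x)) = (\<lambda>x. if g x < L / f x then 1 else 0::ennreal)"
      by (auto simp: fun_eq_iff)
    then show ?thesis by simp
  qed
  note ind[measurable]
  have Z: "(\<integral>\<^sup>+a. \<integral>\<^sup>+b. ?Z a b \<partial>pmeas 0 \<partial>pmeas 0) = (\<integral>\<^sup>+b. \<integral>\<^sup>+a. ?Z a b \<partial>pmeas 0 \<partial>pmeas 0)"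
    by (rule pmeas_pair.Fubini'[symmetric]) measurable
  have "(\<integral>\<^sup>+a. \<integral>\<^sup>+b. \<Phi> a b \<partial>pmeas 0 \<partial>pmeas 0) \<le> (\<integral>\<^sup>+a. \<integral>\<^sup>+b. ?X a b + (?Y a b + ?Z a b) \<partial>pmeas 0 \<partial>pmeas 0)"
    by (intro nn_integral_mono_AE eventually_mono[OF AE_pmeas_pos]) (use main in auto)
  also have "\<dots> = (\<integral>\<^sup>+a. \<integral>\<^sup>+b. ?X a b \<partial>pmeas 0 \<partial>pmeas 0) + ((\<integral>\<^sup>+a. \<integral>\<^sup>+b. ?Y a b \<partial>pmeas 0 \<partial>pmeas 0) + (\<integral>\<^sup>+a. \<integral>\<^sup>+b. ?Z a b \<partial>pmeas 0 \<partial>pmeas 0))"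
    by (simp add: nn_integral_add)
  also have "\<dots> \<le> ennreal (A * L powr (1 - p) * V * W) + (ennreal (\<theta>0 * (L powr (1 - p/2) / (1 - p/2)) * V)
      + ennreal (1 / \<theta>0 * (L powr (1 - p/2) / (1 - p/2)) * W))"
    unfolding Z using t0 pos by (intro add_mono X Y V W) auto
  also have "\<dots> = ennreal (A * L powr (1 - p) * V * W + (\<theta>0 * (L powr (1 - p/2) / (1 - p/2)) * V
      + 1 / \<theta>0 * (L powr (1 - p/2) / (1 - p/2)) * W))"
    using t0 pos p by (simp add: ennreal_plus)
  also have "A * L powr (1 - p) * V * W + (\<theta>0 * (L powr (1 - p/2) / (1 - p/2)) * V
      + 1 / \<theta>0 * (L powr (1 - p/2) / (1 - p/2)) * W) = (1 + 4 / (2 - p)) * A powr (2 / p - 1) * (V * W) powr (1 / p)"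
  proof -
    define s where "s = sqrt (V * W)"
    have s: "s > 0" "V * W = s * s" using pos by (auto simp: s_def)
    have D': "D = A * s" by (simp add: D_def s_def)
    have a1: "\<theta>0 * V = s" using pos by (simp add: \<theta>0_def s_def real_sqrt_divide real_sqrt_mult field_simps)
    have a2: "1 / \<theta>0 * W = s" using pos by (simp add: \<theta>0_def s_def real_sqrt_divide real_sqrt_mult field_simps)
    have b: "A powr (2 / p - 1) * (V * W) powr (1 / p) = D powr (2 / p - 1) * s"
    proof -
      have "(V * W) powr (1 / p) = s powr (2 / p - 1) * s"
        unfolding s(2) using s(1) by (simp add: powr_mult powr_diff flip: powr_add)
      then show ?thesis using pos s unfolding D' by (simp add: powr_mult)
    qed
    have c1: "L powr (1 - p/2) = D powr (2 / p - 1)"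
      using p by (simp add: L_def powr_powr diff_divide_distrib right_diff_distrib)
    have c2: "A * L powr (1 - p) * V * W = D powr (2 / p - 1) * s"
    proof -
      have "L powr (1 - p) = D powr (2 / p - 2)"
        using p by (simp add: L_def powr_powr diff_divide_distrib right_diff_distrib)
      also have "\<dots> = D powr (2 / p - 1) / D"
        using D by (simp add: powr_diff field_simps power2_eq_square)
      finally show ?thesis using D s unfolding D' by (simp add: field_simps)
    qed
    have "A * L powr (1 - p) * V * W + (\<theta>0 * (L powr (1 - p/2) / (1 - p/2)) * V
      + 1 / \<theta>0 * (L powr (1 - p/2) / (1 - p/2)) * W)
      = D powr (2 / p - 1) * s + D powr (2 / p - 1) / (1 - p/2) * (\<theta>0 * V) + D powr (2 / p - 1) / (1 - p/2) * (1 / \<theta>0 * W)"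
      unfolding c2 c1 by (simp add: field_simps)
    also have "\<dots> = (1 + 2 / (1 - p/2)) * (D powr (2 / p - 1) * s)"
      unfolding a1 a2 by (simp add: algebra_simps)
    also have "2 / (1 - p/2) = 4 / (2 - p)" using p by (simp add: field_simps)
    finally show ?thesis unfolding b[symmetric] by (simp add: mult_ac)
  qed
  finally show ?thesis .
qed

section \<open>The Hardy--Littlewood--Sobolev inequality\<close>

text \<open>The split is at distance \<open>e\<close>, the measure of \<open>E\<close> itself. The
  near part is at most the integral of the kernel over an interval of radius \<open>e\<close>; in
  the far part the kernel is at most \<open>e powr (-\<beta>)\<close> on a set of measure
  \<open>e\<close>. Both are multiples of \<open>e powr (1 - \<beta>)\<close>.\<close>

lemma nn_integral_riesz_kernel_le:
  fixes \<beta> e t :: real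
  assumes \<beta>: "0 < \<beta>" "\<beta> < 1" and e: "e \<ge> 0"
    and [measurable]: "E \<in> sets borel" and E: "emeasure lborel E = ennreal e"
  shows "(\<integral>\<^sup>+s. indicator E s * ennreal (\<bar>t - s\<bar> powr (-\<beta>)) \<partial>lborel) \<le> ennreal ((2 / (1 - \<beta>) + 1) * e powr (1 - \<beta>))"
proof (cases "e = 0")
  case True
  then have "E \<in> null_sets lborel" using E by auto
  then have ae: "AE s in lborel. s \<notin> E" by (rule AE_not_in)
  have "(\<integral>\<^sup>+s. indicator E s * ennreal (\<bar>t - s\<bar> powr (-\<beta>)) \<partial>lborel) = (\<integral>\<^sup>+s. 0 \<partial>(lborel :: real measure))"
    by (intro nn_integral_cong_AE eventually_mono[OF ae]) auto
  then show ?thesis by simp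
next
  case False
  then have e0: "e > 0" using e by simp
  let ?k = "\<lambda>u. indicator {..<e} u * indicator {0<..} u * ennreal (u powr (-\<beta>)) :: ennreal"
  have k: "(\<integral>\<^sup>+u. ?k u \<partial>lborel) = ennreal (e powr (1 - \<beta>) / (1 - \<beta>))"
  proof -
    have "(\<integral>\<^sup>+u. ?k u \<partial>lborel) = (\<integral>\<^sup>+x. indicator {..<e} x \<partial>pmeas (-\<beta>))"
      by (subst nn_integral_pmeas, simp, intro nn_integral_cong) (auto simp: indicator_def)
    also have "\<dots> = ennreal (e powr (1 - \<beta>) / (1 - \<beta>))"
      using \<beta> e by (subst nn_integral_pmeas_lessThan) auto
    finally show ?thesis .
  qed
  have k1: "(\<integral>\<^sup>+s. ?k (s - t) \<partial>lborel) = ennreal (e powr (1 - \<beta>) / (1 - \<beta>))"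
    using nn_integral_real_affine[of ?k 1 "-t"] k by (simp add: algebra_simps)
  have k2: "(\<integral>\<^sup>+s. ?k (t - s) \<partial>lborel) = ennreal (e powr (1 - \<beta>) / (1 - \<beta>))"
    using nn_integral_real_affine[of ?k "-1" t] k by (simp add: algebra_simps)
  have "(\<integral>\<^sup>+s. indicator E s * ennreal (\<bar>t - s\<bar> powr (-\<beta>)) \<partial>lborel)
      \<le> (\<integral>\<^sup>+s. (?k (s - t) + ?k (t - s)) + ennreal (e powr (-\<beta>)) * indicator E s \<partial>lborel)"
  proof (intro nn_integral_mono)
    fix s
    show "indicator E s * ennreal (\<bar>t - s\<bar> powr (-\<beta>)) \<le> (?k (s - t) + ?k (t - s)) + ennreal (e powr (-\<beta>)) * indicator E s"
    proof (cases "\<bar>t - s\<bar> < e")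
      case True
      then have "ennreal (\<bar>t - s\<bar> powr (-\<beta>)) \<le> ?k (s - t) + ?k (t - s)"
        by (cases s t rule: linorder_cases) (auto simp: indicator_def)
      then show ?thesis by (auto simp: indicator_def intro: add_increasing2)
    next
      case False
      then have "\<bar>t - s\<bar> powr (-\<beta>) \<le> e powr (-\<beta>)"
        using e0 \<beta> by (intro powr_mono2') auto
      then have "ennreal (\<bar>t - s\<bar> powr (-\<beta>)) \<le> ennreal (e powr (-\<beta>))"
        by (rule ennreal_leI)
      then show ?thesis by (auto simp: indicator_def intro: add_increasing)
    qed
  qed
  also have "\<dots> = ennreal (e powr (1 - \<beta>) / (1 - \<beta>)) + ennreal (e powr (1 - \<beta>) / (1 - \<beta>)) + ennreal (e powr (-\<beta>)) * ennreal e"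
    by (simp add: nn_integral_add nn_integral_cmult k1 k2 E)
  also have "\<dots> = ennreal (e powr (1 - \<beta>) / (1 - \<beta>) + e powr (1 - \<beta>) / (1 - \<beta>) + e powr (-\<beta>) * e)"
    using e \<beta> by (subst ennreal_mult[symmetric], simp, simp, subst ennreal_plus[symmetric]; simp)
  also have "e powr (-\<beta>) * e = e powr (1 - \<beta>)"
    using e0 by (simp add: powr_diff powr_minus field_simps)
  also have "e powr (1 - \<beta>) / (1 - \<beta>) + e powr (1 - \<beta>) / (1 - \<beta>) + e powr (1 - \<beta>) = (2 / (1 - \<beta>) + 1) * e powr (1 - \<beta>)"
    by (simp add: distrib_right)
  finally show ?thesis .
qed

text \<open>Young's inequality with weights \<open>1 - \<beta>\<close> and \<open>\<beta>\<close>
  for \<open>x * y\<close> and a power of \<open>y\<close> chosen so that \<open>y\<close> cancels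
  in the product. It trades a sublinear power of a distribution function for the function itself,
  whose weighted integral is known; \<open>y\<close> stays free and will depend on the
  level.\<close>

lemma powr_le_weighted:
  fixes \<beta> x y :: real
  assumes "0 < \<beta>" "\<beta> < 1" "x \<ge> 0" "y > 0"
  shows "x powr (1 - \<beta>) \<le> x * y + y powr (- (1 - \<beta>) / \<beta>)"
proof (cases "x = 0")
  case False
  define Y where "Y = y powr (- (1 - \<beta>) / \<beta>)"
  have Y: "Y > 0" using assms by (simp add: Y_def)
  have "(x * y) powr (1 - \<beta>) * Y powr \<beta> \<le> (1 - \<beta>) * (x * y) + \<beta> * Y"
    using assms False Y by (intro Youngs_inequality_0) auto
  also have "\<dots> \<le> 1 * (x * y) + 1 * Y"
    using assms Y by (intro add_mono mult_right_mono) auto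
  also have "(x * y) powr (1 - \<beta>) * Y powr \<beta> = x powr (1 - \<beta>) * (y powr (1 - \<beta>) * y powr (- (1 - \<beta>)))"
    using assms by (simp add: Y_def powr_mult powr_powr)
  also have "y powr (1 - \<beta>) * y powr (- (1 - \<beta>)) = 1"
    using assms by (simp flip: powr_add)
  finally show ?thesis by (simp add: Y_def)
qed auto

text \<open>Both copies of \<open>h\<close> are written as integrals of indicators of superlevel
  sets, so that only the interaction \<open>J a b\<close> of two sets has to be bounded, by the
  previous kernel estimate. Here \<open>V\<close> bounds the p-th power of the norm of
  \<open>h\<close> with p = 2 / (2 - \<beta>), so \<open>V powr (2 - \<beta>)\<close> corresponds to
  the square of that norm.\<close>

lemma hardy_littlewood_sobolev_diagonal:
  fixes \<beta> V :: real and h :: "real \<Rightarrow> real"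
  assumes \<beta>: "0 < \<beta>" "\<beta> < 1" and [measurable]: "h \<in> borel_measurable borel"
    and h0: "\<And>t. h t \<ge> 0" and V0: "V \<ge> 0"
    and V: "(\<integral>\<^sup>+t. ennreal (h t powr (2 / (2 - \<beta>))) \<partial>lborel) \<le> ennreal V"
  shows "(\<integral>\<^sup>+t. \<integral>\<^sup>+s. ennreal (h t * h s * \<bar>t - s\<bar> powr (-\<beta>)) \<partial>lborel \<partial>lborel)
     \<le> ennreal (2 * (2 / (1 - \<beta>) + 1) * (3 - \<beta>) * V powr (2 - \<beta>))"
proof (cases "V = 0")
  case True
  then have "AE t in lborel. h t powr (2 / (2 - \<beta>)) = 0"
    using V by (simp add: nn_integral_0_iff_AE)
  then have ae: "AE t in lborel. h t = 0" by simp
  have "(\<integral>\<^sup>+t. \<integral>\<^sup>+s. ennreal (h t * h s * \<bar>t - s\<bar> powr (-\<beta>)) \<partial>lborel \<partial>lborel) = (\<integral>\<^sup>+t. 0 \<partial>(lborel :: real measure))"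
    by (intro nn_integral_cong_AE eventually_mono[OF ae]) auto
  then show ?thesis by simp
next
  case False
  then have Vp: "V > 0" using V0 by simp
  define p where "p = 2 / (2 - \<beta>)"
  have p: "p > 1" "p - 1 = \<beta> / (2 - \<beta>)" "p > 0" using \<beta> by (auto simp: p_def field_simps)
  define K where "K = 2 / (1 - \<beta>) + 1"
  have K: "K > 0" using \<beta> by (simp add: K_def add_pos_pos)
  define v where "v = (\<lambda>a. measure lborel {t. a < h t})"
  \<comment> \<open>Chebyshev's inequality makes the superlevel sets finite. Otherwise the
    real-valued \<open>measure\<close> would be 0 by convention on a set of infinite measure, and
    \<open>v\<close> would not be the distribution function.\<close>
  have ev: "emeasure lborel {t. a < h t} = ennreal (v a)" if "a > 0" for a
  proof -
    have "emeasure lborel {t. a < h t} \<le> emeasure lborel {t \<in> space lborel. 1 \<le> ennreal (a powr (-p)) * ennreal (h t powr p)}"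
    proof (intro emeasure_mono subsetI)
      fix t assume "t \<in> {t. a < h t}"
      then have "1 \<le> (h t / a) powr p" using that p by (intro ge_one_powr_ge_zero) auto
      also have "\<dots> = a powr (-p) * h t powr p" using that h0[of t] by (simp add: powr_divide powr_minus field_simps)
      finally show "t \<in> {t \<in> space lborel. 1 \<le> ennreal (a powr (-p)) * ennreal (h t powr p)}"
        by (simp flip: ennreal_mult ennreal_1)
    qed auto
    also have "\<dots> \<le> ennreal (a powr (-p)) * (\<integral>\<^sup>+t. ennreal (h t powr p) * indicator UNIV t \<partial>lborel)"
      using nn_integral_Markov_inequality[of "\<lambda>t. ennreal (h t powr p)" UNIV lborel "ennreal (a powr (-p))"] by simp
    also have "\<dots> \<le> ennreal (a powr (-p)) * ennreal V"
      using V by (intro mult_left_mono) (auto simp: p_def)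
    also have "\<dots> < \<infinity>" by (simp add: ennreal_mult_less_top)
    finally show ?thesis unfolding v_def by (intro emeasure_eq_ennreal_measure) auto
  qed
  have v0: "v a \<ge> 0" for a by (simp add: v_def)
  have [measurable]: "v \<in> borel_measurable borel"
  proof -
    have "(\<lambda>a. measure lborel {t. a < h t}) = (\<lambda>a. enn2real (\<integral>\<^sup>+t. indicator {t. a < h t} t \<partial>lborel))"
      by (simp add: measure_def)
    also have "\<dots> \<in> borel_measurable borel"
    proof -
      have "(\<lambda>(a, t). indicator {t. a < h t} t :: ennreal) = (\<lambda>z. if fst z < h (snd z) then 1 else 0)"
        by (auto simp: fun_eq_iff)
      then have "(\<lambda>(a, t). indicator {t. a < h t} t :: ennreal) \<in> borel_measurable (borel \<Otimes>\<^sub>M lborel)"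
        by simp
      then show ?thesis by measurable
    qed
    finally show ?thesis unfolding v_def .
  qed
  have vV: "(\<integral>\<^sup>+a. ennreal (v a) \<partial>pmeas (p - 1)) \<le> ennreal V"
  proof -
    have "(\<integral>\<^sup>+a. ennreal (v a) \<partial>pmeas (p - 1)) = (\<integral>\<^sup>+a. emeasure lborel {x \<in> space lborel. a < h x} \<partial>pmeas (p - 1))"
      by (intro nn_integral_cong_AE eventually_mono[OF AE_pmeas_pos]) (simp add: ev)
    also have "\<dots> = (\<integral>\<^sup>+x. ennreal (h x powr p / p) \<partial>lborel)"
      using p h0 by (intro nn_integral_layer_cake) (auto simp: sigma_finite_lborel)
    also have "\<dots> \<le> (\<integral>\<^sup>+x. ennreal (h x powr p) \<partial>lborel)"
      using p by (intro nn_integral_mono ennreal_leI) (auto simp: divide_le_eq mult_le_cancel_left1)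
    also have "\<dots> \<le> ennreal V" using V by (simp add: p_def)
    finally show ?thesis .
  qed
  define k where "k = (\<lambda>a t. indicator {..<h t} a :: ennreal)"
  have [measurable]: "case_prod k \<in> borel_measurable (borel \<Otimes>\<^sub>M borel)"
  proof -
    have "case_prod k = (\<lambda>z. if fst z < h (snd z) then 1 else 0)"
      by (auto simp: fun_eq_iff k_def)
    then show ?thesis by simp
  qed
  have [measurable (raw)]: "(\<lambda>x. k (f x) (g x)) \<in> borel_measurable N"
    if [measurable]: "f \<in> borel_measurable N" "g \<in> borel_measurable N" for f g and N :: "'z measure"
    by measurable
  let ?K = "\<lambda>t s. ennreal (\<bar>t - s\<bar> powr (-\<beta>))"
  have hk: "ennreal (h t) = (\<integral>\<^sup>+a. k a t \<partial>pmeas 0)" for t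
    using nn_integral_pmeas_lessThan[of 0 "h t"] h0[of t] by (simp add: k_def)
  define J where "J = (\<lambda>a b. \<integral>\<^sup>+t. \<integral>\<^sup>+s. k a t * (k b s * ?K t s) \<partial>lborel \<partial>lborel)"
  have [measurable]: "case_prod J \<in> borel_measurable (borel \<Otimes>\<^sub>M borel)"
    unfolding J_def by measurable
  have eq: "(\<integral>\<^sup>+t. \<integral>\<^sup>+s. ennreal (h t * h s * \<bar>t - s\<bar> powr (-\<beta>)) \<partial>lborel \<partial>lborel) = (\<integral>\<^sup>+a. \<integral>\<^sup>+b. J a b \<partial>pmeas 0 \<partial>pmeas 0)"
  proof -
    have "(\<integral>\<^sup>+t. \<integral>\<^sup>+s. ennreal (h t * h s * \<bar>t - s\<bar> powr (-\<beta>)) \<partial>lborel \<partial>lborel)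
      = (\<integral>\<^sup>+t. \<integral>\<^sup>+s. \<integral>\<^sup>+a. \<integral>\<^sup>+b. k a t * (k b s * ?K t s) \<partial>pmeas 0 \<partial>pmeas 0 \<partial>lborel \<partial>lborel)"
      by (simp add: ennreal_mult h0 hk nn_integral_cmult nn_integral_multc mult.assoc)
    also have "\<dots> = (\<integral>\<^sup>+t. \<integral>\<^sup>+a. \<integral>\<^sup>+s. \<integral>\<^sup>+b. k a t * (k b s * ?K t s) \<partial>pmeas 0 \<partial>lborel \<partial>pmeas 0 \<partial>lborel)"
      by (intro nn_integral_cong lborel_pmeas_pair.Fubini'[symmetric]) measurable
    also have "\<dots> = (\<integral>\<^sup>+a. \<integral>\<^sup>+t. \<integral>\<^sup>+s. \<integral>\<^sup>+b. k a t * (k b s * ?K t s) \<partial>pmeas 0 \<partial>lborel \<partial>lborel \<partial>pmeas 0)"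
      by (intro lborel_pmeas_pair.Fubini'[symmetric]) measurable
    also have "\<dots> = (\<integral>\<^sup>+a. \<integral>\<^sup>+t. \<integral>\<^sup>+b. \<integral>\<^sup>+s. k a t * (k b s * ?K t s) \<partial>lborel \<partial>pmeas 0 \<partial>lborel \<partial>pmeas 0)"
      by (intro nn_integral_cong lborel_pmeas_pair.Fubini'[symmetric]) measurable
    also have "\<dots> = (\<integral>\<^sup>+a. \<integral>\<^sup>+b. \<integral>\<^sup>+t. \<integral>\<^sup>+s. k a t * (k b s * ?K t s) \<partial>lborel \<partial>lborel \<partial>pmeas 0 \<partial>pmeas 0)"
      by (intro nn_integral_cong lborel_pmeas_pair.Fubini'[symmetric]) measurable
    finally show ?thesis by (simp add: J_def)
  qed
  have J1: "J a b \<le> ennreal K * (ennreal (v a) * ennreal (v b powr (1 - \<beta>)))" if ab: "a > 0" "b > 0" for a b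
  proof -
    have "J a b = (\<integral>\<^sup>+t. k a t * (\<integral>\<^sup>+s. k b s * ?K t s \<partial>lborel) \<partial>lborel)"
      unfolding J_def by (intro nn_integral_cong nn_integral_cmult) measurable
    also have "\<dots> \<le> (\<integral>\<^sup>+t. k a t * ennreal (K * v b powr (1 - \<beta>)) \<partial>lborel)"
    proof (intro nn_integral_mono mult_left_mono)
      fix t
      have "(\<integral>\<^sup>+s. k b s * ?K t s \<partial>lborel) = (\<integral>\<^sup>+s. indicator {s. b < h s} s * ?K t s \<partial>lborel)"
        by (intro nn_integral_cong) (auto simp: k_def indicator_def)
      also have "\<dots> \<le> ennreal (K * v b powr (1 - \<beta>))"
        unfolding K_def using ev[OF ab(2)] by (intro nn_integral_riesz_kernel_le \<beta> v0) auto
      finally show "(\<integral>\<^sup>+s. k b s * ?K t s \<partial>lborel) \<le> ennreal (K * v b powr (1 - \<beta>))" .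
    qed auto
    also have "\<dots> = (\<integral>\<^sup>+t. indicator {t. a < h t} t \<partial>lborel) * ennreal (K * v b powr (1 - \<beta>))"
      by (subst nn_integral_multc, simp, intro arg_cong2[of _ _ _ _ "(*)"] nn_integral_cong)
         (auto simp: k_def indicator_def)
    also have "\<dots> = ennreal K * (ennreal (v a) * ennreal (v b powr (1 - \<beta>)))"
      using K ev[OF ab(1)] by (simp add: ennreal_mult mult_ac)
    finally show ?thesis .
  qed
  have Jsym: "J a b = J b a" for a b
  proof -
    have "J a b = (\<integral>\<^sup>+s. \<integral>\<^sup>+t. k a t * (k b s * ?K t s) \<partial>lborel \<partial>lborel)"
      unfolding J_def by (rule lborel_pair.Fubini'[symmetric]) measurable
    also have "\<dots> = J b a" unfolding J_def
      by (simp add: abs_minus_commute mult_ac)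
    finally show ?thesis .
  qed
  \<comment> \<open>By symmetry of \<open>J\<close> half of the quadrant suffices. The half
    \<open>b \<le> a\<close> is the useful one: the lowered power \<open>1 - \<beta>\<close> then
    falls on the larger of the two superlevel sets.\<close>
  define G where "G = (\<lambda>a b. J a b * indicator {..a} b)"
  have [measurable]: "case_prod G \<in> borel_measurable (borel \<Otimes>\<^sub>M borel)"
  proof -
    have "case_prod G = (\<lambda>z. if snd z \<le> fst z then J (fst z) (snd z) else 0)"
      by (auto simp: fun_eq_iff G_def)
    then show ?thesis by simp
  qed
  have G: "(\<integral>\<^sup>+a. \<integral>\<^sup>+b. G a b \<partial>pmeas 0 \<partial>pmeas 0) \<le> ennreal (K * (3 - \<beta>) * V powr (2 - \<beta>))"
  proof -
    have inner: "(\<integral>\<^sup>+b. G a b \<partial>pmeas 0) \<le> ennreal (K * (3 - \<beta>) * V powr (1 - \<beta>)) * (ennreal (a powr (p - 1)) * ennreal (v a))"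
      if a: "a > 0" for a
    proof -
      \<comment> \<open>Young's inequality is applied with
        \<open>y = \<mu> * b powr (p - 1)\<close>. This turns the linear term into the integral
        bounded by \<open>V\<close> and the other term into the integrable power
        \<open>b powr e\<close>. The factor \<open>\<mu>\<close> makes both contributions multiples
        of \<open>V powr (1 - \<beta>) * a powr (p - 1)\<close>, with coefficients 1 and
        \<open>1 / (e + 1) = 2 - \<beta>\<close>; hence the constant
        \<open>3 - \<beta>\<close>.\<close>
      define \<mu> where "\<mu> = a powr (p - 1) * V powr (-\<beta>)"
      have \<mu>: "\<mu> > 0" using a Vp by (simp add: \<mu>_def)
      define e where "e = - (1 - \<beta>) / (2 - \<beta>)"
      have e: "(p - 1) * (- (1 - \<beta>) / \<beta>) = e" "e > -1"
        using \<beta> by (auto simp: p(2) e_def field_simps)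
      define c where "c = \<mu> powr (- (1 - \<beta>) / \<beta>)"
      have c: "c = a powr e * V powr (1 - \<beta>)"
        using a Vp \<beta> e by (simp add: c_def \<mu>_def powr_mult powr_powr)
      have "(\<integral>\<^sup>+b. ennreal (v b powr (1 - \<beta>)) * indicator {..a} b \<partial>pmeas 0)
        \<le> (\<integral>\<^sup>+b. ennreal \<mu> * (ennreal (b powr (p - 1)) * ennreal (v b)) + ennreal c * (ennreal (b powr e) * indicator {..<a} b) \<partial>pmeas 0)"
      proof (intro nn_integral_mono_AE)
        \<comment> \<open>The half-quadrant has \<open>b \<le> a\<close>, whereas the power integral
          is available for \<open>b < a\<close>; the difference is a null set.\<close>
        have "AE b in lborel. b \<noteq> a" by (rule AE_lborel_singleton)
        then have "AE b in pmeas 0. b \<noteq> a" unfolding pmeas_def by (subst AE_density) auto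
        with AE_pmeas_pos show "AE b in pmeas 0. ennreal (v b powr (1 - \<beta>)) * indicator {..a} b
           \<le> ennreal \<mu> * (ennreal (b powr (p - 1)) * ennreal (v b)) + ennreal c * (ennreal (b powr e) * indicator {..<a} b)"
        proof eventually_elim
          case (elim b)
          have "v b powr (1 - \<beta>) \<le> v b * (\<mu> * b powr (p - 1)) + (\<mu> * b powr (p - 1)) powr (- (1 - \<beta>) / \<beta>)"
            using elim \<mu> v0 \<beta> by (intro powr_le_weighted) auto
          also have "(\<mu> * b powr (p - 1)) powr (- (1 - \<beta>) / \<beta>) = c * b powr e"
            using elim \<mu> e by (simp add: c_def powr_mult powr_powr)
          finally have "ennreal (v b powr (1 - \<beta>)) \<le> ennreal (v b * (\<mu> * b powr (p - 1)) + c * b powr e)"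
            by (rule ennreal_leI)
          also have "\<dots> = ennreal \<mu> * (ennreal (b powr (p - 1)) * ennreal (v b)) + ennreal c * ennreal (b powr e)"
            using \<mu> v0[of b] by (simp add: ennreal_mult c_def mult_ac)
          finally show ?case using elim by (cases "b < a") (auto simp: indicator_def)
        qed
      qed
      also have "\<dots> = ennreal \<mu> * (\<integral>\<^sup>+b. ennreal (v b) \<partial>pmeas (p - 1)) + ennreal c * (\<integral>\<^sup>+b. indicator {..<a} b \<partial>pmeas e)"
        using nn_integral_pmeas_shift[of "\<lambda>b. ennreal (v b)" "p - 1" 0] nn_integral_pmeas_shift[of "indicator {..<a}" e 0]
        by (simp add: nn_integral_add nn_integral_cmult)
      also have "\<dots> \<le> ennreal \<mu> * ennreal V + ennreal c * ennreal (a powr (e + 1) / (e + 1))"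
        using a e by (intro add_mono mult_left_mono vV) (auto simp: nn_integral_pmeas_lessThan simp del: nn_integral_indicator)
      also have "\<dots> = ennreal (\<mu> * V + c * (a powr (e + 1) / (e + 1)))"
      proof -
        have "ennreal x * ennreal y + ennreal z * ennreal w = ennreal (x * y + z * w)"
          if "x \<ge> 0" "y \<ge> 0" "z \<ge> 0" "w \<ge> 0" for x y z w
          using that by (simp add: ennreal_mult)
        then show ?thesis using \<mu> Vp e by (simp add: c_def)
      qed
      also have "\<mu> * V + c * (a powr (e + 1) / (e + 1)) = (3 - \<beta>) * V powr (1 - \<beta>) * a powr (p - 1)"
      proof -
        have m1: "\<mu> * V = V powr (1 - \<beta>) * a powr (p - 1)"
          using Vp by (simp add: \<mu>_def powr_diff powr_minus field_simps)
        have m2: "c * (a powr (e + 1) / (e + 1)) = (2 - \<beta>) * V powr (1 - \<beta>) * (a powr e * a powr (e + 1))"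
        proof -
          have "e + 1 = 1 / (2 - \<beta>)" using \<beta> by (simp add: e_def field_simps)
          then show ?thesis unfolding c by simp
        qed
        have m3: "a powr e * a powr (e + 1) = a powr (p - 1)"
          using \<beta> by (simp add: e_def p(2) field_simps flip: powr_add)
        show ?thesis unfolding m1 m2 m3 by (simp add: algebra_simps)
      qed
      finally have vb: "(\<integral>\<^sup>+b. ennreal (v b powr (1 - \<beta>)) * indicator {..a} b \<partial>pmeas 0) \<le> ennreal ((3 - \<beta>) * V powr (1 - \<beta>) * a powr (p - 1))" .
      have "(\<integral>\<^sup>+b. G a b \<partial>pmeas 0) \<le> (\<integral>\<^sup>+b. ennreal K * ennreal (v a) * (ennreal (v b powr (1 - \<beta>)) * indicator {..a} b) \<partial>pmeas 0)"
        unfolding G_def using a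
        by (intro nn_integral_mono_AE eventually_mono[OF AE_pmeas_pos])
           (auto simp: indicator_def mult.assoc intro!: J1)
      also have "\<dots> = ennreal K * ennreal (v a) * (\<integral>\<^sup>+b. ennreal (v b powr (1 - \<beta>)) * indicator {..a} b \<partial>pmeas 0)"
        by (rule nn_integral_cmult) simp
      also have "\<dots> \<le> ennreal K * ennreal (v a) * ennreal ((3 - \<beta>) * V powr (1 - \<beta>) * a powr (p - 1))"
        by (intro mult_left_mono vb) auto
      also have "\<dots> = ennreal (K * (3 - \<beta>) * V powr (1 - \<beta>)) * (ennreal (a powr (p - 1)) * ennreal (v a))"
        using K \<beta> v0[of a] by (simp add: mult_ac flip: ennreal_mult)
      finally show ?thesis .
    qed
    have "(\<integral>\<^sup>+a. \<integral>\<^sup>+b. G a b \<partial>pmeas 0 \<partial>pmeas 0) \<le> (\<integral>\<^sup>+a. ennreal (K * (3 - \<beta>) * V powr (1 - \<beta>)) * (ennreal (a powr (p - 1)) * ennreal (v a)) \<partial>pmeas 0)"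
      by (intro nn_integral_mono_AE eventually_mono[OF AE_pmeas_pos] inner)
    also have "\<dots> = ennreal (K * (3 - \<beta>) * V powr (1 - \<beta>)) * (\<integral>\<^sup>+a. ennreal (v a) \<partial>pmeas (p - 1))"
      using nn_integral_pmeas_shift[of "\<lambda>b. ennreal (v b)" "p - 1" 0] by (simp add: nn_integral_cmult)
    also have "\<dots> \<le> ennreal (K * (3 - \<beta>) * V powr (1 - \<beta>)) * ennreal V"
      by (intro mult_left_mono vV) auto
    also have "\<dots> = ennreal (K * (3 - \<beta>) * V powr (2 - \<beta>))"
      using K \<beta> Vp by (simp add: powr_diff power2_eq_square flip: ennreal_mult)
    finally show ?thesis .
  qed
  have "(\<integral>\<^sup>+a. \<integral>\<^sup>+b. J a b \<partial>pmeas 0 \<partial>pmeas 0) \<le> (\<integral>\<^sup>+a. \<integral>\<^sup>+b. G a b + G b a \<partial>pmeas 0 \<partial>pmeas 0)"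
  proof (intro nn_integral_mono)
    fix a b show "J a b \<le> G a b + G b a"
      by (cases "b \<le> a") (auto simp: G_def Jsym[of b a])
  qed
  also have "\<dots> = (\<integral>\<^sup>+a. \<integral>\<^sup>+b. G a b \<partial>pmeas 0 \<partial>pmeas 0) + (\<integral>\<^sup>+a. \<integral>\<^sup>+b. G b a \<partial>pmeas 0 \<partial>pmeas 0)"
    by (simp add: nn_integral_add)
  also have "(\<integral>\<^sup>+a. \<integral>\<^sup>+b. G b a \<partial>pmeas 0 \<partial>pmeas 0) = (\<integral>\<^sup>+b. \<integral>\<^sup>+a. G b a \<partial>pmeas 0 \<partial>pmeas 0)"
    by (rule pmeas_pair.Fubini'[symmetric]) measurable
  also have "(\<integral>\<^sup>+a. \<integral>\<^sup>+b. G a b \<partial>pmeas 0 \<partial>pmeas 0) + (\<integral>\<^sup>+b. \<integral>\<^sup>+a. G b a \<partial>pmeas 0 \<partial>pmeas 0)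
     \<le> ennreal (K * (3 - \<beta>) * V powr (2 - \<beta>)) + ennreal (K * (3 - \<beta>) * V powr (2 - \<beta>))"
    by (intro add_mono G)
  also have "\<dots> = ennreal (2 * K * (3 - \<beta>) * V powr (2 - \<beta>))"
    using K \<beta> by (simp flip: ennreal_plus)
  finally show ?thesis unfolding eq K_def .
qed

section \<open>Gaussian moments\<close>

lemma has_sum_integral_nat:
  fixes f :: "nat \<Rightarrow> 'a \<Rightarrow> complex"
  assumes "\<And>i. integrable M (f i)"
    and "summable (\<lambda>i. \<integral>x. norm (f i x) \<partial>M)"
    and S: "\<And>x. x \<in> space M \<Longrightarrow> ((\<lambda>i. f i x) has_sum S x) UNIV"
  shows "((\<lambda>i. \<integral>x. f i x \<partial>M) has_sum (\<integral>x. S x \<partial>M)) UNIV" "integrable M S"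
proof -
  have sm: "summable (\<lambda>i. norm (f i x))" if "x \<in> space M" for x
  proof -
    have "(\<lambda>i. f i x) summable_on UNIV" using S[OF that] by (rule has_sum_imp_summable)
    then show ?thesis
      by (auto simp: summable_on_iff_abs_summable_on_complex intro: summable_on_imp_summable)
  qed
  have eq: "S x = (\<Sum>i. f i x)" if "x \<in> space M" for x
    using has_sum_imp_sums[OF S[OF that]] by (rule sums_unique)
  have "(\<lambda>i. \<integral>x. f i x \<partial>M) sums (\<integral>x. (\<Sum>i. f i x) \<partial>M)"
    using assms sm by (intro sums_integral) auto
  also have "(\<integral>x. (\<Sum>i. f i x) \<partial>M) = (\<integral>x. S x \<partial>M)"
    by (intro Bochner_Integration.integral_cong) (simp_all add: eq)
  finally have "(\<lambda>i. \<integral>x. f i x \<partial>M) sums (\<integral>x. S x \<partial>M)" .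
  moreover have "summable (\<lambda>i. norm (\<integral>x. f i x \<partial>M))"
    by (rule summable_comparison_test[OF _ assms(2)]) (auto intro: integral_norm_bound)
  ultimately show "((\<lambda>i. \<integral>x. f i x \<partial>M) has_sum (\<integral>x. S x \<partial>M)) UNIV"
    by (intro norm_summable_imp_has_sum)
  have "integrable M (\<lambda>x. \<Sum>i. f i x)"
    using assms sm by (intro integrable_suminf) auto
  then show "integrable M S"
    by (rule Bochner_Integration.integrable_cong[THEN iffD1, rotated -1]) (simp_all add: eq)
qed

text \<open>Termwise integration is a statement about sequences. Since \<open>has_sum\<close> is
  unconditional, it can be transported along the bijection \<open>prod_decode\<close>.\<close>

lemma has_sum_integral_nat_prod:
  fixes f :: "nat \<times> nat \<Rightarrow> 'a \<Rightarrow> complex"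
  assumes "\<And>i. integrable M (f i)"
    and "(\<lambda>i. \<integral>x. norm (f i x) \<partial>M) summable_on UNIV"
    and S: "\<And>x. x \<in> space M \<Longrightarrow> ((\<lambda>i. f i x) has_sum S x) UNIV"
  shows "((\<lambda>i. \<integral>x. f i x \<partial>M) has_sum (\<integral>x. S x \<partial>M)) UNIV" "integrable M S"
proof -
  have b: "bij_betw prod_decode UNIV UNIV" by (rule bij_prod_decode)
  have 2: "summable (\<lambda>i. \<integral>x. norm (f (prod_decode i) x) \<partial>M)"
    using assms(2) unfolding summable_on_reindex_bij_betw[OF b, symmetric]
    by (rule summable_on_imp_summable)
  have 3: "((\<lambda>i. f (prod_decode i) x) has_sum S x) UNIV" if "x \<in> space M" for x
    using S[OF that] by (subst has_sum_reindex_bij_betw[OF b])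
  note * = has_sum_integral_nat[where f = "\<lambda>i. f (prod_decode i)" and S = S, OF assms(1) 2]
  show "((\<lambda>i. \<integral>x. f i x \<partial>M) has_sum (\<integral>x. S x \<partial>M)) UNIV"
    using *(1)[OF 3] has_sum_reindex_bij_betw[OF b, where f = "\<lambda>i. \<integral>x. f i x \<partial>M"] by simp
  show "integrable M S" using *(2)[OF 3] by simp
qed

text \<open>The substitution u = c x^2 in Euler's integral for Gamma.\<close>

lemma nn_integral_gaussian_pmeas:
  assumes "c > 0" "s > 0"
  shows "(\<integral>\<^sup>+\<xi>. ennreal (exp (- c * \<xi>\<^sup>2)) \<partial>pmeas (2 * s - 1)) = ennreal (Gamma s * c powr (- s) / 2)"
proof -
  let ?f = "\<lambda>u. u powr (s - 1) * exp (- u)"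
  have "(?f has_integral Gamma s) {0..}"
    using Gamma_integral_real[OF assms(2)] by (simp add: exp_minus divide_inverse)
  then have i: "(?f has_integral Gamma s) {0<..}"
    by (subst has_integral_spike_set_eq[of _ "{0..}"]) (auto intro: negligible_subset[of "{0}"])
  then have a: "?f absolutely_integrable_on {0<..}"
    by (intro nonnegative_absolutely_integrable_1) (auto simp: integrable_on_def)
  have img: "(\<lambda>x. c * x\<^sup>2) ` {0<..} = {0<..}"
  proof (intro equalityI subsetI)
    fix u :: real assume "u \<in> {0<..}"
    then have "u = c * (sqrt (u / c))\<^sup>2" "sqrt (u / c) \<in> {0<..}" using assms by auto
    then show "u \<in> (\<lambda>x. c * x\<^sup>2) ` {0<..}" by blast
  qed (use assms in auto)
  have "(\<lambda>x. \<bar>2 * c * x\<bar> * ?f (c * x\<^sup>2)) absolutely_integrable_on {0<..} \<and>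
      integral {0<..} (\<lambda>x. \<bar>2 * c * x\<bar> * ?f (c * x\<^sup>2)) = Gamma s"
  proof (subst has_absolute_integral_change_of_variables_1'[where g = "\<lambda>x. c * x\<^sup>2"])
    show "((\<lambda>x. c * x\<^sup>2) has_real_derivative 2 * c * x) (at x within {0<..})" for x
      by (auto intro!: derivative_eq_intros)
    show "inj_on (\<lambda>x. c * x\<^sup>2) {0<..}" using assms by (auto intro!: inj_onI)
    show "?f absolutely_integrable_on (\<lambda>x. c * x\<^sup>2) ` {0<..} \<and> integral ((\<lambda>x. c * x\<^sup>2) ` {0<..}) ?f = Gamma s"
      unfolding img using a i by (auto intro: integral_unique)
  qed auto
  then have "((\<lambda>x. \<bar>2 * c * x\<bar> * ?f (c * x\<^sup>2)) has_integral Gamma s) {0<..}"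
    using set_lebesgue_integral_eq_integral(1) by (auto simp: has_integral_iff)
  moreover have "\<bar>2 * c * x\<bar> * ?f (c * x\<^sup>2) = (2 * c powr s) * (x powr (2 * s - 1) * exp (- c * x\<^sup>2))" if "x > 0" for x
  proof -
    have "(c * x\<^sup>2) powr (s - 1) = c powr (s - 1) * x powr (2 * (s - 1))"
      using assms that by (simp add: powr_mult powr_powr flip: powr_numeral)
    moreover have "c powr s = c * c powr (s - 1)" "x powr (2 * s - 1) = x * x powr (2 * (s - 1))"
      using assms that by (simp_all add: powr_mult_base)
    ultimately show ?thesis using assms that by (simp only: abs_of_pos mult_pos_pos zero_less_numeral) (simp add: mult_ac)
  qed
  ultimately have "((\<lambda>x. (2 * c powr s) * (x powr (2 * s - 1) * exp (- c * x\<^sup>2))) has_integral Gamma s) {0<..}"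
    by (subst (asm) has_integral_cong[of "{0<..}"]) auto
  then have "((\<lambda>x. x powr (2 * s - 1) * exp (- c * x\<^sup>2)) has_integral (1 / (2 * c powr s)) * Gamma s) {0<..}"
    using assms by (elim has_integral_mult_right[where c = "1 / (2 * c powr s)", THEN back_subst[where P = "\<lambda>f. (f has_integral _) _"]]) auto
  then have "((\<lambda>x. if x \<in> {0<..} then x powr (2 * s - 1) * exp (- c * x\<^sup>2) else 0) has_integral (1 / (2 * c powr s)) * Gamma s) UNIV"
    by (subst has_integral_restrict_UNIV)
  then have "(\<integral>\<^sup>+x. ennreal (if x \<in> {0<..} then x powr (2 * s - 1) * exp (- c * x\<^sup>2) else 0) \<partial>lborel) = ennreal ((1 / (2 * c powr s)) * Gamma s)"
    by (intro nn_integral_has_integral_lborel) auto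
  also have "(\<integral>\<^sup>+x. ennreal (if x \<in> {0<..} then x powr (2 * s - 1) * exp (- c * x\<^sup>2) else 0) \<partial>lborel)
     = (\<integral>\<^sup>+\<xi>. ennreal (exp (- c * \<xi>\<^sup>2)) \<partial>pmeas (2 * s - 1))"
    by (subst nn_integral_pmeas, simp, intro nn_integral_cong) (auto simp: indicator_def ennreal_mult)
  also have "(1 / (2 * c powr s)) * Gamma s = Gamma s * c powr (- s) / 2"
    using assms by (simp add: powr_minus field_simps)
  finally show ?thesis .
qed

lemma integral_pmeas_shift:
  fixes f :: "real \<Rightarrow> 'b :: {banach, second_countable_topology}"
  assumes [measurable]: "f \<in> borel_measurable borel"
  shows "integral\<^sup>L (pmeas (c + d)) f = (\<integral>x. (x powr c) *\<^sub>R f x \<partial>pmeas d)"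
    and "integrable (pmeas (c + d)) f \<longleftrightarrow> integrable (pmeas d) (\<lambda>x. (x powr c) *\<^sub>R f x)"
proof -
  have eq: "(indicator {0<..} x * x powr (c + d)) *\<^sub>R f x = (indicator {0<..} x * x powr d) *\<^sub>R (x powr c) *\<^sub>R f x" for x
    by (auto simp: indicator_def powr_add mult_ac)
  show "integral\<^sup>L (pmeas (c + d)) f = (\<integral>x. (x powr c) *\<^sub>R f x \<partial>pmeas d)"
    unfolding pmeas_def by (subst (1 2) integral_density) (auto simp: eq)
  show "integrable (pmeas (c + d)) f \<longleftrightarrow> integrable (pmeas d) (\<lambda>x. (x powr c) *\<^sub>R f x)"
    unfolding pmeas_def by (subst (1 2) integrable_density) (auto simp: eq)
qed

lemma has_bochner_integral_gaussian_real:
  assumes "c > 0" "s > 0"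
  shows "has_bochner_integral (pmeas (2 * s - 1)) (\<lambda>\<xi>. exp (- c * \<xi>\<^sup>2) * \<xi> ^ (2 * n)) (Gamma (s + n) * c powr (- (s + n)) / 2)"
proof (rule has_bochner_integral_nn_integral)
  have "(\<integral>\<^sup>+\<xi>. ennreal (exp (- c * \<xi>\<^sup>2) * \<xi> ^ (2 * n)) \<partial>pmeas (2 * s - 1))
      = (\<integral>\<^sup>+\<xi>. ennreal (\<xi> powr real (2 * n)) * ennreal (exp (- c * \<xi>\<^sup>2)) \<partial>pmeas (2 * s - 1))"
    by (intro nn_integral_cong_AE eventually_mono[OF AE_pmeas_pos])
       (simp only: powr_realpow, simp add: mult.commute flip: ennreal_mult)
  also have "\<dots> = (\<integral>\<^sup>+\<xi>. ennreal (exp (- c * \<xi>\<^sup>2)) \<partial>pmeas (2 * (s + n) - 1))"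
    using nn_integral_pmeas_shift[of "\<lambda>\<xi>. ennreal (exp (- c * \<xi>\<^sup>2))" "real (2 * n)" "2 * s - 1"]
    by (simp add: algebra_simps)
  finally show "(\<integral>\<^sup>+\<xi>. ennreal (exp (- c * \<xi>\<^sup>2) * \<xi> ^ (2 * n)) \<partial>pmeas (2 * s - 1)) = ennreal (Gamma (s + n) * c powr (- (s + n)) / 2)"
    using assms nn_integral_gaussian_pmeas[of c "s + n"] by simp
qed (use assms in \<open>auto intro!: Gamma_real_nonneg\<close>)

text \<open>For complex \<open>z\<close>, expand \<open>exp (- z \<xi>\<^sup>2)\<close> about a real point \<open>c\<close> with \<open>\<bar>c - z\<bar> < c\<close> and sum the
  moments by the binomial series.\<close>

lemma has_bochner_integral_gaussian_complex:
  fixes z :: complex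
  assumes z: "Re z > 0" and s: "s > 0"
  shows "has_bochner_integral (pmeas (2 * s - 1)) (\<lambda>\<xi>. exp (- z * of_real (\<xi>\<^sup>2))) (of_real (Gamma s / 2) * z powr (- of_real s))"
proof -
  have z0: "z \<noteq> 0" using z by auto
  \<comment> \<open>For this \<open>c\<close> the cross term \<open>2 * c * Re z\<close> equals
    \<open>2 * (cmod z)\<^sup>2\<close>, so the squared distance from \<open>c\<close> to
    \<open>z\<close> is \<open>c\<^sup>2 - (cmod z)\<^sup>2\<close>. Every \<open>z\<close> in the
    right half-plane thus lies in a disc about a real centre that avoids 0.\<close>
  define c where "c = (cmod z)\<^sup>2 / Re z"
  have c: "c > 0" using z z0 by (simp add: c_def)
  define d where "d = of_real c - z"
  have d: "cmod d < c"
  proof -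
    have "(cmod d)\<^sup>2 = c\<^sup>2 - 2 * c * Re z + (cmod z)\<^sup>2"
      unfolding cmod_power2 d_def by (simp add: power2_eq_square algebra_simps)
    also have "\<dots> = c\<^sup>2 - (cmod z)\<^sup>2" using z by (simp add: c_def)
    also have "\<dots> < c\<^sup>2" using z0 by simp
    finally show ?thesis using c by (simp add: power_less_imp_less_base)
  qed
  let ?M = "pmeas (2 * s - 1)"
  let ?f = "\<lambda>n \<xi>. of_real (exp (- c * \<xi>\<^sup>2) * \<xi> ^ (2 * n)) * (d ^ n / fact n)"
  have int: "has_bochner_integral ?M (?f n) (of_real (Gamma (s + n) * c powr (- (s + n)) / 2) * (d ^ n / fact n))" for n
    by (intro has_bochner_integral_mult_left has_bochner_integral_of_real has_bochner_integral_gaussian_real c s)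
  have intn: "(\<integral>\<xi>. norm (?f n \<xi>) \<partial>?M) = Gamma (s + n) * c powr (- (s + n)) / 2 * (cmod d ^ n / fact n)" for n
  proof -
    have "norm (?f n \<xi>) = exp (- c * \<xi>\<^sup>2) * \<xi> ^ (2 * n) * (cmod d ^ n / fact n)" for \<xi>
      by (simp add: norm_mult norm_divide norm_power power_even_abs)
    then have "(\<integral>\<xi>. norm (?f n \<xi>) \<partial>?M) = (\<integral>\<xi>. exp (- c * \<xi>\<^sup>2) * \<xi> ^ (2 * n) * (cmod d ^ n / fact n) \<partial>?M)"
      by presburger
    then show ?thesis
      using has_bochner_integral_mult_left[OF has_bochner_integral_gaussian_real[OF c s, of n], of "cmod d ^ n / fact n"]
      by (simp add: has_bochner_integral_iff)
  qed
  \<comment> \<open>Kept general in \<open>w\<close>: at \<open>w = d\<close> the series gives the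
    value of the integral, at \<open>w = cmod d\<close> it gives the summability of the L1 norms
    that termwise integration requires.\<close>
  have term_eq: "of_real (Gamma (s + n) * c powr (- (s + n)) / 2) * (w ^ n / fact n)
      = of_real (Gamma s / 2 * c powr (- s)) * (((- of_real s) gchoose n) * (- (w / of_real c)) ^ n)" for n and w :: complex
  proof -
    have "of_real s \<notin> (\<int>\<^sub>\<le>\<^sub>0 :: real set)" using s nonpos_Ints_nonpos by fastforce
    then have "Gamma (s + n) = pochhammer s n * Gamma s"
      using pochhammer_Gamma[of s n] s by (auto simp: Gamma_eq_zero_iff)
    moreover have "c powr (- (s + n)) = c powr (- s) / c ^ n"
      using c by (simp add: powr_diff powr_minus powr_realpow field_simps powr_add)
    ultimately show ?thesis
      by (simp add: gbinomial_pochhammer pochhammer_of_real power_divide power_minus' field_simps)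
  qed
  have sums1: "(\<lambda>n. ((- of_real s) gchoose n) * (- (w / of_real c)) ^ n) sums (1 - w / of_real c) powr (- of_real s)"
    if "cmod w < c" for w :: complex
  proof -
    have "norm (- (w / of_real c)) < 1" using that c by (simp add: norm_divide)
    from gen_binomial_complex[OF this, of "- of_real s"] show ?thesis by simp
  qed
  have summ: "summable (\<lambda>n. \<integral>\<xi>. norm (?f n \<xi>) \<partial>?M)"
  proof -
    have "cmod (of_real (cmod d)) < c" using d by simp
    from sums_mult[OF sums1[OF this], of "of_real (Gamma s / 2 * c powr (- s))"]
    have "summable (\<lambda>n. of_real (Gamma (s + n) * c powr (- (s + n)) / 2) * (of_real (cmod d) ^ n / fact n) :: complex)"
      unfolding term_eq by (rule sums_summable)
    then have "summable (\<lambda>n. of_real (Gamma (s + n) * c powr (- (s + n)) / 2 * (cmod d ^ n / fact n)) :: complex)"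
      by simp
    then show ?thesis unfolding intn by (simp only: summable_complex_of_real)
  qed
  have S: "((\<lambda>n. ?f n \<xi>) has_sum exp (- z * of_real (\<xi>\<^sup>2))) UNIV" for \<xi>
  proof (rule norm_summable_imp_has_sum)
    have eq: "?f n \<xi> = of_real (exp (- c * \<xi>\<^sup>2)) * ((d * of_real (\<xi>\<^sup>2)) ^ n /\<^sub>R fact n)" for n
      unfolding power_mult by (simp add: power_mult_distrib scaleR_conv_of_real field_simps)
    show "(\<lambda>n. ?f n \<xi>) sums exp (- z * of_real (\<xi>\<^sup>2))"
    proof -
      have "(\<lambda>n. ?f n \<xi>) sums (of_real (exp (- c * \<xi>\<^sup>2)) * exp (d * of_real (\<xi>\<^sup>2)))"
        unfolding eq by (intro sums_mult exp_converges)
      also have "of_real (exp (- c * \<xi>\<^sup>2)) * exp (d * of_real (\<xi>\<^sup>2)) = exp (- z * of_real (\<xi>\<^sup>2))"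
        by (simp add: d_def algebra_simps flip: exp_of_real exp_add)
      finally show ?thesis .
    qed
    show "summable (\<lambda>n. norm (?f n \<xi>))"
      unfolding eq norm_mult by (intro summable_mult summable_norm_exp)
  qed
  have "((\<lambda>n. \<integral>\<xi>. ?f n \<xi> \<partial>?M) has_sum (\<integral>\<xi>. exp (- z * of_real (\<xi>\<^sup>2)) \<partial>?M)) UNIV"
    and I: "integrable ?M (\<lambda>\<xi>. exp (- z * of_real (\<xi>\<^sup>2)))"
    using has_sum_integral_nat[where f = ?f, OF _ summ S] int by (auto simp: has_bochner_integral_iff)
  then have "(\<lambda>n. of_real (Gamma (s + n) * c powr (- (s + n)) / 2) * (d ^ n / fact n)) sums (\<integral>\<xi>. exp (- z * of_real (\<xi>\<^sup>2)) \<partial>?M)"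
    using int by (auto simp: has_bochner_integral_iff dest!: has_sum_imp_sums)
  moreover have "(\<lambda>n. of_real (Gamma (s + n) * c powr (- (s + n)) / 2) * (d ^ n / fact n)) sums
      (of_real (Gamma s / 2 * c powr (- s)) * (1 - d / of_real c) powr (- of_real s))"
    unfolding term_eq by (intro sums_mult sums1 d)
  ultimately have "(\<integral>\<xi>. exp (- z * of_real (\<xi>\<^sup>2)) \<partial>?M) = of_real (Gamma s / 2 * c powr (- s)) * (1 - d / of_real c) powr (- of_real s)"
    by (rule sums_unique2)
  also have "1 - d / of_real c = z / of_real c" using c by (simp add: d_def field_simps)
  also have "of_real (Gamma s / 2 * c powr (- s)) * (z / of_real c) powr (- of_real s) = of_real (Gamma s / 2) * z powr (- of_real s)"
  \<comment> \<open>The principal power is not multiplicative in general, but a positive real factor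
    can be pulled out.\<close>
  proof -
    have "z powr (- of_real s) = (of_real c * (z / of_real c)) powr (- of_real s)" using c by simp
    also have "\<dots> = of_real c powr (- of_real s) * (z / of_real c) powr (- of_real s)"
      using c by (intro powr_times_real_left) auto
    also have "of_real c powr (- of_real s) = (of_real (c powr (- s)) :: complex)"
      using c powr_of_real[of c "- s"] by simp
    finally show ?thesis by simp
  qed
  finally show ?thesis using I by (simp add: has_bochner_integral_iff)
qed

lemma has_bochner_integral_gaussian_moment:
  fixes z :: complex
  assumes z: "Re z > 0" and s: "s > 0"
  shows "has_bochner_integral (pmeas (2 * s - 1)) (\<lambda>\<xi>. exp (- z * of_real (\<xi>\<^sup>2)) * of_real (\<xi> ^ (2 * n)))
     (of_real (Gamma (s + n) / 2) * z powr (- of_real s) / z ^ n)"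
proof -
  have z0: "z \<noteq> 0" using z by auto
  let ?f = "\<lambda>\<xi>. exp (- z * of_real (\<xi>\<^sup>2))"
  have eq: "real (2 * n) + (2 * s - 1) = 2 * (s + n) - 1" by simp
  have p: "z powr (- of_real (s + n)) = z powr (- of_real s) / z ^ n"
    using z0 by (simp add: powr_diff)
  have AE: "AE \<xi> in pmeas (2 * s - 1). (\<xi> powr real (2 * n)) *\<^sub>R ?f \<xi> = ?f \<xi> * of_real (\<xi> ^ (2 * n))"
    by (intro eventually_mono[OF AE_pmeas_pos]) (simp only: powr_realpow, simp add: scaleR_conv_of_real mult.commute del: of_real_power)
  have h: "has_bochner_integral (pmeas (2 * (s + n) - 1)) ?f (of_real (Gamma (s + n) / 2) * z powr (- of_real (s + n)))"
    using s by (intro has_bochner_integral_gaussian_complex z) auto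
  have "has_bochner_integral (pmeas (2 * s - 1)) (\<lambda>\<xi>. (\<xi> powr real (2 * n)) *\<^sub>R ?f \<xi>) (of_real (Gamma (s + n) / 2) * z powr (- of_real (s + n)))"
    using h integral_pmeas_shift[of ?f "real (2 * n)" "2 * s - 1"]
    unfolding has_bochner_integral_iff eq by auto
  then show ?thesis unfolding p using AE
    by (subst (asm) has_bochner_integral_cong_AE[OF _ _ AE]) auto
qed

section \<open>The Bessel series\<close>

text \<open>The parameter \<open>s\<close> stands for \<open>\<nu> + 1 = (a + 1) / 2\<close>, so that \<open>a = 2 * s - 1\<close>.\<close>

definition bcoef :: "real \<Rightarrow> nat \<Rightarrow> real" where
  "bcoef s m = 1 / (fact m * Gamma (s + m))"

text \<open>This is the hypergeometric function 0F1(; s; u) divided by Gamma(s). With \<nu> = s - 1,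
  J_\<nu>(r) is (r/2)^\<nu> times its value at -r^2/4, and I_\<nu>(r) is the same power times its
  value at r^2/4. Being entire in \<open>u\<close>, it treats both kinds of Bessel function without
  any choice of branch.\<close>

definition bess :: "real \<Rightarrow> complex \<Rightarrow> complex" where
  "bess s u = (\<Sum>m. of_real (bcoef s m) * u ^ m)"

lemma bcoef_pos: "s > 0 \<Longrightarrow> bcoef s m > 0"
  by (simp add: bcoef_def add_pos_nonneg)

lemma bcoef_Suc:
  assumes "s > 0"
  shows "bcoef s (Suc m) = bcoef s m / ((m + 1) * (s + m))"
proof -
  have "s + real m \<notin> \<int>\<^sub>\<le>\<^sub>0" using assms nonpos_Ints_nonpos[of "s + m"] by auto
  then have "Gamma (s + Suc m) = (s + m) * Gamma (s + m)"
    using Gamma_plus1[of "s + real m"] by (simp add: add_ac)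
  then show ?thesis unfolding bcoef_def by (simp add: mult_ac add_ac)
qed

lemma summable_bess:
  assumes "s > 0"
  shows "summable (\<lambda>m. norm (of_real (bcoef s m) * u ^ m :: complex))"
proof (rule summable_ratio_test[where c = "1 / 2" and N = "nat \<lceil>2 * norm u / s\<rceil>"])
  fix m assume "m \<ge> nat \<lceil>2 * norm u / s\<rceil>"
  then have "2 * norm u / s \<le> real m" by linarith
  then have "2 * norm u \<le> m * s" using assms by (simp add: field_simps)
  also have "\<dots> \<le> (m + 1) * (s + m)" using assms by (intro mult_mono) auto
  finally have *: "norm u / ((m + 1) * (s + m)) \<le> 1 / 2"
    using assms by (subst pos_divide_le_eq) (auto intro!: mult_pos_pos add_pos_nonneg)
  have nrm: "norm (of_real (bcoef s k) * u ^ k :: complex) = bcoef s k * norm u ^ k" for k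
    using bcoef_pos[OF assms, of k] by (simp add: norm_mult norm_power)
  have "norm (of_real (bcoef s (Suc m)) * u ^ Suc m :: complex) = bcoef s m * norm u ^ m * (norm u / ((m + 1) * (s + m)))"
    unfolding nrm by (simp add: bcoef_Suc[OF assms] mult_ac)
  also have "\<dots> \<le> bcoef s m * norm u ^ m * (1 / 2)"
    using bcoef_pos[OF assms, of m] by (intro mult_left_mono *) auto
  also have "\<dots> = 1 / 2 * norm (of_real (bcoef s m) * u ^ m :: complex)"
    using bcoef_pos[OF assms, of m] by (simp add: norm_mult norm_power)
  finally show "norm (norm (of_real (bcoef s (Suc m)) * u ^ Suc m :: complex)) \<le> 1 / 2 * norm (norm (of_real (bcoef s m) * u ^ m :: complex))"
    unfolding real_norm_def abs_norm_cancel .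
qed auto

lemma bess_sums: "s > 0 \<Longrightarrow> (\<lambda>m. of_real (bcoef s m) * u ^ m) sums bess s u"
  unfolding bess_def by (intro summable_sums summable_norm_cancel[OF summable_bess])

lemma bess_has_sum: "s > 0 \<Longrightarrow> ((\<lambda>m. of_real (bcoef s m) * u ^ m) has_sum bess s u) UNIV"
  by (intro norm_summable_imp_has_sum summable_bess bess_sums)

lemma bess_of_real:
  assumes "s > 0"
  shows "bess s (of_real x) = of_real (\<Sum>m. bcoef s m * x ^ m)"
    and "x \<ge> 0 \<Longrightarrow> (\<Sum>m. bcoef s m * x ^ m) \<ge> 0"
proof -
  have "summable (\<lambda>m. of_real (bcoef s m * x ^ m) :: complex)"
    using sums_summable[OF bess_sums[OF assms, of "of_real x"]] by simp
  then have sm: "summable (\<lambda>m. bcoef s m * x ^ m)"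
    by (simp only: summable_complex_of_real)
  show "bess s (of_real x) = of_real (\<Sum>m. bcoef s m * x ^ m)"
    using suminf_of_real[OF sm, where 'a = complex] by (simp add: bess_def)
  show "x \<ge> 0 \<Longrightarrow> (\<Sum>m. bcoef s m * x ^ m) \<ge> 0"
    using sm bcoef_pos[OF assms] by (intro suminf_nonneg) (auto simp: less_imp_le)
qed

lemma borel_measurable_bess [measurable]: "bess s \<in> borel_measurable borel"
  unfolding bess_def by measurable

section \<open>The duplication formula, Poisson's integral and exponential bounds\<close>

lemma fact_times_Gamma_half: "fact m * Gamma (1 / 2 + real m) = sqrt pi * fact (2 * m) / 4 ^ m"
proof (induction m)
  case (Suc m)
  have nz: "1 / 2 + real m \<notin> \<int>\<^sub>\<le>\<^sub>0" using nonpos_Ints_nonpos by fastforce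
  have "1 / 2 + real (Suc m) = (1 / 2 + real m) + 1" by simp
  then have "fact (Suc m) * Gamma (1 / 2 + real (Suc m)) = (m + 1) * (1 / 2 + real m) * (fact m * Gamma (1 / 2 + real m))"
    using Gamma_plus1[OF nz] by simp
  also have "\<dots> = (m + 1) * (1 / 2 + real m) * (sqrt pi * fact (2 * m) / 4 ^ m)"
    unfolding Suc.IH ..
  also have "\<dots> = sqrt pi * fact (2 * Suc m) / 4 ^ Suc m"
    by (simp add: field_simps)
  finally show ?case .
qed (simp add: Gamma_one_half_real)

lemma cosh_sums_even: "(\<lambda>m. (w\<^sup>2) ^ m /\<^sub>R fact (2 * m)) sums cosh (w :: complex)"
proof -
  have "(\<lambda>m. (\<lambda>n. if even n then w ^ n /\<^sub>R fact n else 0) (2 * m)) sums cosh w"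
    by (subst sums_mono_reindex) (auto simp: strict_mono_def cosh_converges elim!: evenE)
  then show ?thesis by (simp add: power_mult)
qed

lemma norm_cosh_le: "norm (cosh w) \<le> exp \<bar>Re w\<bar>" for w :: complex
proof -
  have "norm (cosh w) \<le> (norm (exp w) + norm (exp (- w))) / 2"
    using norm_triangle_ineq[of "exp w" "exp (- w)"] by (simp add: cosh_def norm_divide)
  also have "\<dots> \<le> (exp \<bar>Re w\<bar> + exp \<bar>Re w\<bar>) / 2"
    by (intro divide_right_mono add_mono) auto
  finally show ?thesis by simp
qed

text \<open>The Beta value brings Gamma(s + m) into the denominator at the price of Gamma(1/2 + m)
  and Gamma(s - 1/2); the former is removed by the duplication formula. The factor
  \<open>4 ^ m / fact (2 * m)\<close> that remains is the coefficient of an even cosh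
  series.\<close>

lemma bcoef_eq_Beta:
  assumes "s > 1 / 2"
  shows "bcoef s m = 4 ^ m / fact (2 * m) * Beta (1 / 2 + m) (s - 1 / 2) / (sqrt pi * Gamma (s - 1 / 2))"
proof -
  have *: "1 / (F * T) = q / f * (G * S / T) / (p * S)"
    if "F * G = p * f / q" "F > 0" "G > 0" "p > 0" "f > 0" "q > 0" "S > 0" "T > 0" for F G p f q S T :: real
  proof -
    have "G = p * f / q / F" using that by (simp add: field_simps)
    then show ?thesis using that by (simp add: field_simps)
  qed
  have "1 / 2 + real m + (s - 1 / 2) = s + m" by simp
  then show ?thesis unfolding bcoef_def Beta_def
    using assms by (simp only:) (intro *[OF fact_times_Gamma_half] Gamma_real_pos, auto)
qed

text \<open>Poisson's integral: by the duplication formula the coefficients of \<open>bess\<close> are those of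
  \<open>cosh (2 * w * sqrt t)\<close> averaged against a Beta density in \<open>t\<close>.\<close>

lemma norm_bess_square_le:
  assumes s: "s \<ge> 1 / 2"
  shows "norm (bess s (w\<^sup>2)) \<le> exp (2 * \<bar>Re w\<bar>) / Gamma s"
\<comment> \<open>At \<open>s = 1 / 2\<close> the Beta density no longer exists, because
  \<open>Gamma (s - 1 / 2)\<close> sits at a pole. There \<open>bess s (w\<^sup>2)\<close> is itself
  \<open>cosh (2 * w) / sqrt pi\<close>, as if the density were a point mass at 1.\<close>
proof (cases "s = 1 / 2")
  case True
  have b: "of_real (bcoef (1 / 2) m) = (4 ^ m / (of_real (sqrt pi) * fact (2 * m)) :: complex)" for m
    by (simp add: bcoef_def fact_times_Gamma_half)
  have "of_real (bcoef (1 / 2) m) * (w\<^sup>2) ^ m = of_real (1 / sqrt pi) * (((2 * w)\<^sup>2) ^ m /\<^sub>R fact (2 * m))" for m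
    unfolding b by (simp add: power_mult_distrib scaleR_conv_of_real field_simps)
  then have "(\<lambda>m. of_real (bcoef (1 / 2) m) * (w\<^sup>2) ^ m) sums (of_real (1 / sqrt pi) * cosh (2 * w))"
    using sums_mult[OF cosh_sums_even[of "2 * w"], of "of_real (1 / sqrt pi)"] by presburger
  then have "bess s (w\<^sup>2) = of_real (1 / sqrt pi) * cosh (2 * w)"
    using bess_sums[of s "w\<^sup>2"] unfolding True by (intro sums_unique2) auto
  then show ?thesis
    using norm_cosh_le[of "2 * w"] unfolding True
    by (simp add: norm_mult norm_divide Gamma_one_half_real divide_right_mono abs_mult)
next
  case False
  then have s: "s > 1 / 2" using s by simp
  then have s0: "s > 0" by simp
  define k where "k = (\<lambda>t. indicator {0..1} t * (t powr (1 / 2 - 1) * (1 - t) powr (s - 1 / 2 - 1)) :: real)"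
  have k0: "k t \<ge> 0" for t by (simp add: k_def)
  have [measurable]: "k \<in> borel_measurable borel" unfolding k_def by simp
  have moment: "has_bochner_integral lborel (\<lambda>t. k t * t ^ m) (Beta (1 / 2 + m) (s - 1 / 2))" for m
  proof (rule has_bochner_integral_nn_integral)
    have "((\<lambda>t. t powr (1 / 2 + real m - 1) * (1 - t) powr (s - 1 / 2 - 1)) has_integral Beta (1 / 2 + m) (s - 1 / 2)) {0..1}"
      using s by (intro has_integral_Beta_real) auto
    then have "((\<lambda>t. if t \<in> {0..1} then t powr (1 / 2 + real m - 1) * (1 - t) powr (s - 1 / 2 - 1) else 0) has_integral Beta (1 / 2 + m) (s - 1 / 2)) UNIV"
      by (subst has_integral_restrict_UNIV)
    then have "(\<integral>\<^sup>+t. ennreal (if t \<in> {0..1} then t powr (1 / 2 + real m - 1) * (1 - t) powr (s - 1 / 2 - 1) else 0) \<partial>lborel) = ennreal (Beta (1 / 2 + m) (s - 1 / 2))"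
      by (intro nn_integral_has_integral_lborel) auto
    moreover have "(\<integral>\<^sup>+t. ennreal (k t * t ^ m) \<partial>lborel) = (\<integral>\<^sup>+t. ennreal (if t \<in> {0..1} then t powr (1 / 2 + real m - 1) * (1 - t) powr (s - 1 / 2 - 1) else 0) \<partial>lborel)"
    proof (intro nn_integral_cong_AE eventually_mono[OF AE_lborel_singleton[of 0]])
      fix t :: real assume "t \<noteq> 0"
      then have "t powr (1 / 2 + real m - 1) = t powr (1 / 2 - 1) * t ^ m" if "t \<in> {0..1}"
        using that powr_add[of t "1 / 2 - 1" "real m"] by (simp add: powr_realpow)
      then show "ennreal (k t * t ^ m) = ennreal (if t \<in> {0..1} then t powr (1 / 2 + real m - 1) * (1 - t) powr (s - 1 / 2 - 1) else 0)"
        by (auto simp: k_def mult_ac)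
    qed
    ultimately show "(\<integral>\<^sup>+t. ennreal (k t * t ^ m) \<partial>lborel) = ennreal (Beta (1 / 2 + m) (s - 1 / 2))" by simp
  qed (use s in \<open>auto simp: k_def indicator_def Beta_def intro!: AE_I2 divide_nonneg_nonneg mult_nonneg_nonneg Gamma_real_nonneg\<close>)
  \<comment> \<open>The normalisation in Poisson's formula: \<open>g * bess s (w\<^sup>2)\<close> is
    the integral of \<open>cosh (2 * w * sqrt t)\<close> against \<open>k\<close>. The total mass of
    \<open>k\<close> is \<open>g / Gamma s\<close>, so dividing by \<open>g\<close> at the end
    leaves \<open>1 / Gamma s\<close>.\<close>
  define g where "g = sqrt pi * Gamma (s - 1 / 2)"
  have g: "g > 0" using s by (auto simp: g_def intro!: mult_pos_pos Gamma_real_pos)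
  let ?f = "\<lambda>m t. of_real (k t * t ^ m) * ((4 * w\<^sup>2) ^ m /\<^sub>R fact (2 * m))"
  have int: "has_bochner_integral lborel (?f m) (of_real (Beta (1 / 2 + m) (s - 1 / 2)) * ((4 * w\<^sup>2) ^ m /\<^sub>R fact (2 * m)))" for m
    by (intro has_bochner_integral_mult_left has_bochner_integral_of_real moment)
  have coef: "of_real (Beta (1 / 2 + m) (s - 1 / 2)) * ((4 * u) ^ m /\<^sub>R fact (2 * m)) = of_real g * (of_real (bcoef s m) * u ^ m)" for m and u :: complex
  proof -
    have "bcoef s m = 4 ^ m / fact (2 * m) * Beta (1 / 2 + m) (s - 1 / 2) / g"
      unfolding g_def by (rule bcoef_eq_Beta[OF s])
    then have "of_real (bcoef s m) = (4 ^ m / fact (2 * m) * of_real (Beta (1 / 2 + m) (s - 1 / 2)) / of_real g :: complex)"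
      by simp
    then show ?thesis using g by (simp add: power_mult_distrib scaleR_conv_of_real field_simps)
  qed
  have intn: "(\<integral>t. norm (?f m t) \<partial>lborel) = g * norm (of_real (bcoef s m) * (w\<^sup>2) ^ m)" for m
  proof -
    have "norm (?f m t) = k t * t ^ m * norm ((4 * w\<^sup>2) ^ m /\<^sub>R fact (2 * m))" for t
      using k0[of t] by (cases "t \<ge> 0") (auto simp: norm_mult norm_power k_def)
    then have "(\<integral>t. norm (?f m t) \<partial>lborel) = (\<integral>t. k t * t ^ m * norm ((4 * w\<^sup>2) ^ m /\<^sub>R fact (2 * m)) \<partial>lborel)"
      by presburger
    also have "\<dots> = Beta (1 / 2 + m) (s - 1 / 2) * norm ((4 * w\<^sup>2) ^ m /\<^sub>R fact (2 * m))"
      by (rule has_bochner_integral_integral_eq[OF has_bochner_integral_mult_left[OF moment]])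
    also have "\<dots> = norm (of_real (Beta (1 / 2 + m) (s - 1 / 2)) * ((4 * w\<^sup>2) ^ m /\<^sub>R fact (2 * m)))"
    proof -
      have "Beta (1 / 2 + m) (s - 1 / 2) \<ge> 0"
        using s unfolding Beta_def by (intro divide_nonneg_nonneg mult_nonneg_nonneg Gamma_real_nonneg) auto
      then show ?thesis by (simp only: norm_mult norm_of_real abs_of_nonneg)
    qed
    also have "\<dots> = g * norm (of_real (bcoef s m) * (w\<^sup>2) ^ m)"
      unfolding coef using g by (simp add: norm_mult)
    finally show ?thesis .
  qed
  have S: "((\<lambda>m. ?f m t) has_sum (of_real (k t) * cosh (2 * w * of_real (sqrt t)))) UNIV" for t
  proof (cases "t \<ge> 0")
    case True
    have eq: "?f m t = of_real (k t) * (((2 * w * of_real (sqrt t))\<^sup>2) ^ m /\<^sub>R fact (2 * m))" for m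
    proof -
      have "(of_real (sqrt t) :: complex)\<^sup>2 = of_real t"
        using True by (simp flip: of_real_power)
      then have "(2 * w * of_real (sqrt t))\<^sup>2 = 4 * w\<^sup>2 * of_real t"
        unfolding power_mult_distrib by simp
      then have "((2 * w * of_real (sqrt t))\<^sup>2) ^ m = (4 * w\<^sup>2) ^ m * of_real t ^ m"
        by (simp only: power_mult_distrib[of "4 * w\<^sup>2"])
      then show ?thesis by (simp add: mult_ac)
    qed
    show ?thesis unfolding eq
    proof (intro has_sum_cmult_right norm_summable_imp_has_sum cosh_sums_even)
      define r where "r = norm (2 * w * of_real (sqrt t))"
      have "summable (\<lambda>m. of_real ((r\<^sup>2) ^ m /\<^sub>R fact (2 * m)) :: complex)"
        using sums_summable[OF cosh_sums_even[of "of_real r"]] by (simp add: scaleR_conv_of_real)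
      then have "summable (\<lambda>m. (r\<^sup>2) ^ m /\<^sub>R fact (2 * m))"
        by (simp only: summable_complex_of_real)
      then show "summable (\<lambda>m. norm (((2 * w * of_real (sqrt t))\<^sup>2) ^ m /\<^sub>R fact (2 * m)))"
        by (simp add: norm_power r_def)
    qed
  qed (simp add: k_def)
  have sm: "summable (\<lambda>m. \<integral>t. norm (?f m t) \<partial>lborel)"
    unfolding intn by (intro summable_mult summable_bess s0)
  have "((\<lambda>m. \<integral>t. ?f m t \<partial>lborel) has_sum (\<integral>t. of_real (k t) * cosh (2 * w * of_real (sqrt t)) \<partial>lborel)) UNIV"
    using has_sum_integral_nat(1)[where f = ?f, OF _ sm S] int by (auto simp: has_bochner_integral_iff)
  then have "(\<lambda>m. of_real g * (of_real (bcoef s m) * (w\<^sup>2) ^ m)) sums (\<integral>t. of_real (k t) * cosh (2 * w * of_real (sqrt t)) \<partial>lborel)"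
    unfolding trans[OF has_bochner_integral_integral_eq[OF int] coef] by (rule has_sum_imp_sums)
  then have "of_real g * bess s (w\<^sup>2) = (\<integral>t. of_real (k t) * cosh (2 * w * of_real (sqrt t)) \<partial>lborel)"
    using sums_mult[OF bess_sums[OF s0]] by (rule sums_unique2[rotated])
  then have "norm (of_real g * bess s (w\<^sup>2)) \<le> (\<integral>t. norm (of_real (k t) * cosh (2 * w * of_real (sqrt t))) \<partial>lborel)"
    by (simp only: integral_norm_bound)
  also have "\<dots> \<le> (\<integral>t. k t * t ^ 0 * exp (2 * \<bar>Re w\<bar>) \<partial>lborel)"
  proof (rule integral_mono')
    show "integrable lborel (\<lambda>t. k t * t ^ 0 * exp (2 * \<bar>Re w\<bar>))"
      by (intro integrable_mult_left integrable.intros[OF moment])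
    show "norm (of_real (k t) * cosh (2 * w * of_real (sqrt t))) \<le> k t * t ^ 0 * exp (2 * \<bar>Re w\<bar>)" for t
    proof (cases "t \<in> {0..1}")
      case True
      have "norm (cosh (2 * w * of_real (sqrt t))) \<le> exp \<bar>Re (2 * w * of_real (sqrt t))\<bar>" by (rule norm_cosh_le)
      also have "\<bar>Re (2 * w * of_real (sqrt t))\<bar> = 2 * \<bar>Re w\<bar> * sqrt t" using True by (simp add: abs_mult)
      also have "\<dots> \<le> 2 * \<bar>Re w\<bar> * 1" using True by (intro mult_left_mono) auto
      finally show ?thesis using k0[of t] by (simp add: norm_mult mult_left_mono)
    qed (simp add: k_def)
  qed (use k0 in simp)
  also have "\<dots> = Beta (1 / 2 + real 0) (s - 1 / 2) * exp (2 * \<bar>Re w\<bar>)"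
    by (rule has_bochner_integral_integral_eq[OF has_bochner_integral_mult_left[OF moment]])
  also have "Beta (1 / 2 + real 0) (s - 1 / 2) = g / Gamma s"
    by (simp add: Beta_def g_def Gamma_one_half_real)
  finally have "g * norm (bess s (w\<^sup>2)) \<le> g * (exp (2 * \<bar>Re w\<bar>) / Gamma s)"
    using g by (simp add: norm_mult)
  then show ?thesis using g by (simp only: mult_le_cancel_left_pos)
qed

section \<open>Weber's integral\<close>

lemma has_sum_product_complex:
  fixes f :: "'a \<Rightarrow> complex" and g :: "'b \<Rightarrow> complex"
  assumes f: "(f has_sum a) UNIV" and g: "(g has_sum b) UNIV"
  shows "((\<lambda>(i, j). f i * g j) has_sum (a * b)) UNIV"
proof -
  have fn: "(\<lambda>i. norm (f i)) summable_on UNIV" and gn: "(\<lambda>i. norm (g i)) summable_on UNIV"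
    using has_sum_imp_summable[OF f] has_sum_imp_summable[OF g]
    by (simp_all add: summable_on_iff_abs_summable_on_complex)
  have "(\<lambda>p. norm (case p of (i, j) \<Rightarrow> f i * g j)) summable_on (UNIV \<times> UNIV)"
  proof (rule summable_on_SigmaI)
    show "((\<lambda>j. norm (case (i, j) of (i, j) \<Rightarrow> f i * g j)) has_sum (norm (f i) * (\<Sum>\<^sub>\<infinity>j. norm (g j)))) UNIV" for i
      using has_sum_cmult_right[OF has_sum_infsum[OF gn]] by (simp add: norm_mult)
    show "(\<lambda>i. norm (f i) * (\<Sum>\<^sub>\<infinity>j. norm (g j))) summable_on UNIV"
      by (intro summable_on_cmult_left fn)
  qed auto
  then have sm: "(\<lambda>(i, j). f i * g j) summable_on (UNIV \<times> UNIV)"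
    by (simp add: summable_on_iff_abs_summable_on_complex)
  have "((\<lambda>(i, j). f i * g j) has_sum (a * b)) (UNIV \<times> UNIV)"
  proof (rule has_sum_SigmaI[OF _ _ sm])
    show "((\<lambda>j. case (i, j) of (i, j) \<Rightarrow> f i * g j) has_sum f i * b) UNIV" for i
      using has_sum_cmult_right[OF g] by simp
    show "((\<lambda>i. f i * b) has_sum a * b) UNIV"
      by (intro has_sum_cmult_left f)
  qed
  then show ?thesis by simp
qed

text \<open>Vandermonde's convolution for the generalised binomials k choose m and (s + l - 1)
  choose (l - m), with the factorials cleared. The left-hand side is the coefficient of x^k y^l in
  exp x * exp y * \<open>bess s (x * y)\<close>.\<close>

lemma bcoef_convolution:
  assumes s: "s > 0"
  shows "(\<Sum>m\<le>min k l. bcoef s m / (fact (k - m) * fact (l - m))) = Gamma (s + (k + l)) * bcoef s k * bcoef s l"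
proof -
  have nn: "s + real n \<notin> \<int>\<^sub>\<le>\<^sub>0" for n using s nonpos_Ints_nonpos[of "s + n"] by auto
  have pos: "Gamma (s + real n) > 0" for n using s by (intro Gamma_real_pos) auto
  let ?t = "\<lambda>m. (real k gchoose m) * ((s + real l - 1) gchoose (l - m))"
  have t: "?t m = fact k * Gamma (s + l) * (bcoef s m / (fact (k - m) * fact (l - m)))" if "m \<le> min k l" for m
  proof -
    have "(real k gchoose m) = fact k / (fact m * fact (k - m))"
      using that by (simp add: binomial_fact flip: binomial_gbinomial)
    moreover have "(s + real l - 1) gchoose (l - m) = Gamma (s + l) / (fact (l - m) * Gamma (s + m))"
      using that nn[of l] by (subst gbinomial_Gamma) (auto simp: of_nat_diff algebra_simps)
    ultimately show ?thesis by (simp add: bcoef_def)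
  qed
  \<comment> \<open>Terms with \<open>k < m\<close> vanish, since k choose m is an ordinary binomial
    coefficient.\<close>
  have "(\<Sum>m\<in>{0..l}. ?t m) = (\<Sum>m\<le>min k l. ?t m)"
    by (intro sum.mono_neutral_right) (auto simp flip: binomial_gbinomial)
  also have "\<dots> = fact k * Gamma (s + l) * (\<Sum>m\<le>min k l. bcoef s m / (fact (k - m) * fact (l - m)))"
    unfolding sum_distrib_left by (intro sum.cong t) auto
  finally have "fact k * Gamma (s + l) * (\<Sum>m\<le>min k l. bcoef s m / (fact (k - m) * fact (l - m)))
      = (real k + (s + real l - 1)) gchoose l"
    by (simp add: gbinomial_Vandermonde)
  also have "\<dots> = Gamma (s + (k + l)) / (fact l * Gamma (s + k))"
    using nn[of "k + l"] by (subst gbinomial_Gamma) (auto simp: algebra_simps)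
  finally have *: "fact k * Gamma (s + l) * (\<Sum>m\<le>min k l. bcoef s m / (fact (k - m) * fact (l - m)))
      = Gamma (s + (k + l)) / (fact l * Gamma (s + k))" .
  have "(\<Sum>m\<le>min k l. bcoef s m / (fact (k - m) * fact (l - m)))
      = fact k * Gamma (s + l) * (\<Sum>m\<le>min k l. bcoef s m / (fact (k - m) * fact (l - m))) / (fact k * Gamma (s + l))"
    using pos[of l] by simp
  then show ?thesis unfolding * by (simp add: bcoef_def mult_ac)
qed

text \<open>The triple series for exp y, exp x and \<open>bess\<close> is regrouped by total powers,
  the index triple (m, i, j) going to k = m + i and l = m + j, and summed over m first. Read
  backwards, it resums the series that Gaussian moments produce, since the moment belonging to the
  pair (k, l) carries the factor \<open>Gamma (s + (k + l))\<close>.\<close>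

lemma bess_double_series:
  assumes s: "s > 0"
  shows "((\<lambda>(k, l). of_real (Gamma (s + (k + l)) * bcoef s k * bcoef s l) * (x ^ k * y ^ l)) has_sum
           (exp x * exp y * bess s (x * y))) UNIV"
proof -
  have E: "((\<lambda>n. w ^ n /\<^sub>R fact n) has_sum exp w) UNIV" for w :: complex
    by (intro norm_summable_imp_has_sum summable_norm_exp exp_converges)
  have "((\<lambda>(m, i, j). (of_real (bcoef s m) * (x * y) ^ m) * ((x ^ i /\<^sub>R fact i) * (y ^ j /\<^sub>R fact j))) has_sum
      (bess s (x * y) * (exp x * exp y))) UNIV"
    using has_sum_product_complex[OF bess_has_sum[OF s] has_sum_product_complex[OF E E]]
    by (simp add: case_prod_unfold)
  also have "?this \<longleftrightarrow> ((\<lambda>((k, l), m). of_real (bcoef s m / (fact (k - m) * fact (l - m))) * (x ^ k * y ^ l)) has_sum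
      (exp x * exp y * bess s (x * y))) (SIGMA (k, l) : UNIV. {..min k l})"
    by (rule has_sum_reindex_bij_witness[of _ "\<lambda>((k, l), m). (m, k - m, l - m)" "\<lambda>(m, i, j). ((m + i, m + j), m)"])
       (auto simp: scaleR_conv_of_real power_add power_mult_distrib field_simps)
  finally have *: "((\<lambda>((k, l), m). of_real (bcoef s m / (fact (k - m) * fact (l - m))) * (x ^ k * y ^ l)) has_sum
      (exp x * exp y * bess s (x * y))) (SIGMA (k, l) : UNIV. {..min k l})" .
  have inner: "((\<lambda>m. case (p, m) of ((k, l), m) \<Rightarrow> of_real (bcoef s m / (fact (k - m) * fact (l - m))) * (x ^ k * y ^ l)) has_sum
       (case p of (k, l) \<Rightarrow> of_real (Gamma (s + (k + l)) * bcoef s k * bcoef s l) * (x ^ k * y ^ l))) (case p of (k, l) \<Rightarrow> {..min k l})" for p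
  proof -
    obtain k l where p: "p = (k, l)" by force
    have "((\<lambda>m. of_real (bcoef s m / (fact (k - m) * fact (l - m))) * (x ^ k * y ^ l)) has_sum
       (\<Sum>m\<le>min k l. of_real (bcoef s m / (fact (k - m) * fact (l - m))) * (x ^ k * y ^ l))) {..min k l}"
      by (rule has_sum_finite) auto
    also have "(\<Sum>m\<le>min k l. of_real (bcoef s m / (fact (k - m) * fact (l - m))) * (x ^ k * y ^ l))
       = of_real (\<Sum>m\<le>min k l. bcoef s m / (fact (k - m) * fact (l - m))) * (x ^ k * y ^ l)"
      by (simp only: of_real_sum sum_distrib_right)
    finally show ?thesis unfolding bcoef_convolution[OF s] p by simp
  qed
  show ?thesis using inner by (intro has_sum_SigmaD[OF *]) (simp add: case_prod_unfold)
qed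

text \<open>With \<nu> = s - 1 this is J_\<nu>(r) divided by (r/2)^\<nu>, hence 2^\<nu> times the
  quotient by r^\<nu>. The powers of 2 that appear in later constants come from this
  normalisation.\<close>

definition jbess :: "real \<Rightarrow> real \<Rightarrow> real" where
  "jbess s r = (\<Sum>m. bcoef s m * (- (r\<^sup>2 / 4)) ^ m)"

lemma jbess_bess: "s > 0 \<Longrightarrow> complex_of_real (jbess s r) = bess s (of_real (- (r\<^sup>2 / 4)))"
  unfolding jbess_def by (rule bess_of_real(1)[symmetric])

lemma borel_measurable_jbess [measurable]: "jbess s \<in> borel_measurable borel"
  unfolding jbess_def by measurable

text \<open>The number -r^2/4 is the square of i r/2, whose real part is 0, so the exponential bound
  for \<open>bess\<close> loses nothing.\<close>

lemma abs_jbess_le: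
  assumes "s \<ge> 1 / 2"
  shows "\<bar>jbess s r\<bar> \<le> 1 / Gamma s"
proof -
  have "complex_of_real (jbess s r) = bess s ((\<i> * of_real (r / 2))\<^sup>2)"
    using assms by (subst jbess_bess) (auto simp: power_mult_distrib power_divide)
  then have "norm (complex_of_real (jbess s r)) \<le> exp (2 * \<bar>Re (\<i> * of_real (r / 2))\<bar>) / Gamma s"
    using norm_bess_square_le[OF assms, of "\<i> * of_real (r / 2)"] by (simp only:)
  then show ?thesis by simp
qed

text \<open>The usual closed form contains I_\<nu>(x y / (2 z)) divided by a power of x y. Absorbing
  the powers into \<open>bess\<close>, whose argument is (x y / (4 z))^2, leaves
  \<open>z powr (- of_real s)\<close> as the only multivalued factor and makes the formula valid at
  x = 0 or y = 0 too.\<close>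

definition weber :: "real \<Rightarrow> complex \<Rightarrow> real \<Rightarrow> real \<Rightarrow> complex" where
  "weber s z x y = z powr (- of_real s) / 2 *
     (exp (- of_real (x\<^sup>2 / 4) / z) * exp (- of_real (y\<^sup>2 / 4) / z) * bess s (of_real (x\<^sup>2 / 4) * of_real (y\<^sup>2 / 4) / z\<^sup>2))"

text \<open>Both factors \<open>jbess\<close> are expanded, each monomial is integrated as a
  Gaussian moment, and the result is the double series at -X/z and -Y/z.\<close>

lemma has_bochner_integral_weber:
  assumes z: "Re z > 0" and s: "s > 0"
  shows "has_bochner_integral (pmeas (2 * s - 1))
     (\<lambda>\<xi>. exp (- z * of_real (\<xi>\<^sup>2)) * (of_real (jbess s (\<xi> * x)) * of_real (jbess s (\<xi> * y)))) (weber s z x y)"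
proof -
  have z0: "z \<noteq> 0" using z by auto
  let ?M = "pmeas (2 * s - 1)"
  define X Y where "X = x\<^sup>2 / 4" and "Y = y\<^sup>2 / 4"
  have XY: "X \<ge> 0" "Y \<ge> 0" by (simp_all add: X_def Y_def)
  define d where "d = (\<lambda>k l. Gamma (s + (k + l)) * bcoef s k * bcoef s l)"
  have d0: "d k l \<ge> 0" for k l
    using s bcoef_pos[OF s, of k] bcoef_pos[OF s, of l] unfolding d_def
    by (intro mult_nonneg_nonneg Gamma_real_nonneg) auto
  define q :: "nat \<times> nat \<Rightarrow> complex" where "q = (\<lambda>p :: nat \<times> nat. case p of (k, l) \<Rightarrow> of_real (bcoef s k * bcoef s l) * (of_real (- X) ^ k * of_real (- Y) ^ l))"
  define f where "f = (\<lambda>p :: nat \<times> nat. \<lambda>\<xi>. exp (- z * of_real (\<xi>\<^sup>2)) * of_real (\<xi> ^ (2 * (fst p + snd p))) * q p)"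
  have int: "has_bochner_integral ?M (f p) (of_real (Gamma (s + real (fst p + snd p)) / 2) * z powr (- of_real s) / z ^ (fst p + snd p) * q p)" for p
    unfolding f_def by (intro has_bochner_integral_mult_left has_bochner_integral_gaussian_moment z s)
  have val: "of_real (Gamma (s + real (fst p + snd p)) / 2) * z powr (- of_real s) / z ^ (fst p + snd p) * q p
     = z powr (- of_real s) / 2 * (case p of (k, l) \<Rightarrow> of_real (d k l) * ((- of_real X / z) ^ k * (- of_real Y / z) ^ l))" for p
  proof -
    obtain k l where p: "p = (k, l)" by force
    have e: "(- of_real r / z) ^ n = of_real (- r) ^ n / z ^ n" for r n
      by (simp only: power_divide of_real_minus)
    show ?thesis unfolding p prod.case fst_conv snd_conv q_def d_def e using z0 by (simp add: power_add del: of_real_minus)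
  qed
  have val': "integral\<^sup>L ?M (f p) = z powr (- of_real s) / 2 * (case p of (k, l) \<Rightarrow> of_real (d k l) * ((- of_real X / z) ^ k * (- of_real Y / z) ^ l))" for p
    by (rule trans[OF has_bochner_integral_integral_eq[OF int] val])
  \<comment> \<open>Taking norms replaces \<open>z\<close> by \<open>Re z\<close> and removes the
    signs. The L1 norms are thus the terms of the same double series at positive arguments, which is
    known to converge absolutely.\<close>
  have nrm: "(\<integral>\<xi>. norm (f p \<xi>) \<partial>?M) = Re z powr (- s) / 2 * norm (case p of (k, l) \<Rightarrow> complex_of_real (d k l) * (of_real (X / Re z) ^ k * of_real (Y / Re z) ^ l))" for p
  proof -
    obtain k l where p: "p = (k, l)" by force
    have "norm (f p \<xi>) = exp (- Re z * \<xi>\<^sup>2) * \<xi> ^ (2 * (k + l)) * (bcoef s k * bcoef s l * (X ^ k * Y ^ l))" for \<xi>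
      using XY bcoef_pos[OF s, of k] bcoef_pos[OF s, of l] abs_of_nonneg[OF zero_le_even_power[of "2 * k + 2 * l" \<xi>]]
      by (simp add: p f_def q_def norm_mult norm_power power_even_abs flip: of_real_power)
    then have "(\<integral>\<xi>. norm (f p \<xi>) \<partial>?M) = (\<integral>\<xi>. exp (- Re z * \<xi>\<^sup>2) * \<xi> ^ (2 * (k + l)) * (bcoef s k * bcoef s l * (X ^ k * Y ^ l)) \<partial>?M)"
      by presburger
    also have "\<dots> = Gamma (s + real (k + l)) * Re z powr (- (s + real (k + l))) / 2 * (bcoef s k * bcoef s l * (X ^ k * Y ^ l))"
      by (intro has_bochner_integral_integral_eq has_bochner_integral_mult_left has_bochner_integral_gaussian_real z s)
    also have "Re z powr (- (s + real (k + l))) = Re z powr (- s) / (Re z ^ k * Re z ^ l)"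
    proof -
      have "Re z powr (- (s + real (k + l))) = Re z powr (- s - real (k + l))" by (simp add: algebra_simps)
      also have "\<dots> = Re z powr (- s) / Re z ^ (k + l)"
        using z by (simp only: powr_diff powr_realpow)
      finally show ?thesis by (simp add: power_add)
    qed
    finally show ?thesis
      using d0[of k l] XY z by (simp add: p norm_mult norm_power norm_divide power_divide) (simp add: d_def mult_ac)
  qed
  have sm: "(\<lambda>p. \<integral>\<xi>. norm (f p \<xi>) \<partial>?M) summable_on UNIV"
    unfolding nrm using has_sum_imp_summable[OF bess_double_series[OF s, of "of_real (X / Re z)" "of_real (Y / Re z)"]]
    by (intro summable_on_cmult_right) (simp add: summable_on_iff_abs_summable_on_complex d_def)
  have S: "((\<lambda>p. f p \<xi>) has_sum (exp (- z * of_real (\<xi>\<^sup>2)) * (of_real (jbess s (\<xi> * x)) * of_real (jbess s (\<xi> * y))))) UNIV" for \<xi>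
  proof -
    have "f p \<xi> = exp (- z * of_real (\<xi>\<^sup>2)) * (case p of (k, l) \<Rightarrow> (of_real (bcoef s k) * of_real (- ((\<xi> * x)\<^sup>2 / 4)) ^ k) * (of_real (bcoef s l) * of_real (- ((\<xi> * y)\<^sup>2 / 4)) ^ l))" for p
    proof -
      obtain k l where p: "p = (k, l)" by force
      have "- ((\<xi> * x)\<^sup>2 / 4) = \<xi>\<^sup>2 * (- X)" "- ((\<xi> * y)\<^sup>2 / 4) = \<xi>\<^sup>2 * (- Y)"
        by (simp_all add: X_def Y_def power_mult_distrib)
      moreover have "(complex_of_real \<xi> ^ n)\<^sup>2 = ((complex_of_real \<xi>)\<^sup>2) ^ n" for n
        by (simp add: mult.commute flip: power_mult)
      ultimately show ?thesis
        unfolding p f_def q_def by (simp only: of_real_mult power_mult_distrib prod.case fst_conv snd_conv power_mult power_add of_real_power mult_ac)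
    qed
    then show ?thesis
      using has_sum_cmult_right[OF has_sum_product_complex[OF bess_has_sum[OF s] bess_has_sum[OF s]]]
      unfolding jbess_bess[OF s] by presburger
  qed
  have "((\<lambda>p. integral\<^sup>L ?M (f p)) has_sum (\<integral>\<xi>. exp (- z * of_real (\<xi>\<^sup>2)) * (of_real (jbess s (\<xi> * x)) * of_real (jbess s (\<xi> * y))) \<partial>?M)) UNIV"
    and I: "integrable ?M (\<lambda>\<xi>. exp (- z * of_real (\<xi>\<^sup>2)) * (of_real (jbess s (\<xi> * x)) * of_real (jbess s (\<xi> * y))))"
    using has_sum_integral_nat_prod[where f = f and M = ?M, OF integrable.intros[OF int] sm S] by auto
  moreover have "((\<lambda>p. integral\<^sup>L ?M (f p)) has_sum weber s z x y) UNIV"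
  proof -
    have "((\<lambda>p. integral\<^sup>L ?M (f p)) has_sum
       (z powr (- of_real s) / 2 * (exp (- of_real X / z) * exp (- of_real Y / z) * bess s ((- of_real X / z) * (- of_real Y / z))))) UNIV"
      unfolding val' d_def by (intro has_sum_cmult_right bess_double_series s)
    also have "(- of_real X / z) * (- of_real Y / z) = of_real X * of_real Y / z\<^sup>2"
      by (simp add: power2_eq_square)
    finally show ?thesis by (simp only: weber_def X_def Y_def)
  qed
  ultimately show ?thesis
    using has_sum_unique by (auto simp: has_bochner_integral_iff)
qed

text \<open>Put X = x^2/4, Y = y^2/4 and let \<rho> be the real part of 1/z. The two exponentials
  decay like exp (- (X + Y) \<rho>), and \<open>bess\<close> grows at most like exp (2 sqrt (X Y)
  \<rho>). By the inequality of arithmetic and geometric means the decay wins, so only the power of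
  |z| survives, uniformly in x and y.\<close>

lemma norm_weber_le:
  assumes z: "Re z > 0" and s: "s \<ge> 1 / 2"
  shows "norm (weber s z x y) \<le> norm z powr (- s) / (2 * Gamma s)"
proof -
  define X Y where "X = x\<^sup>2 / 4" and "Y = y\<^sup>2 / 4"
  have XY: "X \<ge> 0" "Y \<ge> 0" by (simp_all add: X_def Y_def)
  define \<rho> where "\<rho> = Re (1 / z)"
  have \<rho>: "\<rho> \<ge> 0" using z by (simp add: \<rho>_def Re_divide)
  have Re_mult: "Re (of_real r * u) = r * Re u" for r u by simp
  have eX: "norm (exp (- of_real r / z)) = exp (- r * \<rho>)" for r
  proof -
    have "- of_real r / z = of_real (- r) * (1 / z)" by simp
    then have "Re (- of_real r / z) = - r * \<rho>" unfolding \<rho>_def by (simp only: Re_mult)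
    then show ?thesis by (simp only: norm_exp_eq_Re)
  qed
  define w where "w = of_real (sqrt (X * Y)) * (1 / z)"
  have w2: "w\<^sup>2 = of_real X * of_real Y / z\<^sup>2"
  proof -
    have "(complex_of_real (sqrt (X * Y)))\<^sup>2 = of_real (X * Y)"
      using XY by (simp flip: of_real_power)
    then show ?thesis by (simp add: w_def power_mult_distrib power_divide)
  qed
  have Rw: "\<bar>Re w\<bar> = sqrt (X * Y) * \<rho>"
    unfolding w_def \<rho>_def[symmetric] using XY \<rho> by (simp only: Re_mult \<rho>_def[symmetric]) (simp add: abs_mult)
  have "norm (weber s z x y) = norm z powr (- s) / 2 * (exp (- X * \<rho>) * exp (- Y * \<rho>) * norm (bess s (w\<^sup>2)))"
    unfolding weber_def w2 X_def[symmetric] Y_def[symmetric] norm_mult eX norm_divide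
    by (simp add: norm_powr_real_powr')
  also have "\<dots> \<le> norm z powr (- s) / 2 * (exp (- X * \<rho>) * exp (- Y * \<rho>) * (exp (2 * \<bar>Re w\<bar>) / Gamma s))"
    by (intro mult_left_mono norm_bess_square_le s) auto
  also have "\<dots> = norm z powr (- s) / (2 * Gamma s) * exp ((2 * sqrt (X * Y) - (X + Y)) * \<rho>)"
    unfolding Rw by (simp add: algebra_simps flip: exp_add)
  also have "\<dots> \<le> norm z powr (- s) / (2 * Gamma s) * 1"
  proof (intro mult_left_mono)
    have "2 * sqrt (X * Y) - (X + Y) \<le> 0" using arith_geo_mean_sqrt[OF XY] by simp
    then show "exp ((2 * sqrt (X * Y) - (X + Y)) * \<rho>) \<le> 1"
      using \<rho> by (simp add: mult_nonpos_nonneg)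
  qed (use s in \<open>auto intro!: divide_nonneg_nonneg Gamma_real_nonneg\<close>)
  finally show ?thesis by simp
qed

lemma weber_pos_real:
  assumes c: "c > 0" and s: "s > 0"
  obtains k where "k \<ge> 0" "weber s (of_real c) x y = of_real k"
proof -
  define u where "u = x\<^sup>2 / 4 * (y\<^sup>2 / 4) / c\<^sup>2"
  have u: "u \<ge> 0" by (simp add: u_def)
  have p: "complex_of_real c powr (- of_real s) = of_real (c powr (- s))"
    using c powr_of_real[of c "- s"] by simp
  have b: "bess s (of_real (x\<^sup>2 / 4) * of_real (y\<^sup>2 / 4) / (of_real c)\<^sup>2) = of_real (\<Sum>m. bcoef s m * u ^ m)"
    using bess_of_real(1)[OF s, of u] by (simp add: u_def)
  show ?thesis
  proof (rule that)
    show "weber s (of_real c) x y = of_real (c powr (- s) / 2 * (exp (- (x\<^sup>2 / 4) / c) * exp (- (y\<^sup>2 / 4) / c) * (\<Sum>m. bcoef s m * u ^ m)))"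
      unfolding weber_def b p by (simp flip: exp_of_real)
    show "c powr (- s) / 2 * (exp (- (x\<^sup>2 / 4) / c) * exp (- (y\<^sup>2 / 4) / c) * (\<Sum>m. bcoef s m * u ^ m)) \<ge> 0"
      using bess_of_real(2)[OF s u] by (intro mult_nonneg_nonneg) auto
  qed
qed

lemma weber_commute: "weber s z x y = weber s z y x"
  by (simp add: weber_def mult_ac)

text \<open>Each Gaussian moment in y produces the \<open>Gamma (s + m)\<close> that
  \<open>bcoef s m\<close> divides by. What remains is the series of exp (X/c), which cancels the
  prefactor exp (-X/c) and all dependence on \<open>x\<close> and \<open>c\<close>. With \<nu> = s -
  1 the value \<open>4 powr s / 4\<close> is the square of the factor 2^\<nu> in
  \<open>jbess\<close>.\<close>

lemma has_bochner_integral_weber_real: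
  assumes c: "c > 0" and s: "s > 0"
  shows "has_bochner_integral (pmeas (2 * s - 1)) (\<lambda>y. weber s (of_real c) x y) (of_real (4 powr s / 4))"
proof -
  let ?M = "pmeas (2 * s - 1)"
  define X where "X = x\<^sup>2 / 4"
  have X: "X \<ge> 0" by (simp add: X_def)
  have p: "complex_of_real c powr (- of_real s) = of_real (c powr (- s))"
    using c powr_of_real[of c "- s"] by simp
  define q where "q = (\<lambda>m. c powr (- s) / 2 * exp (- X / c) * bcoef s m * (X / (4 * c\<^sup>2)) ^ m)"
  have q0: "q m \<ge> 0" for m
    using X bcoef_pos[OF s, of m] unfolding q_def by (intro mult_nonneg_nonneg) auto
  define g where "g = (\<lambda>m y. exp (- (1 / (4 * c)) * y\<^sup>2) * y ^ (2 * m) * q m)"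
  define v where "v = (\<lambda>m. Gamma (s + real m) * (1 / (4 * c)) powr (- (s + real m)) / 2 * q m)"
  have int: "has_bochner_integral ?M (g m) (v m)" for m
    unfolding g_def v_def using c
    by (intro has_bochner_integral_mult_left has_bochner_integral_gaussian_real s) auto
  have v: "v m = 4 powr s / 4 * exp (- X / c) * ((X / c) ^ m /\<^sub>R fact m)" for m
  proof -
    have "1 / (4 * c) = (4 * c) powr (- 1)" using c by (simp add: powr_minus_divide)
    then have "(1 / (4 * c)) powr (- (s + real m)) = (4 * c) powr (s + real m)"
      by (simp only: powr_powr) (simp add: add.commute)
    also have "\<dots> = 4 powr s * c powr s * (4 * c) ^ m"
      using c by (simp add: powr_add powr_mult powr_realpow)
    finally have e: "(1 / (4 * c)) powr (- (s + real m)) = 4 powr s * c powr s * (4 * c) ^ m" .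
    have "Gamma (s + real m) > 0" using s by (intro Gamma_real_pos) auto
    then show ?thesis unfolding v_def e q_def bcoef_def using c
      by (simp add: powr_minus power_divide power_mult_distrib power2_eq_square field_simps)
  qed
  have g0: "g m y \<ge> 0" for m y using q0[of m] by (simp add: g_def)
  have vs: "v sums (4 powr s / 4)"
  proof -
    have "v sums (4 powr s / 4 * exp (- X / c) * exp (X / c))"
      unfolding v by (intro sums_mult exp_converges)
    then show ?thesis by (simp only: mult.assoc exp_add[symmetric]) simp
  qed
  have S: "((\<lambda>m. of_real (g m y)) has_sum weber s (of_real c) x y) UNIV" for y
  proof -
    have "((\<lambda>m. of_real (c powr (- s)) / 2 * (exp (- of_real X / of_real c) * exp (- of_real (y\<^sup>2 / 4) / of_real c)
       * (of_real (bcoef s m) * (of_real X * of_real (y\<^sup>2 / 4) / (of_real c)\<^sup>2) ^ m))) has_sum weber s (of_real c) x y) UNIV"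
      unfolding weber_def p X_def[symmetric] by (intro has_sum_cmult_right bess_has_sum s)
    also have "(\<lambda>m. of_real (c powr (- s)) / 2 * (exp (- of_real X / of_real c) * exp (- of_real (y\<^sup>2 / 4) / of_real c)
       * (of_real (bcoef s m) * (of_real X * of_real (y\<^sup>2 / 4) / (of_real c)\<^sup>2) ^ m))) = (\<lambda>m. complex_of_real (g m y))"
    proof
      fix m
      have "(X * (y\<^sup>2 / 4) / c\<^sup>2) ^ m = (X / (4 * c\<^sup>2)) ^ m * y ^ (2 * m)"
        unfolding power_mult power_mult_distrib[symmetric] by simp
      then have "c powr (- s) / 2 * (exp (- X / c) * exp (- (y\<^sup>2 / 4) / c) * (bcoef s m * (X * (y\<^sup>2 / 4) / c\<^sup>2) ^ m)) = g m y"
        by (simp add: g_def q_def mult_ac)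
      from arg_cong[OF this, of complex_of_real]
      show "of_real (c powr (- s)) / 2 * (exp (- of_real X / of_real c) * exp (- of_real (y\<^sup>2 / 4) / of_real c)
       * (of_real (bcoef s m) * (of_real X * of_real (y\<^sup>2 / 4) / (of_real c)\<^sup>2) ^ m)) = complex_of_real (g m y)"
        by (simp flip: exp_of_real)
    qed
    finally show ?thesis .
  qed
  have int': "has_bochner_integral ?M (\<lambda>y. of_real (g m y) :: complex) (of_real (v m))" for m
    by (intro has_bochner_integral_of_real int)
  have "summable (\<lambda>m. \<integral>y. norm (of_real (g m y) :: complex) \<partial>?M)"
    using vs g0 has_bochner_integral_integral_eq[OF int] by (simp add: sums_iff)
  then have "((\<lambda>m. \<integral>y. of_real (g m y) \<partial>?M) has_sum (\<integral>y. weber s (of_real c) x y \<partial>?M)) UNIV"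
    and I: "integrable ?M (\<lambda>y. weber s (of_real c) x y)"
    using has_sum_integral_nat[where f = "\<lambda>m y. of_real (g m y)" and M = ?M, OF integrable.intros[OF int'] _ S] by auto
  then have "(\<lambda>m. of_real (v m)) sums (\<integral>y. weber s (of_real c) x y \<partial>?M)"
    unfolding has_bochner_integral_integral_eq[OF int'] by (intro has_sum_imp_sums)
  moreover have "(\<lambda>m. of_real (v m)) sums (of_real (4 powr s / 4) :: complex)"
    by (intro sums_of_real vs)
  ultimately have "(\<integral>y. weber s (of_real c) x y \<partial>?M) = of_real (4 powr s / 4)"
    by (rule sums_unique2)
  then show ?thesis using I by (simp add: has_bochner_integral_iff)
qed

section \<open>Dispersive and energy estimates\<close>

lemma (in pair_sigma_finite) integrable_pair_bound:
  fixes h :: "'a \<times> 'b \<Rightarrow> 'c :: {banach, second_countable_topology}" and f :: "'a \<Rightarrow> real" and g :: "'b \<Rightarrow> real"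
  assumes f: "integrable M1 f" and g: "integrable M2 g"
    and [measurable]: "h \<in> borel_measurable (M1 \<Otimes>\<^sub>M M2)"
    and bound: "\<And>x y. x \<in> space M1 \<Longrightarrow> y \<in> space M2 \<Longrightarrow> norm (h (x, y)) \<le> f x * g y"
  shows "integrable (M1 \<Otimes>\<^sub>M M2) h"
proof (rule Bochner_Integration.integrable_bound)
  have [measurable]: "f \<in> borel_measurable M1" "g \<in> borel_measurable M2"
    using f g by auto
  show "integrable (M1 \<Otimes>\<^sub>M M2) (\<lambda>(x, y). f x * g y)"
  proof (rule Fubini_integrable)
    have "integrable M1 (\<lambda>x. \<bar>f x\<bar> * (\<integral>y. \<bar>g y\<bar> \<partial>M2))"
      using f by (intro integrable_mult_left) auto
    then show "integrable M1 (\<lambda>x. \<integral>y. norm (case (x, y) of (x, y) \<Rightarrow> f x * g y) \<partial>M2)"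
      by (simp add: abs_mult)
    show "AE x in M1. integrable M2 (\<lambda>y. case (x, y) of (x, y) \<Rightarrow> f x * g y)"
      using g by simp
  qed simp
  show "AE p in M1 \<Otimes>\<^sub>M M2. norm (h p) \<le> norm (case p of (x, y) \<Rightarrow> f x * g y)"
    using bound by (intro AE_I2) (auto simp: space_pair_measure intro: order_trans[OF _ abs_ge_self])
qed simp

text \<open>The modified Hankel transform of order s - 1, times 2^(s - 1), with the power weight
  moved into the measure. Values of \<open>f\<close> at x \<le> 0 have no influence.\<close>

definition hk :: "real \<Rightarrow> (real \<Rightarrow> complex) \<Rightarrow> real \<Rightarrow> complex" where
  "hk s f \<xi> = (\<integral>x. f x * of_real (jbess s (\<xi> * x)) \<partial>pmeas (2 * s - 1))"

text \<open>Bilinear instead of sesquilinear, so that it is symmetric and a statement about one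
  argument transfers to the other. Where a conjugate is wanted it is put into an argument, which is
  harmless because the kernel of \<open>hk\<close> is real.\<close>

definition bilin :: "real \<Rightarrow> complex \<Rightarrow> (real \<Rightarrow> complex) \<Rightarrow> (real \<Rightarrow> complex) \<Rightarrow> complex" where
  "bilin s z f g = (\<integral>\<xi>. exp (- z * of_real (\<xi>\<^sup>2)) * (hk s f \<xi> * hk s g \<xi>) \<partial>pmeas (2 * s - 1))"

lemma bilin_commute: "bilin s z f g = bilin s z g f"
  by (simp add: bilin_def mult_ac)

lemma hk_cnj: "hk s (\<lambda>x. cnj (f x)) \<xi> = cnj (hk s f \<xi>)"
  using Bochner_Integration.integral_cnj[of "pmeas (2 * s - 1)" "\<lambda>x. f x * complex_of_real (jbess s (\<xi> * x))"] by (simp add: hk_def)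

lemma borel_measurable_hk [measurable]:
  assumes [measurable]: "f \<in> borel_measurable borel"
  shows "hk s f \<in> borel_measurable borel"
  unfolding hk_def by measurable

lemma borel_measurable_weber [measurable (raw)]:
  assumes [measurable]: "f \<in> borel_measurable N" "g \<in> borel_measurable N"
  shows "(\<lambda>p. weber s z (f p) (g p)) \<in> borel_measurable N"
  unfolding weber_def by measurable

lemma norm_gauss: "norm (exp (- z * of_real (\<xi>\<^sup>2))) = exp (- Re z * \<xi>\<^sup>2)"
  by (simp add: norm_exp_eq_Re)

text \<open>Without integrability the Bochner integral is 0 by convention and the inequality is
  trivial, so it can be applied before any integrability has been checked.\<close>

lemma ennreal_norm_integral_le:
  fixes f :: "'a \<Rightarrow> 'b :: {banach, second_countable_topology}"
  shows "ennreal (norm (integral\<^sup>L M f)) \<le> (\<integral>\<^sup>+x. ennreal (norm (f x)) \<partial>M)"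
  by (cases "integrable M f") (auto simp: integral_norm_bound_ennreal not_integrable_integral_eq)

context
  fixes s :: real
  assumes s: "s \<ge> 1 / 2"
begin

lemma s_pos: "s > 0" "Gamma s > 0"
  using s by (auto intro: Gamma_real_pos)

lemma norm_hk_le:
  assumes f: "integrable (pmeas (2 * s - 1)) f"
  shows "norm (hk s f \<xi>) \<le> (\<integral>x. norm (f x) \<partial>pmeas (2 * s - 1)) / Gamma s"
proof -
  have "norm (hk s f \<xi>) \<le> (\<integral>x. norm (f x) * (1 / Gamma s) \<partial>pmeas (2 * s - 1))"
    unfolding hk_def
  proof (rule order_trans[OF integral_norm_bound integral_mono'])
    show "integrable (pmeas (2 * s - 1)) (\<lambda>x. norm (f x) * (1 / Gamma s))"
      using f by (intro integrable_mult_left integrable_norm)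
    show "norm (f x * complex_of_real (jbess s (\<xi> * x))) \<le> norm (f x) * (1 / Gamma s)" for x
      using mult_left_mono[OF abs_jbess_le[OF s, of "\<xi> * x"], of "norm (f x)"] by (simp add: norm_mult)
  qed (use s_pos in simp)
  then show ?thesis by simp
qed

lemma integrable_gauss:
  assumes "c > 0"
  shows "integrable (pmeas (2 * s - 1)) (\<lambda>\<xi>. exp (- c * \<xi>\<^sup>2))"
  using has_bochner_integral_gaussian_real[OF assms s_pos(1), of 0]
  by (auto simp: has_bochner_integral_iff)

text \<open>The Gaussian factor makes the triple integral absolutely convergent. The two factors
  \<open>hk\<close> are unfolded one after the other, so that each exchange of integrals has a
  product majorant; the innermost integral is then Weber's.\<close>

lemma bilin_eq_weber:
  assumes z: "Re z > 0" and f: "integrable (pmeas (2 * s - 1)) f" and g: "integrable (pmeas (2 * s - 1)) g"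
  shows "bilin s z f g = (\<integral>x. f x * (\<integral>y. g y * weber s z x y \<partial>pmeas (2 * s - 1)) \<partial>pmeas (2 * s - 1))"
proof -
  let ?M = "pmeas (2 * s - 1)"
  have [measurable]: "f \<in> borel_measurable borel" "g \<in> borel_measurable borel" using f g by simp_all
  let ?e = "\<lambda>\<xi>. exp (- z * of_real (\<xi>\<^sup>2))"
  let ?j = "\<lambda>\<xi> x. complex_of_real (jbess s (\<xi> * x))"
  let ?I = "\<integral>x. norm (g x) \<partial>?M"
  have j: "norm (?j \<xi> x) \<le> 1 / Gamma s" for \<xi> x using abs_jbess_le[OF s] by simp
  have I: "?I \<ge> 0" by (intro integral_nonneg_AE) auto
  have "bilin s z f g = (\<integral>\<xi>. (\<integral>x. ?e \<xi> * (f x * ?j \<xi> x * hk s g \<xi>) \<partial>?M) \<partial>?M)"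
  proof -
    have "?e \<xi> * (hk s f \<xi> * hk s g \<xi>) = (\<integral>x. ?e \<xi> * (f x * ?j \<xi> x * hk s g \<xi>) \<partial>?M)" for \<xi>
      unfolding integral_mult_right_zero integral_mult_left_zero hk_def[of s f] ..
    then show ?thesis unfolding bilin_def by presburger
  qed
  also have "\<dots> = (\<integral>x. (\<integral>\<xi>. ?e \<xi> * (f x * ?j \<xi> x * hk s g \<xi>) \<partial>?M) \<partial>?M)"
  proof (rule pmeas_pair.Fubini_integral[symmetric])
    show "integrable (?M \<Otimes>\<^sub>M ?M) (\<lambda>(\<xi>, x). ?e \<xi> * (f x * ?j \<xi> x * hk s g \<xi>))"
    proof (rule pmeas_pair.integrable_pair_bound)
      show "integrable ?M (\<lambda>\<xi>. exp (- Re z * \<xi>\<^sup>2))" by (rule integrable_gauss[OF z])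
      show "integrable ?M (\<lambda>x. norm (f x) * (1 / Gamma s * (?I / Gamma s)))"
        using f by (intro integrable_mult_left integrable_norm)
      fix \<xi> x :: real
      have "norm (?e \<xi> * (f x * ?j \<xi> x * hk s g \<xi>)) = exp (- Re z * \<xi>\<^sup>2) * (norm (f x) * norm (?j \<xi> x) * norm (hk s g \<xi>))"
        unfolding norm_mult norm_gauss ..
      also have "\<dots> \<le> exp (- Re z * \<xi>\<^sup>2) * (norm (f x) * (1 / Gamma s) * (?I / Gamma s))"
        using j[of \<xi> x] norm_hk_le[OF g, of \<xi>] s_pos I
        by (intro mult_left_mono mult_mono) auto
      finally show "norm (case (\<xi>, x) of (\<xi>, x) \<Rightarrow> ?e \<xi> * (f x * ?j \<xi> x * hk s g \<xi>)) \<le> exp (- Re z * \<xi>\<^sup>2) * (norm (f x) * (1 / Gamma s * (?I / Gamma s)))"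
        by (simp add: mult_ac)
    qed measurable
  qed
  also have "\<dots> = (\<integral>x. f x * (\<integral>y. g y * weber s z x y \<partial>?M) \<partial>?M)"
  proof (intro Bochner_Integration.integral_cong refl)
    fix x
    have "(\<integral>\<xi>. ?e \<xi> * (f x * ?j \<xi> x * hk s g \<xi>) \<partial>?M) = f x * (\<integral>\<xi>. ?e \<xi> * ?j \<xi> x * hk s g \<xi> \<partial>?M)"
      unfolding integral_mult_right_zero[symmetric]
      by (intro Bochner_Integration.integral_cong refl) (simp only: mult_ac)
    also have "(\<integral>\<xi>. ?e \<xi> * ?j \<xi> x * hk s g \<xi> \<partial>?M) = (\<integral>\<xi>. (\<integral>y. ?e \<xi> * ?j \<xi> x * (g y * ?j \<xi> y) \<partial>?M) \<partial>?M)"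
      unfolding integral_mult_right_zero hk_def ..
    also have "\<dots> = (\<integral>y. (\<integral>\<xi>. ?e \<xi> * ?j \<xi> x * (g y * ?j \<xi> y) \<partial>?M) \<partial>?M)"
    proof (rule pmeas_pair.Fubini_integral[symmetric])
      show "integrable (?M \<Otimes>\<^sub>M ?M) (\<lambda>(\<xi>, y). ?e \<xi> * ?j \<xi> x * (g y * ?j \<xi> y))"
      proof (rule pmeas_pair.integrable_pair_bound)
        show "integrable ?M (\<lambda>\<xi>. exp (- Re z * \<xi>\<^sup>2))" by (rule integrable_gauss[OF z])
        show "integrable ?M (\<lambda>x. norm (g x) * (1 / Gamma s * (1 / Gamma s)))"
          using g by (intro integrable_mult_left integrable_norm)
        fix \<xi> y :: real
        have "norm (?e \<xi> * ?j \<xi> x * (g y * ?j \<xi> y)) = exp (- Re z * \<xi>\<^sup>2) * norm (?j \<xi> x) * (norm (g y) * norm (?j \<xi> y))"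
          unfolding norm_mult norm_gauss ..
        also have "\<dots> \<le> exp (- Re z * \<xi>\<^sup>2) * (1 / Gamma s) * (norm (g y) * (1 / Gamma s))"
          using j[of \<xi> x] j[of \<xi> y] s_pos
          by (intro mult_mono) auto
        finally show "norm (case (\<xi>, y) of (\<xi>, y) \<Rightarrow> ?e \<xi> * ?j \<xi> x * (g y * ?j \<xi> y)) \<le> exp (- Re z * \<xi>\<^sup>2) * (norm (g y) * (1 / Gamma s * (1 / Gamma s)))"
          by (simp add: mult_ac)
      qed measurable
    qed
    also have "\<dots> = (\<integral>y. g y * weber s z x y \<partial>?M)"
    proof (intro Bochner_Integration.integral_cong refl)
      fix y
      have "(\<integral>\<xi>. ?e \<xi> * ?j \<xi> x * (g y * ?j \<xi> y) \<partial>?M) = g y * (\<integral>\<xi>. ?e \<xi> * (?j \<xi> x * ?j \<xi> y) \<partial>?M)"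
        unfolding integral_mult_right_zero[symmetric]
        by (intro Bochner_Integration.integral_cong refl) (simp only: mult_ac)
      then show "(\<integral>\<xi>. ?e \<xi> * ?j \<xi> x * (g y * ?j \<xi> y) \<partial>?M) = g y * weber s z x y"
        unfolding has_bochner_integral_integral_eq[OF has_bochner_integral_weber[OF z s_pos(1)]] .
    qed
    finally show "(\<integral>\<xi>. ?e \<xi> * (f x * ?j \<xi> x * hk s g \<xi>) \<partial>?M) = f x * (\<integral>y. g y * weber s z x y \<partial>?M)" .
  qed
  finally show ?thesis .
qed

lemma dispersive_estimate:
  assumes z: "Re z > 0" and f: "integrable (pmeas (2 * s - 1)) f" and g: "integrable (pmeas (2 * s - 1)) g"
  shows "ennreal (norm (bilin s z f g)) \<le> ennreal (norm z powr (- s) / (2 * Gamma s))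
     * (\<integral>\<^sup>+x. ennreal (norm (f x)) \<partial>pmeas (2 * s - 1)) * (\<integral>\<^sup>+x. ennreal (norm (g x)) \<partial>pmeas (2 * s - 1))"
proof -
  let ?M = "pmeas (2 * s - 1)"
  let ?K = "norm z powr (- s) / (2 * Gamma s)"
  have [measurable]: "f \<in> borel_measurable borel" "g \<in> borel_measurable borel" using f g by simp_all
  have inner: "ennreal (norm (\<integral>y. g y * weber s z x y \<partial>?M)) \<le> ennreal ?K * (\<integral>\<^sup>+x. ennreal (norm (g x)) \<partial>?M)" for x
  proof -
    have "ennreal (norm (\<integral>y. g y * weber s z x y \<partial>?M)) \<le> (\<integral>\<^sup>+y. ennreal (norm (g y * weber s z x y)) \<partial>?M)"
      by (rule ennreal_norm_integral_le)
    also have "\<dots> \<le> (\<integral>\<^sup>+y. ennreal ?K * ennreal (norm (g y)) \<partial>?M)"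
    proof (intro nn_integral_mono)
      fix y
      have "norm (g y * weber s z x y) \<le> ?K * norm (g y)"
        unfolding norm_mult using norm_weber_le[OF z s, of x y] by (subst mult.commute) (intro mult_right_mono, auto)
      then show "ennreal (norm (g y * weber s z x y)) \<le> ennreal ?K * ennreal (norm (g y))"
        using s_pos by (subst ennreal_mult[symmetric]) (auto intro!: ennreal_leI)
    qed
    also have "\<dots> = ennreal ?K * (\<integral>\<^sup>+x. ennreal (norm (g x)) \<partial>?M)"
      by (intro nn_integral_cmult) simp
    finally show ?thesis .
  qed
  have "ennreal (norm (bilin s z f g)) \<le> (\<integral>\<^sup>+x. ennreal (norm (f x * (\<integral>y. g y * weber s z x y \<partial>?M))) \<partial>?M)"
    unfolding bilin_eq_weber[OF assms] by (rule ennreal_norm_integral_le)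
  also have "\<dots> \<le> (\<integral>\<^sup>+x. ennreal (norm (f x)) * (ennreal ?K * (\<integral>\<^sup>+x. ennreal (norm (g x)) \<partial>?M)) \<partial>?M)"
    unfolding norm_mult by (intro nn_integral_mono) (auto simp: ennreal_mult intro!: mult_left_mono inner)
  also have "\<dots> = (\<integral>\<^sup>+x. ennreal (norm (f x)) \<partial>?M) * (ennreal ?K * (\<integral>\<^sup>+x. ennreal (norm (g x)) \<partial>?M))"
    by (intro nn_integral_multc) simp
  finally show ?thesis by (simp add: mult_ac)
qed

text \<open>Pairing \<open>f\<close> with its conjugate turns the left-hand side into a quadratic
  form whose kernel is symmetric with constant marginals. The bound does not depend on
  \<open>c\<close>, and it is this uniformity that the energy estimate needs.\<close>

lemma hankel_bessel_inequality:
  assumes c: "c > 0" and f: "integrable (pmeas (2 * s - 1)) f"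
  shows "(\<integral>\<^sup>+\<xi>. ennreal (exp (- c * \<xi>\<^sup>2) * (norm (hk s f \<xi>))\<^sup>2) \<partial>pmeas (2 * s - 1))
     \<le> ennreal (4 powr s / 4) * (\<integral>\<^sup>+x. ennreal ((norm (f x))\<^sup>2) \<partial>pmeas (2 * s - 1))"
proof -
  let ?M = "pmeas (2 * s - 1)"
  have [measurable]: "f \<in> borel_measurable borel" using f by simp
  have Re: "Re (complex_of_real c) > 0" using c by simp
  have cf: "integrable ?M (\<lambda>x. cnj (f x))" using f by simp
  define k where "k = (\<lambda>x y. norm (weber s (of_real c) x y))"
  have [measurable]: "case_prod k \<in> borel_measurable (borel \<Otimes>\<^sub>M borel)" unfolding k_def by measurable
  have [measurable]: "k x \<in> borel_measurable borel" for x unfolding k_def by measurable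
  have ksym: "k x y = k y x" for x y by (simp add: k_def weber_commute)
  have k: "(\<integral>\<^sup>+y. ennreal (k x y) \<partial>?M) = ennreal (4 powr s / 4)" for x
  proof -
    \<comment> \<open>At real \<open>c\<close> the kernel equals its own modulus, so the known
      integral of \<open>weber\<close> is also the integral of the modulus that Schur's test
      requires.\<close>
    have kr: "weber s (of_real c) x y = of_real (k x y)" for y
    proof -
      obtain k' where "k' \<ge> 0" "weber s (of_real c) x y = of_real k'"
        by (rule weber_pos_real[OF c s_pos(1)])
      then show ?thesis by (simp add: k_def)
    qed
    have "has_bochner_integral ?M (\<lambda>y. complex_of_real (k x y)) (of_real (4 powr s / 4))"
      using has_bochner_integral_weber_real[OF c s_pos(1), of x] unfolding kr .
    from has_bochner_integral_bounded_linear[OF bounded_linear_Re this]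
    have "has_bochner_integral ?M (k x) (4 powr s / 4)"
      by (simp only: Re_complex_of_real)
    then have "integrable ?M (k x)" "integral\<^sup>L ?M (k x) = 4 powr s / 4"
      by (simp_all only: has_bochner_integral_iff)
    then show ?thesis
      by (subst nn_integral_eq_integral) (auto simp: k_def)
  qed
  have int: "integrable ?M (\<lambda>\<xi>. exp (- c * \<xi>\<^sup>2) * (norm (hk s f \<xi>))\<^sup>2)"
  proof (rule Bochner_Integration.integrable_bound)
    show "integrable ?M (\<lambda>\<xi>. exp (- c * \<xi>\<^sup>2) * ((\<integral>x. norm (f x) \<partial>?M) / Gamma s)\<^sup>2)"
      by (intro integrable_mult_left integrable_gauss c)
    show "AE \<xi> in ?M. norm (exp (- c * \<xi>\<^sup>2) * (norm (hk s f \<xi>))\<^sup>2) \<le> norm (exp (- c * \<xi>\<^sup>2) * ((\<integral>x. norm (f x) \<partial>?M) / Gamma s)\<^sup>2)"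
      using norm_hk_le[OF f] by (intro AE_I2) (auto simp: abs_mult intro!: mult_left_mono power_mono)
  qed simp
  have eq: "bilin s (of_real c) f (\<lambda>x. cnj (f x)) = of_real (\<integral>\<xi>. exp (- c * \<xi>\<^sup>2) * (norm (hk s f \<xi>))\<^sup>2 \<partial>?M)"
  proof -
    have "exp (- complex_of_real c * of_real (\<xi>\<^sup>2)) = of_real (exp (- c * \<xi>\<^sup>2))" for \<xi>
      by (simp flip: exp_of_real)
    moreover have "(\<integral>\<xi>. complex_of_real (exp (- c * \<xi>\<^sup>2) * (norm (hk s f \<xi>))\<^sup>2) \<partial>?M) = of_real (\<integral>\<xi>. exp (- c * \<xi>\<^sup>2) * (norm (hk s f \<xi>))\<^sup>2 \<partial>?M)"
      by (rule has_bochner_integral_integral_eq[OF has_bochner_integral_of_real[OF has_bochner_integral_integrable[OF int]]])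
    ultimately show ?thesis
      unfolding bilin_def hk_cnj complex_norm_square[symmetric] by (simp only: of_real_mult[symmetric])
  qed
  have "(\<integral>\<^sup>+\<xi>. ennreal (exp (- c * \<xi>\<^sup>2) * (norm (hk s f \<xi>))\<^sup>2) \<partial>?M) = ennreal (norm (bilin s (of_real c) f (\<lambda>x. cnj (f x))))"
    unfolding eq using int by (subst nn_integral_eq_integral) (auto intro!: integral_nonneg_AE)
  also have "\<dots> \<le> (\<integral>\<^sup>+x. ennreal (norm (f x * (\<integral>y. cnj (f y) * weber s (of_real c) x y \<partial>?M))) \<partial>?M)"
    unfolding bilin_eq_weber[OF Re f cf] by (rule ennreal_norm_integral_le)
  also have "\<dots> \<le> (\<integral>\<^sup>+x. ennreal (norm (f x)) * (\<integral>\<^sup>+y. ennreal (norm (f y) * k x y) \<partial>?M) \<partial>?M)"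
  proof (intro nn_integral_mono)
    fix x
    have "ennreal (norm (\<integral>y. cnj (f y) * weber s (of_real c) x y \<partial>?M)) \<le> (\<integral>\<^sup>+y. ennreal (norm (cnj (f y) * weber s (of_real c) x y)) \<partial>?M)"
      by (rule ennreal_norm_integral_le)
    then show "ennreal (norm (f x * (\<integral>y. cnj (f y) * weber s (of_real c) x y \<partial>?M))) \<le> ennreal (norm (f x)) * (\<integral>\<^sup>+y. ennreal (norm (f y) * k x y) \<partial>?M)"
      by (auto simp: norm_mult ennreal_mult k_def intro!: mult_left_mono)
  qed
  also have "\<dots> = (\<integral>\<^sup>+x. \<integral>\<^sup>+y. ennreal (norm (f x) * (norm (f y) * k x y)) \<partial>?M \<partial>?M)"
    by (simp add: ennreal_mult' nn_integral_cmult)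
  also have "\<dots> \<le> (\<integral>\<^sup>+x. \<integral>\<^sup>+y. ennreal ((norm (f x))\<^sup>2 / 2) * ennreal (k x y) + ennreal ((norm (f y))\<^sup>2 / 2) * ennreal (k y x) \<partial>?M \<partial>?M)"
  proof (intro nn_integral_mono)
    fix x y
    have k0: "k x y \<ge> 0" by (simp add: k_def)
    have "norm (f x) * norm (f y) \<le> (norm (f x))\<^sup>2 / 2 + (norm (f y))\<^sup>2 / 2"
      using sum_squares_bound[of "norm (f x)" "norm (f y)"] by simp
    from mult_right_mono[OF this k0]
    have "ennreal (norm (f x) * (norm (f y) * k x y)) \<le> ennreal ((norm (f x))\<^sup>2 / 2 * k x y + (norm (f y))\<^sup>2 / 2 * k x y)"
      by (intro ennreal_leI) (simp add: algebra_simps)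
    also have "\<dots> = ennreal ((norm (f x))\<^sup>2 / 2) * ennreal (k x y) + ennreal ((norm (f y))\<^sup>2 / 2) * ennreal (k x y)"
      using k0 by (subst ennreal_plus) (auto simp flip: ennreal_mult)
    finally show "ennreal (norm (f x) * (norm (f y) * k x y)) \<le> ennreal ((norm (f x))\<^sup>2 / 2) * ennreal (k x y) + ennreal ((norm (f y))\<^sup>2 / 2) * ennreal (k y x)"
      by (simp add: ksym[of y x])
  qed
  also have "\<dots> = (\<integral>\<^sup>+x. \<integral>\<^sup>+y. ennreal ((norm (f x))\<^sup>2 / 2) * ennreal (k x y) \<partial>?M \<partial>?M) + (\<integral>\<^sup>+x. \<integral>\<^sup>+y. ennreal ((norm (f y))\<^sup>2 / 2) * ennreal (k y x) \<partial>?M \<partial>?M)"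
    by (simp add: nn_integral_add)
  also have "(\<integral>\<^sup>+x. \<integral>\<^sup>+y. ennreal ((norm (f y))\<^sup>2 / 2) * ennreal (k y x) \<partial>?M \<partial>?M) = (\<integral>\<^sup>+y. \<integral>\<^sup>+x. ennreal ((norm (f y))\<^sup>2 / 2) * ennreal (k y x) \<partial>?M \<partial>?M)"
    by (intro pmeas_pair.Fubini'[symmetric]) measurable
  also have "(\<integral>\<^sup>+x. \<integral>\<^sup>+y. ennreal ((norm (f x))\<^sup>2 / 2) * ennreal (k x y) \<partial>?M \<partial>?M) = (\<integral>\<^sup>+x. ennreal ((norm (f x))\<^sup>2 / 2) * ennreal (4 powr s / 4) \<partial>?M)"
    by (simp add: nn_integral_cmult k)
  also have "\<dots> = (\<integral>\<^sup>+x. ennreal (4 powr s / 8) * ennreal ((norm (f x))\<^sup>2) \<partial>?M)"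
    by (intro nn_integral_cong) (simp flip: ennreal_mult)
  also have "\<dots> = ennreal (4 powr s / 8) * (\<integral>\<^sup>+x. ennreal ((norm (f x))\<^sup>2) \<partial>?M)"
    by (simp add: nn_integral_cmult)
  also have "ennreal (4 powr s / 8) * (\<integral>\<^sup>+x. ennreal ((norm (f x))\<^sup>2) \<partial>?M) + ennreal (4 powr s / 8) * (\<integral>\<^sup>+x. ennreal ((norm (f x))\<^sup>2) \<partial>?M)
     = ennreal (4 powr s / 4) * (\<integral>\<^sup>+x. ennreal ((norm (f x))\<^sup>2) \<partial>?M)"
    by (simp flip: distrib_right ennreal_plus)
  finally show ?thesis .
qed

text \<open>The oscillation of the exponential is discarded, leaving the damping at
  \<open>c = Re z\<close>, where the previous inequality applies to both factors. The product is
  split with a free weight \<open>\<theta>\<close> because \<open>bilinear_interpolation\<close>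
  varies it with the levels.\<close>

lemma energy_estimate:
  assumes z: "Re z > 0" and f: "integrable (pmeas (2 * s - 1)) f" and g: "integrable (pmeas (2 * s - 1)) g" and \<theta>: "\<theta> > 0"
  shows "ennreal (norm (bilin s z f g)) \<le>
     ennreal \<theta> * (ennreal (4 powr s / 8) * (\<integral>\<^sup>+x. ennreal ((norm (f x))\<^sup>2) \<partial>pmeas (2 * s - 1)))
   + ennreal (1 / \<theta>) * (ennreal (4 powr s / 8) * (\<integral>\<^sup>+x. ennreal ((norm (g x))\<^sup>2) \<partial>pmeas (2 * s - 1)))"
proof -
  let ?M = "pmeas (2 * s - 1)"
  have [measurable]: "f \<in> borel_measurable borel" "g \<in> borel_measurable borel" using f g by simp_all
  let ?G = "\<lambda>f \<xi>. exp (- Re z * \<xi>\<^sup>2) * (norm (hk s f \<xi>))\<^sup>2"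
  have "ennreal (norm (bilin s z f g)) \<le> (\<integral>\<^sup>+\<xi>. ennreal (exp (- Re z * \<xi>\<^sup>2) * (norm (hk s f \<xi>) * norm (hk s g \<xi>))) \<partial>?M)"
    using ennreal_norm_integral_le[of ?M "\<lambda>\<xi>. exp (- z * of_real (\<xi>\<^sup>2)) * (hk s f \<xi> * hk s g \<xi>)"]
    unfolding bilin_def[symmetric] norm_mult norm_gauss .
  also have "\<dots> \<le> (\<integral>\<^sup>+\<xi>. ennreal (\<theta> / 2) * ennreal (?G f \<xi>) + ennreal (1 / \<theta> / 2) * ennreal (?G g \<xi>) \<partial>?M)"
  proof (intro nn_integral_mono)
    fix \<xi>
    define a b where "a = norm (hk s f \<xi>)" and "b = norm (hk s g \<xi>)"
    have "0 \<le> (\<theta> * a - b)\<^sup>2 / (2 * \<theta>)" using \<theta> by simp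
    also have "\<dots> = \<theta> / 2 * a\<^sup>2 + 1 / \<theta> / 2 * b\<^sup>2 - a * b"
      using \<theta> by (simp add: power2_eq_square field_simps)
    finally have ab: "a * b \<le> \<theta> / 2 * a\<^sup>2 + 1 / \<theta> / 2 * b\<^sup>2" by simp
    have "exp (- Re z * \<xi>\<^sup>2) * (a * b) \<le> exp (- Re z * \<xi>\<^sup>2) * (\<theta> / 2 * a\<^sup>2 + 1 / \<theta> / 2 * b\<^sup>2)"
      by (intro mult_left_mono ab) auto
    then have "ennreal (exp (- Re z * \<xi>\<^sup>2) * (a * b)) \<le> ennreal (\<theta> / 2 * (exp (- Re z * \<xi>\<^sup>2) * a\<^sup>2) + 1 / \<theta> / 2 * (exp (- Re z * \<xi>\<^sup>2) * b\<^sup>2))"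
      by (intro ennreal_leI) (simp add: algebra_simps)
    also have "\<dots> = ennreal (\<theta> / 2) * ennreal (exp (- Re z * \<xi>\<^sup>2) * a\<^sup>2) + ennreal (1 / \<theta> / 2) * ennreal (exp (- Re z * \<xi>\<^sup>2) * b\<^sup>2)"
      using \<theta> by (subst ennreal_plus) (auto simp flip: ennreal_mult)
    finally show "ennreal (exp (- Re z * \<xi>\<^sup>2) * (norm (hk s f \<xi>) * norm (hk s g \<xi>))) \<le> ennreal (\<theta> / 2) * ennreal (?G f \<xi>) + ennreal (1 / \<theta> / 2) * ennreal (?G g \<xi>)"
      by (simp only: a_def b_def)
  qed
  also have "\<dots> = ennreal (\<theta> / 2) * (\<integral>\<^sup>+\<xi>. ennreal (?G f \<xi>) \<partial>?M) + ennreal (1 / \<theta> / 2) * (\<integral>\<^sup>+\<xi>. ennreal (?G g \<xi>) \<partial>?M)"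
    by (simp add: nn_integral_add nn_integral_cmult)
  also have "\<dots> \<le> ennreal (\<theta> / 2) * (ennreal (4 powr s / 4) * (\<integral>\<^sup>+x. ennreal ((norm (f x))\<^sup>2) \<partial>?M))
      + ennreal (1 / \<theta> / 2) * (ennreal (4 powr s / 4) * (\<integral>\<^sup>+x. ennreal ((norm (g x))\<^sup>2) \<partial>?M))"
    by (intro add_mono mult_left_mono hankel_bessel_inequality z f g) auto
  also have "\<dots> = ennreal \<theta> * (ennreal (4 powr s / 8) * (\<integral>\<^sup>+x. ennreal ((norm (f x))\<^sup>2) \<partial>?M))
      + ennreal (1 / \<theta>) * (ennreal (4 powr s / 8) * (\<integral>\<^sup>+x. ennreal ((norm (g x))\<^sup>2) \<partial>?M))"
  proof -
    have "ennreal (\<theta> / 2) * ennreal (4 powr s / 4) = ennreal \<theta> * ennreal (4 powr s / 8)"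
      "ennreal (1 / \<theta> / 2) * ennreal (4 powr s / 4) = ennreal (1 / \<theta>) * ennreal (4 powr s / 8)"
      using \<theta> by (simp_all add: mult.commute flip: ennreal_mult)
    then show ?thesis by (simp only: mult.assoc[symmetric])
  qed
  finally show ?thesis .
qed

end

section \<open>Interpolation of the two estimates\<close>

text \<open>The slice of \<open>f\<close> at height \<open>a\<close>: it has the phase of
  \<open>f\<close> where |f| exceeds \<open>a\<close> and is 0 elsewhere. Integrating the slices
  over a > 0 recovers \<open>f\<close>.\<close>

definition layer :: "('a \<Rightarrow> complex) \<Rightarrow> real \<Rightarrow> 'a \<Rightarrow> complex" where
  "layer f a x = of_real (indicator {..<norm (f x)} a) * sgn (f x)"

text \<open>A nonnegative level excludes the zeros of \<open>f\<close>, the only points where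
  \<open>sgn\<close> does not have modulus 1.\<close>

lemma norm_layer: "a \<ge> 0 \<Longrightarrow> norm (layer f a x) = indicator {x. a < norm (f x)} x"
  by (auto simp: layer_def norm_mult norm_sgn indicator_def)

lemma borel_measurable_layer [measurable]:
  assumes [measurable]: "f \<in> borel_measurable M"
  shows "layer f a \<in> borel_measurable M" "(\<lambda>p. layer f (snd p) (fst p)) \<in> borel_measurable (M \<Otimes>\<^sub>M borel)"
proof -
  have "layer f a = (\<lambda>x. if a < norm (f x) then sgn (f x) else 0)"
    "(\<lambda>p. layer f (snd p) (fst p)) = (\<lambda>p. if snd p < norm (f (fst p)) then sgn (f (fst p)) else 0)"
    by (auto simp: layer_def)
  then show "layer f a \<in> borel_measurable M" "(\<lambda>p. layer f (snd p) (fst p)) \<in> borel_measurable (M \<Otimes>\<^sub>M borel)"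
    by (simp_all add: sgn_div_norm)
qed

lemma nn_integral_norm_layer:
  assumes [measurable]: "f \<in> borel_measurable M" and "a \<ge> 0"
  shows "(\<integral>\<^sup>+x. ennreal (norm (layer f a x)) \<partial>M) = emeasure M {x \<in> space M. a < norm (f x)}"
    and "(\<integral>\<^sup>+x. ennreal ((norm (layer f a x))\<^sup>2) \<partial>M) = emeasure M {x \<in> space M. a < norm (f x)}"
proof -
  have "(\<integral>\<^sup>+x. indicator {x \<in> space M. a < norm (f x)} x \<partial>M) = emeasure M {x \<in> space M. a < norm (f x)}"
    by (intro nn_integral_indicator) measurable
  moreover have "(\<integral>\<^sup>+x. ennreal (norm (layer f a x)) \<partial>M) = (\<integral>\<^sup>+x. indicator {x \<in> space M. a < norm (f x)} x \<partial>M)"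
    "(\<integral>\<^sup>+x. ennreal ((norm (layer f a x))\<^sup>2) \<partial>M) = (\<integral>\<^sup>+x. indicator {x \<in> space M. a < norm (f x)} x \<partial>M)"
    using assms(2) by (auto intro!: nn_integral_cong simp: norm_layer indicator_def)
  ultimately show "(\<integral>\<^sup>+x. ennreal (norm (layer f a x)) \<partial>M) = emeasure M {x \<in> space M. a < norm (f x)}"
    "(\<integral>\<^sup>+x. ennreal ((norm (layer f a x))\<^sup>2) \<partial>M) = emeasure M {x \<in> space M. a < norm (f x)}"
    by simp_all
qed

lemma integrable_layer:
  assumes f: "integrable M f" and "a > 0"
  shows "integrable M (layer f a)"
proof (rule Bochner_Integration.integrable_bound)
  have [measurable]: "f \<in> borel_measurable M" using f by auto
  show "integrable M (\<lambda>x. norm (f x) / a)" using f by auto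
  show "layer f a \<in> borel_measurable M" by measurable
  show "AE x in M. norm (layer f a x) \<le> norm (norm (f x) / a)"
    using assms(2) by (intro AE_I2) (auto simp: norm_layer indicator_def field_simps)
qed

text \<open>Linearity is used in integrated form: \<open>f\<close> is the integral of its layers.
  Boundedness of \<open>k\<close> makes the double integral over points and levels absolutely
  convergent, and the modulus is taken only after the exchange, so cancellation within each layer is
  kept.\<close>

lemma layer_cake_functional:
  fixes f k :: "'a \<Rightarrow> complex"
  assumes "sigma_finite_measure M" and f: "integrable M f" and [measurable]: "k \<in> borel_measurable M"
    and k: "\<And>x. x \<in> space M \<Longrightarrow> norm (k x) \<le> K"
  shows "ennreal (norm (\<integral>x. f x * k x \<partial>M)) \<le> (\<integral>\<^sup>+a. ennreal (norm (\<integral>x. layer f a x * k x \<partial>M)) \<partial>pmeas 0)"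
proof -
  interpret M: sigma_finite_measure M by fact
  interpret P: pair_sigma_finite M "pmeas 0" ..
  have [measurable]: "f \<in> borel_measurable M" using f by auto
  have ind: "has_bochner_integral (pmeas 0) (indicator {..<r}) r" if "r \<ge> 0" for r :: real
  proof (rule has_bochner_integral_nn_integral)
    show "(\<integral>\<^sup>+x. ennreal (indicator {..<r} x) \<partial>pmeas 0) = ennreal r"
      using nn_integral_pmeas_lessThan[of 0 r] that by (simp add: ennreal_indicator)
  qed (use that in auto)
  have 1: "has_bochner_integral (pmeas 0) (\<lambda>a. norm (layer f a x * k x)) (norm (f x) * norm (k x))" for x
  proof -
    have "has_bochner_integral (pmeas 0) (\<lambda>a. indicator {..<norm (f x)} a * norm (k x)) (norm (f x) * norm (k x))"
      by (intro has_bochner_integral_mult_left ind) simp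
    moreover have "AE a in pmeas 0. indicator {..<norm (f x)} a * norm (k x) = norm (layer f a x * k x)"
      by (intro eventually_mono[OF AE_pmeas_pos]) (auto simp: norm_mult norm_layer indicator_def)
    ultimately show ?thesis
      by (subst (asm) has_bochner_integral_cong_AE[where g = "\<lambda>a. norm (layer f a x * k x)"]) (auto simp: layer_def)
  qed
  have 2: "has_bochner_integral (pmeas 0) (\<lambda>a. layer f a x * k x) (f x * k x)" for x
  proof -
    have "has_bochner_integral (pmeas 0) (\<lambda>a. of_real (indicator {..<norm (f x)} a) * (sgn (f x) * k x)) (of_real (norm (f x)) * (sgn (f x) * k x))"
      by (intro has_bochner_integral_mult_left has_bochner_integral_of_real ind) simp
    moreover have "of_real (norm (f x)) * (sgn (f x) * k x) = f x * k x"
      by (cases "f x = 0") (simp_all add: sgn_eq)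
    ultimately show ?thesis by (simp only: layer_def mult.assoc)
  qed
  have fk: "integrable M (\<lambda>x. norm (f x) * norm (k x))"
  proof (rule Bochner_Integration.integrable_bound)
    show "integrable M (\<lambda>x. norm (f x) * K)" using f by auto
    show "AE x in M. norm (norm (f x) * norm (k x)) \<le> norm (norm (f x) * K)"
      using k by (intro AE_I2) (auto simp: abs_mult intro!: mult_left_mono order_trans[OF _ abs_ge_self])
  qed measurable
  have int: "integrable (M \<Otimes>\<^sub>M pmeas 0) (\<lambda>(x, a). layer f a x * k x)"
  proof (rule P.Fubini_integrable)
    show "(\<lambda>(x, a). layer f a x * k x) \<in> borel_measurable (M \<Otimes>\<^sub>M pmeas 0)"
      unfolding case_prod_unfold by measurable
    show "integrable M (\<lambda>x. \<integral>a. norm (case (x, a) of (x, a) \<Rightarrow> layer f a x * k x) \<partial>pmeas 0)"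
      using fk unfolding prod.case has_bochner_integral_integral_eq[OF 1] .
    show "AE x in M. integrable (pmeas 0) (\<lambda>a. case (x, a) of (x, a) \<Rightarrow> layer f a x * k x)"
      using integrable.intros[OF 2] by (intro AE_I2) simp
  qed
  have "(\<integral>x. f x * k x \<partial>M) = (\<integral>x. (\<integral>a. layer f a x * k x \<partial>pmeas 0) \<partial>M)"
    unfolding has_bochner_integral_integral_eq[OF 2] ..
  also have "\<dots> = (\<integral>a. (\<integral>x. layer f a x * k x \<partial>M) \<partial>pmeas 0)"
    by (rule P.Fubini_integral[symmetric, OF int])
  finally show ?thesis by (simp add: ennreal_norm_integral_le)
qed

context
  fixes s :: real
  assumes s: "s \<ge> 1 / 2"
begin

lemma bilin_layer_left:
  assumes z: "Re z > 0" and f: "integrable (pmeas (2 * s - 1)) f" and g: "integrable (pmeas (2 * s - 1)) g"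
  shows "ennreal (norm (bilin s z f g)) \<le> (\<integral>\<^sup>+a. ennreal (norm (bilin s z (layer f a) g)) \<partial>pmeas 0)"
proof -
  let ?M = "pmeas (2 * s - 1)"
  have [measurable]: "f \<in> borel_measurable borel" "g \<in> borel_measurable borel" using f g by simp_all
  define k where "k = (\<lambda>x. \<integral>y. g y * weber s z x y \<partial>?M)"
  let ?K = "norm z powr (- s) / (2 * Gamma s)"
  have K: "?K \<ge> 0" using s_pos[OF s] by simp
  have b: "norm (k x) \<le> (\<integral>y. norm (g y) * ?K \<partial>?M)" for x
    unfolding k_def
  proof (rule order_trans[OF integral_norm_bound integral_mono'])
    show "integrable ?M (\<lambda>y. norm (g y) * ?K)" using g by (intro integrable_mult_left integrable_norm)
    show "norm (g y * weber s z x y) \<le> norm (g y) * ?K" for y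
      unfolding norm_mult by (intro mult_left_mono norm_weber_le z s) auto
  qed (intro mult_nonneg_nonneg K norm_ge_zero)
  have "ennreal (norm (\<integral>x. f x * k x \<partial>?M)) \<le> (\<integral>\<^sup>+a. ennreal (norm (\<integral>x. layer f a x * k x \<partial>?M)) \<partial>pmeas 0)"
  proof (rule layer_cake_functional[OF _ f _ b])
    show "k \<in> borel_measurable ?M" unfolding k_def by measurable
  qed unfold_locales
  also have "\<dots> = (\<integral>\<^sup>+a. ennreal (norm (bilin s z (layer f a) g)) \<partial>pmeas 0)"
    by (intro nn_integral_cong_AE eventually_mono[OF AE_pmeas_pos])
       (simp add: bilin_eq_weber[OF s z integrable_layer[OF f] g] k_def)
  finally show ?thesis using bilin_eq_weber[OF s z f g] by (simp add: k_def)
qed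

text \<open>The constant is fixed before \<open>z\<close>, \<open>f\<close> and \<open>g\<close>,
  and only the modulus of \<open>z\<close> enters, so nothing degenerates as the real part tends to
  0. \<open>V\<close> and \<open>W\<close> bound p-th powers of norms.\<close>

lemma interpolated_dispersive_estimate:
  assumes p: "1 < p" "p < 2"
  obtains C where "C > 0"
    "\<And>z f g V W. Re z > 0 \<Longrightarrow> integrable (pmeas (2 * s - 1)) f \<Longrightarrow> integrable (pmeas (2 * s - 1)) g \<Longrightarrow> V \<ge> 0 \<Longrightarrow> W \<ge> 0 \<Longrightarrow>
      (\<integral>\<^sup>+x. ennreal (norm (f x) powr p) \<partial>pmeas (2 * s - 1)) \<le> ennreal V \<Longrightarrow>
      (\<integral>\<^sup>+x. ennreal (norm (g x) powr p) \<partial>pmeas (2 * s - 1)) \<le> ennreal W \<Longrightarrow>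
      norm (bilin s z f g) \<le> C * norm z powr (- s * (2 / p - 1)) * (V * W) powr (1 / p)"
proof -
  let ?M = "pmeas (2 * s - 1)"
  \<comment> \<open>\<open>bilinear_interpolation\<close> wants the same two functions in both
    estimates. The energy constant \<open>D\<close> is therefore put into them, and
    \<open>A0\<close> compensates by \<open>D\<^sup>2\<close> in the dispersive estimate.\<close>
  define D where "D = (4::real) powr s / 8"
  have D: "D > 0" by (simp add: D_def)
  define A0 where "A0 = 1 / (2 * Gamma s) / D\<^sup>2"
  have A0: "A0 > 0" using s_pos[OF s] D by (simp add: A0_def)
  define C where "C = (1 + 4 / (2 - p)) * A0 powr (2 / p - 1) * (D * D) powr (1 / p)"
  have C: "C > 0" using p A0 D by (simp add: C_def add_pos_pos)
  \<comment> \<open>The interpolation lemma needs positive \<open>V\<close> and \<open>W\<close>. If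
    either is 0, the function concerned vanishes almost everywhere.\<close>
  have zero: "bilin s z f g = 0" if f: "integrable ?M f" and "(\<integral>\<^sup>+x. ennreal (norm (f x) powr p) \<partial>?M) \<le> ennreal 0" for z f g
  proof -
    have [measurable]: "f \<in> borel_measurable borel" using f by simp
    have ae: "AE x in ?M. f x = 0"
      using that(2) by (simp add: nn_integral_0_iff_AE)
    have "hk s f \<xi> = 0" for \<xi>
      unfolding hk_def by (rule integral_eq_zero_AE) (use ae in \<open>auto elim: eventually_mono\<close>)
    then show ?thesis by (simp add: bilin_def)
  qed
  show ?thesis
  proof (rule that[OF C])
    fix z :: complex and f g :: "real \<Rightarrow> complex" and V W :: real
    assume z: "Re z > 0" and f: "integrable ?M f" and g: "integrable ?M g" and V0: "V \<ge> 0" and W0: "W \<ge> 0"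
      and V: "(\<integral>\<^sup>+x. ennreal (norm (f x) powr p) \<partial>?M) \<le> ennreal V"
      and W: "(\<integral>\<^sup>+x. ennreal (norm (g x) powr p) \<partial>?M) \<le> ennreal W"
    have [measurable]: "f \<in> borel_measurable borel" "g \<in> borel_measurable borel" using f g by simp_all
    have z0: "norm z > 0" using z by auto
    show "norm (bilin s z f g) \<le> C * norm z powr (- s * (2 / p - 1)) * (V * W) powr (1 / p)"
    proof (cases "V = 0 \<or> W = 0")
      case True
      then have "bilin s z f g = 0"
        using zero[OF f] zero[OF g] V W bilin_commute[of s z f g] by auto
      then show ?thesis using C by simp
    next
      case False
      then have pos: "V > 0" "W > 0" using V0 W0 by auto
      define \<mu> where "\<mu> = (\<lambda>h :: real \<Rightarrow> complex. \<lambda>a. emeasure ?M {x \<in> space ?M. a < norm (h x)})"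
      have \<mu>m [measurable]: "\<mu> h \<in> borel_measurable borel" if [measurable]: "h \<in> borel_measurable borel" for h
      proof -
        have "\<mu> h a = (\<integral>\<^sup>+x. indicator {x. a < norm (h x)} x \<partial>?M)" for a
          by (subst nn_integral_indicator) (auto simp: \<mu>_def)
        moreover have "(\<lambda>(a, x). indicator {x. a < norm (h x)} x :: ennreal) \<in> borel_measurable (borel \<Otimes>\<^sub>M ?M)"
        proof -
          have "(\<lambda>(a, x). indicator {x. a < norm (h x)} x :: ennreal) = (\<lambda>q. if fst q < norm (h (snd q)) then 1 else 0)"
            by (auto simp: fun_eq_iff)
          then show ?thesis by simp
        qed
        ultimately show ?thesis
          using pmeas.borel_measurable_nn_integral[of "\<lambda>a x. indicator {x. a < norm (h x)} x" borel "2 * s - 1"]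
          by (simp add: fun_eq_iff[symmetric] cong: measurable_cong)
      qed
      have \<mu>V: "(\<integral>\<^sup>+a. ennreal D * \<mu> h a \<partial>pmeas (p - 1)) \<le> ennreal (D * U)"
        if [measurable]: "h \<in> borel_measurable borel" and U: "(\<integral>\<^sup>+x. ennreal (norm (h x) powr p) \<partial>?M) \<le> ennreal U" "U > 0" for h U
      proof -
        have "(\<integral>\<^sup>+a. \<mu> h a \<partial>pmeas (p - 1)) = (\<integral>\<^sup>+x. ennreal (norm (h x) powr p / p) \<partial>?M)"
          unfolding \<mu>_def using p by (intro nn_integral_layer_cake) (auto intro: pmeas.sigma_finite_measure_axioms)
        also have "\<dots> \<le> (\<integral>\<^sup>+x. ennreal (norm (h x) powr p) \<partial>?M)"
          using p by (intro nn_integral_mono ennreal_leI) (auto simp: divide_le_eq mult_le_cancel_left1)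
        also have "\<dots> \<le> ennreal U" by (rule U)
        finally have "ennreal D * (\<integral>\<^sup>+a. \<mu> h a \<partial>pmeas (p - 1)) \<le> ennreal D * ennreal U"
          by (rule mult_left_mono) auto
        then show ?thesis using D U by (simp add: nn_integral_cmult ennreal_mult)
      qed
      let ?A = "norm z powr (- s) * A0"
      have A: "?A > 0" using z0 A0 by simp
      have "(\<integral>\<^sup>+a. \<integral>\<^sup>+b. ennreal (norm (bilin s z (layer f a) (layer g b))) \<partial>pmeas 0 \<partial>pmeas 0)
         \<le> ennreal ((1 + 4 / (2 - p)) * ?A powr (2 / p - 1) * ((D * V) * (D * W)) powr (1 / p))"
      proof (rule bilinear_interpolation[OF p A, where v = "\<lambda>a. ennreal D * \<mu> f a" and w = "\<lambda>b. ennreal D * \<mu> g b"])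
        show "D * V > 0" "D * W > 0" using D pos by auto
        show "(\<integral>\<^sup>+a. ennreal D * \<mu> f a \<partial>pmeas (p - 1)) \<le> ennreal (D * V)" using V pos by (intro \<mu>V) auto
        show "(\<integral>\<^sup>+a. ennreal D * \<mu> g a \<partial>pmeas (p - 1)) \<le> ennreal (D * W)" using W pos by (intro \<mu>V) auto
        show "(\<lambda>a. ennreal D * \<mu> f a) \<in> borel_measurable borel" "(\<lambda>a. ennreal D * \<mu> g a) \<in> borel_measurable borel"
          by measurable
        fix a b :: real assume ab: "a > 0" "b > 0"
        note l = integrable_layer[OF f ab(1)] integrable_layer[OF g ab(2)]
        have nf: "(\<integral>\<^sup>+x. ennreal (norm (layer f a x)) \<partial>?M) = \<mu> f a" "(\<integral>\<^sup>+x. ennreal ((norm (layer f a x))\<^sup>2) \<partial>?M) = \<mu> f a"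
          and ng: "(\<integral>\<^sup>+x. ennreal (norm (layer g b x)) \<partial>?M) = \<mu> g b" "(\<integral>\<^sup>+x. ennreal ((norm (layer g b x))\<^sup>2) \<partial>?M) = \<mu> g b"
          using ab nn_integral_norm_layer[of f ?M a] nn_integral_norm_layer[of g ?M b] by (simp_all add: \<mu>_def)
        have "ennreal (norm (bilin s z (layer f a) (layer g b))) \<le> ennreal (norm z powr (- s) / (2 * Gamma s)) * \<mu> f a * \<mu> g b"
          using dispersive_estimate[OF s z l] unfolding nf ng .
        also have "norm z powr (- s) / (2 * Gamma s) = ?A * (D * D)"
          using D by (simp add: A0_def power2_eq_square)
        also have "ennreal (?A * (D * D)) * \<mu> f a * \<mu> g b = ennreal ?A * (ennreal D * \<mu> f a) * (ennreal D * \<mu> g b)"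
          using A D by (subst ennreal_mult, simp, simp, subst ennreal_mult, simp, simp) (simp only: mult_ac)
        finally show "ennreal (norm (bilin s z (layer f a) (layer g b))) \<le> ennreal ?A * (ennreal D * \<mu> f a) * (ennreal D * \<mu> g b)" .
        show "ennreal (norm (bilin s z (layer f a) (layer g b))) \<le> ennreal \<theta> * (ennreal D * \<mu> f a) + ennreal (1 / \<theta>) * (ennreal D * \<mu> g b)"
          if "\<theta> > 0" for \<theta>
          using energy_estimate[OF s z l that] unfolding nf ng D_def .
      qed
      also have "(1 + 4 / (2 - p)) * ?A powr (2 / p - 1) * ((D * V) * (D * W)) powr (1 / p)
         = C * norm z powr (- s * (2 / p - 1)) * (V * W) powr (1 / p)"
      proof -
        have "?A powr (2 / p - 1) = norm z powr (- s * (2 / p - 1)) * A0 powr (2 / p - 1)"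
          using A0 by (simp add: powr_mult powr_powr)
        moreover have "((D * V) * (D * W)) powr (1 / p) = (D * D) powr (1 / p) * (V * W) powr (1 / p)"
          using D pos by (simp add: mult_ac flip: powr_mult)
        ultimately show ?thesis by (simp only: C_def mult_ac)
      qed
      finally have fin: "(\<integral>\<^sup>+a. \<integral>\<^sup>+b. ennreal (norm (bilin s z (layer f a) (layer g b))) \<partial>pmeas 0 \<partial>pmeas 0)
         \<le> ennreal (C * norm z powr (- s * (2 / p - 1)) * (V * W) powr (1 / p))" .
      have "ennreal (norm (bilin s z f g)) \<le> (\<integral>\<^sup>+a. ennreal (norm (bilin s z (layer f a) g)) \<partial>pmeas 0)"
        by (rule bilin_layer_left[OF z f g])
      also have "\<dots> \<le> (\<integral>\<^sup>+a. \<integral>\<^sup>+b. ennreal (norm (bilin s z (layer f a) (layer g b))) \<partial>pmeas 0 \<partial>pmeas 0)"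
      proof (intro nn_integral_mono_AE eventually_mono[OF AE_pmeas_pos])
        \<comment> \<open>The second argument is decomposed by exchanging it with the first, which
          symmetry of \<open>bilin\<close> allows.\<close>
        fix a :: real assume "a > 0"
        from bilin_layer_left[OF z g integrable_layer[OF f this]]
        show "ennreal (norm (bilin s z (layer f a) g)) \<le> (\<integral>\<^sup>+b. ennreal (norm (bilin s z (layer f a) (layer g b))) \<partial>pmeas 0)"
          by (simp only: bilin_commute[of s z "layer f a"])
      qed
      also note fin
      finally show ?thesis using C by (subst (asm) ennreal_le_iff) auto
    qed
  qed
qed

end

section \<open>The TT* argument\<close>

text \<open>With q' = 2 / (2 - \<beta>), \<open>S\<close> bounds the q'-th power of the mixed norm,
  so \<open>S powr (2 - \<beta>)\<close> stands for its square. The conclusion uses a nonnegative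
  integral, so finiteness of the left-hand side is part of the result.\<close>

lemma fourier_hankel_restriction:
  fixes s p \<beta> :: real
  assumes s: "s \<ge> 1 / 2" and p: "1 < p" "p < 2" and \<beta>: "\<beta> = s * (2 / p - 1)" "0 < \<beta>" "\<beta> < 1"
  obtains K where "K > 0"
    "\<And>f S. (\<lambda>(t, x). f t x) \<in> borel_measurable (borel \<Otimes>\<^sub>M borel) \<Longrightarrow>
      (\<And>t. integrable (pmeas (2 * s - 1)) (f t)) \<Longrightarrow>
      integrable lborel (\<lambda>t. \<integral>x. norm (f t x) \<partial>pmeas (2 * s - 1)) \<Longrightarrow>
      (\<And>t. integrable (pmeas (2 * s - 1)) (\<lambda>x. norm (f t x) powr p)) \<Longrightarrow>
      S \<ge> 0 \<Longrightarrow>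
      (\<integral>\<^sup>+t. ennreal ((\<integral>x. norm (f t x) powr p \<partial>pmeas (2 * s - 1)) powr (2 / (2 - \<beta>) / p)) \<partial>lborel) \<le> ennreal S \<Longrightarrow>
      (\<integral>\<^sup>+\<xi>. ennreal ((norm (\<integral>t. exp (\<i> * of_real (\<xi>\<^sup>2 * t)) * hk s (f t) \<xi> \<partial>lborel))\<^sup>2) \<partial>pmeas (2 * s - 1))
        \<le> ennreal (K * S powr (2 - \<beta>))"
proof -
  let ?M = "pmeas (2 * s - 1)"
  obtain C where C: "C > 0" and bil: "\<And>z f g V W. Re z > 0 \<Longrightarrow> integrable ?M f \<Longrightarrow> integrable ?M g \<Longrightarrow> V \<ge> 0 \<Longrightarrow> W \<ge> 0 \<Longrightarrow>
      (\<integral>\<^sup>+x. ennreal (norm (f x) powr p) \<partial>?M) \<le> ennreal V \<Longrightarrow>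
      (\<integral>\<^sup>+x. ennreal (norm (g x) powr p) \<partial>?M) \<le> ennreal W \<Longrightarrow>
      norm (bilin s z f g) \<le> C * norm z powr (- s * (2 / p - 1)) * (V * W) powr (1 / p)"
    using interpolated_dispersive_estimate[OF s p] by blast
  define H where "H = 2 * (2 / (1 - \<beta>) + 1) * (3 - \<beta>)"
  have H: "H > 0" using \<beta> by (auto simp: H_def intro!: mult_pos_pos add_pos_pos)
  have G0: "Gamma s > 0" using s_pos[OF s] by simp
  show ?thesis
  proof (rule that[of "C * H"])
    show "C * H > 0" using C H by simp
    fix f :: "real \<Rightarrow> real \<Rightarrow> complex" and S :: real
    assume fm: "(\<lambda>(t, x). f t x) \<in> borel_measurable (borel \<Otimes>\<^sub>M borel)"
      and f: "\<And>t. integrable ?M (f t)"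
      and L: "integrable lborel (\<lambda>t. \<integral>x. norm (f t x) \<partial>?M)"
      and fp: "\<And>t. integrable ?M (\<lambda>x. norm (f t x) powr p)"
      and S0: "S \<ge> 0"
      and S: "(\<integral>\<^sup>+t. ennreal ((\<integral>x. norm (f t x) powr p \<partial>?M) powr (2 / (2 - \<beta>) / p)) \<partial>lborel) \<le> ennreal S"
    have [measurable (raw)]: "(\<lambda>w. f (u w) (v w)) \<in> borel_measurable N"
      if [measurable]: "u \<in> borel_measurable N" "v \<in> borel_measurable N" for u v and N :: "'z measure"
      using measurable_compose[OF measurable_Pair[OF that] fm] by simp
    have [measurable]: "f t \<in> borel_measurable borel" for t by measurable
    have [measurable]: "(\<lambda>w. hk s (f (fst w)) (snd w)) \<in> borel_measurable (borel \<Otimes>\<^sub>M borel)"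
      unfolding hk_def by measurable
    have [measurable (raw)]: "(\<lambda>w. hk s (f (u w)) (v w)) \<in> borel_measurable N"
      if [measurable]: "u \<in> borel_measurable N" "v \<in> borel_measurable N" for u v and N :: "'z measure"
      unfolding hk_def by measurable
    define N where "N = (\<lambda>t. \<integral>x. norm (f t x) powr p \<partial>?M)"
    have N0: "N t \<ge> 0" for t unfolding N_def by (intro integral_nonneg_AE) auto
    have [measurable]: "N \<in> borel_measurable borel" unfolding N_def by measurable
    \<comment> \<open>The time-only majorant of the Hankel transforms. Its integrability, together
      with that of the Gaussian in the frequency variable, justifies all exchanges of integrals
      below.\<close>
    define l where "l = (\<lambda>t. (\<integral>x. norm (f t x) \<partial>?M) / Gamma s)"
    have l: "norm (hk s (f t) \<xi>) \<le> l t" for t \<xi> unfolding l_def by (intro norm_hk_le s f)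
    have l0: "l t \<ge> 0" for t using order_trans[OF norm_ge_zero l] .
    have li: "integrable lborel l" unfolding l_def using L by simp
    define G where "G = (\<lambda>\<xi>. \<integral>t. exp (\<i> * of_real (\<xi>\<^sup>2 * t)) * hk s (f t) \<xi> \<partial>lborel)"
    have [measurable]: "G \<in> borel_measurable borel" unfolding G_def by measurable
    have [measurable]: "cnj \<in> borel_measurable borel"
      by (intro borel_measurable_continuous_onI continuous_intros)
    have e1: "norm (exp (\<i> * of_real r)) = 1" for r by (rule norm_exp_i_times)
    have Gb: "norm (G \<xi>) \<le> integral\<^sup>L lborel l" for \<xi>
      unfolding G_def by (rule order_trans[OF integral_norm_bound integral_mono'[OF li]])
        (auto simp: norm_mult l l0 simp del: of_real_mult of_real_power)
    have Gcnj: "cnj (G \<xi>) = (\<integral>u. exp (- \<i> * of_real (\<xi>\<^sup>2 * u)) * hk s (\<lambda>x. cnj (f u x)) \<xi> \<partial>lborel)" for \<xi>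
      unfolding G_def hk_cnj Bochner_Integration.integral_cnj[symmetric] by (simp add: exp_cnj)
    have eps: "(\<integral>\<^sup>+\<xi>. ennreal (exp (- \<epsilon> * \<xi>\<^sup>2) * (norm (G \<xi>))\<^sup>2) \<partial>?M) \<le> ennreal (C * H * S powr (2 - \<beta>))"
      if \<epsilon>: "\<epsilon> > 0" for \<epsilon>
    proof -
      let ?e = "\<lambda>\<xi>. exp (- \<epsilon> * \<xi>\<^sup>2)"
      \<comment> \<open>Multiplying the phases at times \<open>t\<close> and \<open>-u\<close> with
        the damping gives \<open>exp (- ?z t u * of_real (\<xi>\<^sup>2))\<close>.\<close>
      let ?z = "\<lambda>t u. of_real \<epsilon> - \<i> * of_real (t - u)"
      have int: "integrable ?M (\<lambda>\<xi>. ?e \<xi> * (norm (G \<xi>))\<^sup>2)"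
      proof (rule Bochner_Integration.integrable_bound)
        show "integrable ?M (\<lambda>\<xi>. ?e \<xi> * (integral\<^sup>L lborel l)\<^sup>2)"
          by (intro integrable_mult_left integrable_gauss s \<epsilon>)
        show "AE \<xi> in ?M. norm (?e \<xi> * (norm (G \<xi>))\<^sup>2) \<le> norm (?e \<xi> * (integral\<^sup>L lborel l)\<^sup>2)"
          using Gb by (intro AE_I2) (auto simp: abs_mult intro!: mult_left_mono power_mono)
      qed measurable
      have "of_real (\<integral>\<xi>. ?e \<xi> * (norm (G \<xi>))\<^sup>2 \<partial>?M) = (\<integral>\<xi>. of_real (?e \<xi>) * (G \<xi> * cnj (G \<xi>)) \<partial>?M)"
        unfolding complex_norm_square[symmetric] of_real_mult[symmetric]
        by (rule has_bochner_integral_integral_eq[OF has_bochner_integral_of_real[OF has_bochner_integral_integrable[OF int]], symmetric])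
      also have "\<dots> = (\<integral>\<xi>. (\<integral>t. of_real (?e \<xi>) * (exp (\<i> * of_real (\<xi>\<^sup>2 * t)) * hk s (f t) \<xi> * cnj (G \<xi>)) \<partial>lborel) \<partial>?M)"
        unfolding integral_mult_right_zero integral_mult_left_zero by (simp only: G_def)
      also have "\<dots> = (\<integral>t. (\<integral>\<xi>. of_real (?e \<xi>) * (exp (\<i> * of_real (\<xi>\<^sup>2 * t)) * hk s (f t) \<xi> * cnj (G \<xi>)) \<partial>?M) \<partial>lborel)"
      proof (rule pmeas_lborel_pair.Fubini_integral[symmetric], rule pmeas_lborel_pair.integrable_pair_bound)
        show "integrable ?M (\<lambda>\<xi>. ?e \<xi> * integral\<^sup>L lborel l)"
          by (intro integrable_mult_left integrable_gauss s \<epsilon>)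
        show "integrable lborel l" by (rule li)
        fix \<xi> t :: real
        have "norm (of_real (?e \<xi>) * (exp (\<i> * of_real (\<xi>\<^sup>2 * t)) * hk s (f t) \<xi> * cnj (G \<xi>))) = ?e \<xi> * (norm (hk s (f t) \<xi>) * norm (G \<xi>))"
          unfolding norm_mult e1 by simp
        also have "\<dots> \<le> ?e \<xi> * (l t * integral\<^sup>L lborel l)"
          by (intro mult_left_mono mult_mono l Gb l0) auto
        finally show "norm (case (\<xi>, t) of (\<xi>, t) \<Rightarrow> of_real (?e \<xi>) * (exp (\<i> * of_real (\<xi>\<^sup>2 * t)) * hk s (f t) \<xi> * cnj (G \<xi>))) \<le> ?e \<xi> * integral\<^sup>L lborel l * l t"
          by (simp only: prod.case mult_ac)
      qed measurable
      also have "\<dots> = (\<integral>t. (\<integral>u. bilin s (?z t u) (f t) (\<lambda>x. cnj (f u x)) \<partial>lborel) \<partial>lborel)"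
      proof (rule Bochner_Integration.integral_cong[OF refl])
        fix t
        have "(\<integral>\<xi>. of_real (?e \<xi>) * (exp (\<i> * of_real (\<xi>\<^sup>2 * t)) * hk s (f t) \<xi> * cnj (G \<xi>)) \<partial>?M)
           = (\<integral>\<xi>. (\<integral>u. of_real (?e \<xi>) * (exp (\<i> * of_real (\<xi>\<^sup>2 * t)) * hk s (f t) \<xi> * (exp (- \<i> * of_real (\<xi>\<^sup>2 * u)) * hk s (\<lambda>x. cnj (f u x)) \<xi>)) \<partial>lborel) \<partial>?M)"
          unfolding integral_mult_right_zero Gcnj ..
        also have "\<dots> = (\<integral>u. (\<integral>\<xi>. of_real (?e \<xi>) * (exp (\<i> * of_real (\<xi>\<^sup>2 * t)) * hk s (f t) \<xi> * (exp (- \<i> * of_real (\<xi>\<^sup>2 * u)) * hk s (\<lambda>x. cnj (f u x)) \<xi>)) \<partial>?M) \<partial>lborel)"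
        proof (rule pmeas_lborel_pair.Fubini_integral[symmetric], rule pmeas_lborel_pair.integrable_pair_bound)
          show "integrable ?M (\<lambda>\<xi>. ?e \<xi> * l t)"
            by (intro integrable_mult_left integrable_gauss s \<epsilon>)
          show "integrable lborel l" by (rule li)
          fix \<xi> u :: real
          have e2: "norm (exp (- \<i> * of_real (\<xi>\<^sup>2 * u))) = 1" using e1[of "- (\<xi>\<^sup>2 * u)"] by simp
          have "norm (of_real (?e \<xi>) * (exp (\<i> * of_real (\<xi>\<^sup>2 * t)) * hk s (f t) \<xi> * (exp (- \<i> * of_real (\<xi>\<^sup>2 * u)) * hk s (\<lambda>x. cnj (f u x)) \<xi>))) = ?e \<xi> * (norm (hk s (f t) \<xi>) * norm (hk s (f u) \<xi>))"
            unfolding norm_mult e1 e2 hk_cnj by simp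
          also have "\<dots> \<le> ?e \<xi> * (l t * l u)"
            by (intro mult_left_mono mult_mono l l0) auto
          finally show "norm (case (\<xi>, u) of (\<xi>, u) \<Rightarrow> of_real (?e \<xi>) * (exp (\<i> * of_real (\<xi>\<^sup>2 * t)) * hk s (f t) \<xi> * (exp (- \<i> * of_real (\<xi>\<^sup>2 * u)) * hk s (\<lambda>x. cnj (f u x)) \<xi>))) \<le> ?e \<xi> * l t * l u"
            by (simp only: prod.case mult_ac)
        qed (unfold hk_cnj, measurable)
        also have "\<dots> = (\<integral>u. bilin s (?z t u) (f t) (\<lambda>x. cnj (f u x)) \<partial>lborel)"
        proof (intro Bochner_Integration.integral_cong refl)
          fix u
          have "of_real (?e \<xi>) * (exp (\<i> * of_real (\<xi>\<^sup>2 * t)) * exp (- \<i> * of_real (\<xi>\<^sup>2 * u))) = exp (- ?z t u * of_real (\<xi>\<^sup>2))" for \<xi>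
            unfolding exp_of_real[symmetric] exp_add[symmetric] by (simp add: algebra_simps)
          moreover have "E * (A * a * (B * b)) = E * (A * B) * (a * b)" for E A B a b :: complex
            by (simp only: mult_ac)
          ultimately have "of_real (?e \<xi>) * (exp (\<i> * of_real (\<xi>\<^sup>2 * t)) * a * (exp (- \<i> * of_real (\<xi>\<^sup>2 * u)) * b)) = exp (- ?z t u * of_real (\<xi>\<^sup>2)) * (a * b)" for \<xi> a b
            by presburger
          then show "(\<integral>\<xi>. of_real (?e \<xi>) * (exp (\<i> * of_real (\<xi>\<^sup>2 * t)) * hk s (f t) \<xi> * (exp (- \<i> * of_real (\<xi>\<^sup>2 * u)) * hk s (\<lambda>x. cnj (f u x)) \<xi>)) \<partial>?M) = bilin s (?z t u) (f t) (\<lambda>x. cnj (f u x))"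
            unfolding bilin_def by presburger
        qed
        finally show "(\<integral>\<xi>. of_real (?e \<xi>) * (exp (\<i> * of_real (\<xi>\<^sup>2 * t)) * hk s (f t) \<xi> * cnj (G \<xi>)) \<partial>?M) = (\<integral>u. bilin s (?z t u) (f t) (\<lambda>x. cnj (f u x)) \<partial>lborel)" .
      qed
      finally have eq: "of_real (\<integral>\<xi>. ?e \<xi> * (norm (G \<xi>))\<^sup>2 \<partial>?M) = (\<integral>t. (\<integral>u. bilin s (?z t u) (f t) (\<lambda>x. cnj (f u x)) \<partial>lborel) \<partial>lborel)" .
      have "(\<integral>\<xi>. ?e \<xi> * (norm (G \<xi>))\<^sup>2 \<partial>?M) \<ge> 0" by (intro integral_nonneg_AE) auto
      then have "(\<integral>\<^sup>+\<xi>. ennreal (?e \<xi> * (norm (G \<xi>))\<^sup>2) \<partial>?M) = ennreal (norm (complex_of_real (\<integral>\<xi>. ?e \<xi> * (norm (G \<xi>))\<^sup>2 \<partial>?M)))"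
        using int by (subst nn_integral_eq_integral) auto
      also have "\<dots> \<le> (\<integral>\<^sup>+t. ennreal (norm (\<integral>u. bilin s (?z t u) (f t) (\<lambda>x. cnj (f u x)) \<partial>lborel)) \<partial>lborel)"
        unfolding eq by (rule ennreal_norm_integral_le)
      also have "\<dots> \<le> (\<integral>\<^sup>+t. \<integral>\<^sup>+u. ennreal (norm (bilin s (?z t u) (f t) (\<lambda>x. cnj (f u x)))) \<partial>lborel \<partial>lborel)"
        by (intro nn_integral_mono ennreal_norm_integral_le)
      also have "\<dots> \<le> (\<integral>\<^sup>+t. \<integral>\<^sup>+u. ennreal C * ennreal (N t powr (1 / p) * N u powr (1 / p) * \<bar>t - u\<bar> powr (- \<beta>)) \<partial>lborel \<partial>lborel)"
      proof (rule nn_integral_mono, rule nn_integral_mono_AE, rule eventually_mono[OF AE_lborel_singleton])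
        \<comment> \<open>The diagonal is a null set and has to be left out: there
          \<open>\<bar>t - u\<bar> powr (- \<beta>)\<close> is 0 by the convention on
          \<open>powr\<close>.\<close>
        fix t u :: real assume "u \<noteq> t"
        have "norm (bilin s (?z t u) (f t) (\<lambda>x. cnj (f u x))) \<le> C * norm (?z t u) powr (- s * (2 / p - 1)) * (N t * N u) powr (1 / p)"
          using fp[of t] fp[of u] f[of t] f[of u] N0 \<epsilon>
          by (intro bil) (auto simp: N_def nn_integral_eq_integral)
        also have "- s * (2 / p - 1) = - \<beta>" using \<beta> by simp
        \<comment> \<open>The modulus of \<open>?z t u\<close> is at least that of its imaginary
          part. From here on the bound is free of \<open>\<epsilon>\<close>.\<close>
        also have "C * norm (?z t u) powr (- \<beta>) * (N t * N u) powr (1 / p) \<le> C * \<bar>t - u\<bar> powr (- \<beta>) * (N t * N u) powr (1 / p)"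
        proof (intro mult_right_mono mult_left_mono powr_mono2')
          show "\<bar>t - u\<bar> \<le> norm (?z t u)" using abs_Im_le_cmod[of "?z t u"] by simp
        qed (use C \<beta> \<open>u \<noteq> t\<close> in auto)
        also have "\<dots> = C * (N t powr (1 / p) * N u powr (1 / p) * \<bar>t - u\<bar> powr (- \<beta>))"
          using N0 by (simp add: powr_mult mult_ac)
        finally have "norm (bilin s (?z t u) (f t) (\<lambda>x. cnj (f u x))) \<le> C * (N t powr (1 / p) * N u powr (1 / p) * \<bar>t - u\<bar> powr (- \<beta>))" .
        then show "ennreal (norm (bilin s (?z t u) (f t) (\<lambda>x. cnj (f u x)))) \<le> ennreal C * ennreal (N t powr (1 / p) * N u powr (1 / p) * \<bar>t - u\<bar> powr (- \<beta>))"
          using C by (subst ennreal_mult[symmetric]) (auto intro!: ennreal_leI)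
      qed
      also have "\<dots> = ennreal C * (\<integral>\<^sup>+t. \<integral>\<^sup>+u. ennreal (N t powr (1 / p) * N u powr (1 / p) * \<bar>t - u\<bar> powr (- \<beta>)) \<partial>lborel \<partial>lborel)"
        by (simp add: nn_integral_cmult)
      also have "\<dots> \<le> ennreal C * ennreal (H * S powr (2 - \<beta>))"
      proof (rule mult_left_mono)
        show "(\<integral>\<^sup>+t. \<integral>\<^sup>+u. ennreal (N t powr (1 / p) * N u powr (1 / p) * \<bar>t - u\<bar> powr (- \<beta>)) \<partial>lborel \<partial>lborel) \<le> ennreal (H * S powr (2 - \<beta>))"
          unfolding H_def
        proof (rule hardy_littlewood_sobolev_diagonal[OF \<beta>(2,3) _ _ S0])
          show "(\<integral>\<^sup>+t. ennreal ((N t powr (1 / p)) powr (2 / (2 - \<beta>))) \<partial>lborel) \<le> ennreal S"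
            using S by (simp add: powr_powr N_def mult.commute)
        qed auto
      qed auto
      also have "\<dots> = ennreal (C * H * S powr (2 - \<beta>))"
        using C H by (simp add: mult.assoc flip: ennreal_mult)
      finally show ?thesis .
    qed
    \<comment> \<open>Fatou's lemma along \<open>\<epsilon> = 1 / Suc n\<close>; the bound being the
      same for every n, it passes to the limit.\<close>
    have "(\<integral>\<^sup>+\<xi>. ennreal ((norm (G \<xi>))\<^sup>2) \<partial>?M) = (\<integral>\<^sup>+\<xi>. liminf (\<lambda>n. ennreal (exp (- (1 / real (Suc n)) * \<xi>\<^sup>2) * (norm (G \<xi>))\<^sup>2)) \<partial>?M)"
    proof (intro nn_integral_cong lim_imp_Liminf[symmetric] tendsto_ennrealI)
      fix \<xi> :: real
      have "(\<lambda>n. exp (- (1 / real (Suc n)) * \<xi>\<^sup>2) * (norm (G \<xi>))\<^sup>2) \<longlonglongrightarrow> exp (- 0 * \<xi>\<^sup>2) * (norm (G \<xi>))\<^sup>2"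
        by (intro tendsto_intros LIMSEQ_Suc[OF lim_1_over_n])
      then show "(\<lambda>n. exp (- (1 / real (Suc n)) * \<xi>\<^sup>2) * (norm (G \<xi>))\<^sup>2) \<longlonglongrightarrow> (norm (G \<xi>))\<^sup>2" by simp
    qed simp
    also have "\<dots> \<le> liminf (\<lambda>n. \<integral>\<^sup>+\<xi>. ennreal (exp (- (1 / real (Suc n)) * \<xi>\<^sup>2) * (norm (G \<xi>))\<^sup>2) \<partial>?M)"
      by (intro nn_integral_liminf) measurable
    also have "\<dots> \<le> liminf (\<lambda>n. ennreal (C * H * S powr (2 - \<beta>)))"
      by (intro Liminf_mono always_eventually allI eps) auto
    also have "\<dots> = ennreal (C * H * S powr (2 - \<beta>))" by (simp add: Liminf_const)
    finally show "(\<integral>\<^sup>+\<xi>. ennreal ((norm (\<integral>t. exp (\<i> * of_real (\<xi>\<^sup>2 * t)) * hk s (f t) \<xi> \<partial>lborel))\<^sup>2) \<partial>?M) \<le> ennreal (C * H * S powr (2 - \<beta>))"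
      by (simp only: G_def)
  qed
qed

section \<open>Application to the Fourier--Hankel transform\<close>

lemma integral_pmeas:
  fixes f :: "real \<Rightarrow> 'b :: {banach, second_countable_topology}"
  assumes [measurable]: "f \<in> borel_measurable borel"
  shows "integral\<^sup>L (pmeas c) f = (LINT x:{0<..}|lborel. (x powr c) *\<^sub>R f x)"
    and "integrable (pmeas c) f \<longleftrightarrow> set_integrable lborel {0<..} (\<lambda>x. (x powr c) *\<^sub>R f x)"
  unfolding pmeas_def set_lebesgue_integral_def set_integrable_def
  by (simp_all add: integral_density integrable_density)

lemma integrable_inverse_one_plus_square: "integrable lborel (\<lambda>t::real. 1 / (1 + t\<^sup>2))"
proof -
  have "(\<integral>\<^sup>+t. ennreal (1 / (1 + t\<^sup>2)) * indicator {0..} t \<partial>lborel) = ennreal (pi / 2 - arctan 0)"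
  proof (rule nn_integral_FTC_atLeast)
    show "DERIV arctan x :> 1 / (1 + x\<^sup>2)" for x
      using DERIV_arctan[of x] by (simp add: inverse_eq_divide)
    show "(arctan \<longlongrightarrow> pi / 2) at_top" by (rule tendsto_arctan_at_top)
  qed auto
  then have *: "(\<integral>\<^sup>+t. ennreal (1 / (1 + t\<^sup>2)) * indicator {0..} t \<partial>lborel) < \<infinity>" by simp
  have "(\<integral>\<^sup>+t. ennreal (1 / (1 + t\<^sup>2)) * indicator {0..} (- t) \<partial>lborel) = (\<integral>\<^sup>+t. ennreal (1 / (1 + t\<^sup>2)) * indicator {0..} t \<partial>lborel)"
    by (subst (2) nn_integral_real_affine[of _ "- 1" 0]) auto
  with * have **: "(\<integral>\<^sup>+t. ennreal (1 / (1 + t\<^sup>2)) * indicator {0..} (- t) \<partial>lborel) < \<infinity>" by simp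
  have "(\<integral>\<^sup>+t. ennreal (norm (1 / (1 + (t::real)\<^sup>2))) \<partial>lborel) \<le> (\<integral>\<^sup>+t. ennreal (1 / (1 + t\<^sup>2)) * indicator {0..} t + ennreal (1 / (1 + t\<^sup>2)) * indicator {0..} (- t) \<partial>lborel)"
    by (intro nn_integral_mono) (auto simp: indicator_def)
  also have "\<dots> = (\<integral>\<^sup>+t. ennreal (1 / (1 + t\<^sup>2)) * indicator {0..} t \<partial>lborel) + (\<integral>\<^sup>+t. ennreal (1 / (1 + t\<^sup>2)) * indicator {0..} (- t) \<partial>lborel)"
    by (intro nn_integral_add) measurable
  also have "\<dots> < \<infinity>" using * ** by (simp add: ennreal_add_eq_top less_top)
  finally show ?thesis by (intro integrableI_bounded) auto
qed

lemma integrable_pmeas_decay: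
  assumes "m \<ge> a / 2 + 1" "a \<ge> 0"
  shows "integrable (pmeas a) (\<lambda>x. (1 + x\<^sup>2) powr (- m))"
proof -
  have "integrable lborel (\<lambda>x. (indicator {0<..} x * x powr a) *\<^sub>R (1 + x\<^sup>2) powr (- m))"
  proof (rule Bochner_Integration.integrable_bound[OF integrable_inverse_one_plus_square])
    show "AE x in lborel. norm ((indicator {0<..} x * x powr a) *\<^sub>R (1 + x\<^sup>2) powr (- m)) \<le> norm (1 / (1 + x\<^sup>2))"
    proof (intro AE_I2)
      fix x :: real
      have pos: "1 + x\<^sup>2 > 0" by (simp add: add_pos_nonneg)
      have "x powr a * (1 + x\<^sup>2) powr (- m) \<le> 1 / (1 + x\<^sup>2)" if "x > 0"
      proof -
        have "x powr a = (x\<^sup>2) powr (a / 2)" using that by (simp add: powr_powr flip: powr_numeral)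
        also have "\<dots> \<le> (1 + x\<^sup>2) powr (a / 2)" using assms by (intro powr_mono2) auto
        finally have "x powr a * (1 + x\<^sup>2) powr (- m) \<le> (1 + x\<^sup>2) powr (a / 2) * (1 + x\<^sup>2) powr (- m)"
          by (intro mult_right_mono) auto
        also have "\<dots> = (1 + x\<^sup>2) powr (a / 2 - m)" by (simp flip: powr_add)
        also have "\<dots> \<le> (1 + x\<^sup>2) powr (- 1)" using assms by (intro powr_mono) auto
        also have "\<dots> = 1 / (1 + x\<^sup>2)" using pos by (simp add: powr_minus_divide)
        finally show ?thesis .
      qed
      then show "norm ((indicator {0<..} x * x powr a) *\<^sub>R (1 + x\<^sup>2) powr (- m)) \<le> norm (1 / (1 + x\<^sup>2))"
        using pos by (auto simp: indicator_def abs_mult)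
    qed
  qed measurable
  then show ?thesis unfolding pmeas_def by (subst integrable_density) auto
qed

lemma besselJ_eq_jbess:
  assumes "\<nu> > - 1" "z > 0"
  shows "besselJ \<nu> z = (z / 2) powr \<nu> * jbess (\<nu> + 1) z"
proof -
  have "summable (\<lambda>m. of_real (bcoef (\<nu> + 1) m * (- (z\<^sup>2 / 4)) ^ m) :: complex)"
    using sums_summable[OF bess_sums[of "\<nu> + 1" "of_real (- (z\<^sup>2 / 4))"]] assms by simp
  then have sm: "summable (\<lambda>m. bcoef (\<nu> + 1) m * (- (z\<^sup>2 / 4)) ^ m)"
    by (simp only: summable_complex_of_real)
  have "(- 1) ^ k / (fact k * Gamma (real k + \<nu> + 1)) * (z / 2) powr (2 * real k + \<nu>)
      = (z / 2) powr \<nu> * (bcoef (\<nu> + 1) k * (- (z\<^sup>2 / 4)) ^ k)" for k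
  proof -
    have "(z / 2) powr (2 * real k + \<nu>) = (z / 2) powr real (2 * k) * (z / 2) powr \<nu>"
      by (simp add: powr_add)
    also have "(z / 2) powr real (2 * k) = (z\<^sup>2 / 4) ^ k"
      using assms by (subst powr_realpow) (simp_all add: power_mult power_divide)
    finally show ?thesis
      by (simp add: bcoef_def power_minus[of "z\<^sup>2 / 4"] add_ac)
  qed
  then have "besselJ \<nu> z = (\<Sum>k. (z / 2) powr \<nu> * (bcoef (\<nu> + 1) k * (- (z\<^sup>2 / 4)) ^ k))"
    unfolding besselJ_def by presburger
  also have "\<dots> = (z / 2) powr \<nu> * jbess (\<nu> + 1) z"
    unfolding jbess_def by (rule suminf_mult[OF sm])
  finally show ?thesis .
qed

text \<open>The Bessel factor (\<xi> y / 2)^\<nu> cancels the prefactor \<xi>^(-\<nu>) and raises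
  the weight y^(\<nu> + 1) to y^(2 \<nu> + 1), the density of the measure. The factor 2^(-\<nu>) is
  left over.\<close>

lemma hankel_eq_hk:
  assumes "\<nu> > - 1" "\<xi> > 0" and [measurable]: "(\<lambda>y. if y > 0 then \<phi> y else 0) \<in> borel_measurable borel"
  shows "hankel \<nu> \<phi> \<xi> = of_real (2 powr (- \<nu>)) * hk (\<nu> + 1) (\<lambda>y. if y > 0 then \<phi> y else 0) \<xi>"
proof -
  have eq: "of_real (\<xi> powr (- \<nu>)) * (\<phi> y * of_real (besselJ \<nu> (\<xi> * y) * y powr (\<nu> + 1)))
     = of_real (2 powr (- \<nu>)) * ((y powr (2 * (\<nu> + 1) - 1)) *\<^sub>R (\<phi> y * of_real (jbess (\<nu> + 1) (\<xi> * y))))" if y: "y > 0" for y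
  proof -
    have "\<xi> powr (- \<nu>) * (besselJ \<nu> (\<xi> * y) * y powr (\<nu> + 1)) = \<xi> powr (- \<nu>) * (\<xi> * y / 2) powr \<nu> * y powr (\<nu> + 1) * jbess (\<nu> + 1) (\<xi> * y)"
      using assms y by (simp add: besselJ_eq_jbess)
    also have "\<xi> powr (- \<nu>) * (\<xi> * y / 2) powr \<nu> * y powr (\<nu> + 1) = 2 powr (- \<nu>) * y powr (2 * (\<nu> + 1) - 1)"
    proof -
      have "2 * (\<nu> + 1) - 1 = \<nu> + (\<nu> + 1)" by simp
      then have "y powr (2 * (\<nu> + 1) - 1) = y powr \<nu> * y powr (\<nu> + 1)" by (simp only: powr_add)
      moreover have "(\<xi> * y / 2) powr \<nu> = \<xi> powr \<nu> * y powr \<nu> / 2 powr \<nu>"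
        using assms y by (simp add: powr_divide powr_mult)
      ultimately show ?thesis using assms y by (simp add: powr_minus field_simps)
    qed
    finally have "complex_of_real (\<xi> powr (- \<nu>) * (besselJ \<nu> (\<xi> * y) * y powr (\<nu> + 1))) = of_real (2 powr (- \<nu>) * y powr (2 * (\<nu> + 1) - 1) * jbess (\<nu> + 1) (\<xi> * y))"
      by (rule arg_cong)
    then show ?thesis
      by (simp only: of_real_mult scaleR_conv_of_real mult_ac) 
  qed
  have "hankel \<nu> \<phi> \<xi> = (LINT y:{0<..}|lborel. of_real (\<xi> powr (- \<nu>)) * (\<phi> y * of_real (besselJ \<nu> (\<xi> * y) * y powr (\<nu> + 1))))"
    unfolding hankel_def by (rule set_integral_mult_right[symmetric])
  also have "\<dots> = (LINT y:{0<..}|lborel. of_real (2 powr (- \<nu>)) * ((y powr (2 * (\<nu> + 1) - 1)) *\<^sub>R ((if y > 0 then \<phi> y else 0) * of_real (jbess (\<nu> + 1) (\<xi> * y)))))"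
    by (intro set_lebesgue_integral_cong allI impI, simp, subst eq) auto
  also have "\<dots> = of_real (2 powr (- \<nu>)) * (LINT y:{0<..}|lborel. (y powr (2 * (\<nu> + 1) - 1)) *\<^sub>R ((if y > 0 then \<phi> y else 0) * of_real (jbess (\<nu> + 1) (\<xi> * y))))"
    by (rule set_integral_mult_right)
  also have "(LINT y:{0<..}|lborel. (y powr (2 * (\<nu> + 1) - 1)) *\<^sub>R ((if y > 0 then \<phi> y else 0) * of_real (jbess (\<nu> + 1) (\<xi> * y)))) = hk (\<nu> + 1) (\<lambda>y. if y > 0 then \<phi> y else 0) \<xi>"
    unfolding hk_def by (rule integral_pmeas(1)[symmetric]) measurable
  finally show ?thesis .
qed

text \<open>Membership in \<open>Splus\<close> does not constrain \<open>F x t\<close> for \<open>x \<le> 0\<close>, where it need not even be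
  measurable.\<close>

definition cutoff :: "(real \<Rightarrow> real \<Rightarrow> complex) \<Rightarrow> real \<Rightarrow> real \<Rightarrow> complex" where
  "cutoff F t x = (if x > 0 then F x t else 0)"

lemma Splus_measurable:
  assumes "F \<in> Splus"
  shows "(\<lambda>(t, x). cutoff F t x) \<in> borel_measurable (borel \<Otimes>\<^sub>M borel)"
proof -
  \<comment> \<open>The empty word of derivatives gives differentiability of \<open>F\<close> itself
    on the open half-plane, hence continuity there.\<close>
  have "(\<lambda>(x, t). pderivs [] F x t) differentiable_on ({0<..} \<times> UNIV)"
    using assms unfolding Splus_def smooth_plus_def by blast
  then have "continuous_on ({0<..} \<times> UNIV) (\<lambda>(x, t). F x t)"
    by (intro differentiable_imp_continuous_on) simp
  moreover have "{0<..} \<times> (UNIV :: real set) \<in> sets (borel :: (real \<times> real) measure)"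
    by (intro borel_open open_Times) auto
  ultimately have "(\<lambda>w. indicator ({0<..} \<times> UNIV) w *\<^sub>R (\<lambda>(x, t). F x t) w) \<in> borel_measurable (borel :: (real \<times> real) measure)"
    by (intro borel_measurable_continuous_on_indicator)
  then have "(\<lambda>w. indicator ({0<..} \<times> UNIV) w *\<^sub>R (\<lambda>(x, t). F x t) w) \<in> borel_measurable (borel \<Otimes>\<^sub>M borel)"
    by (simp only: borel_prod)
  from measurable_compose[OF measurable_pair_swap' this]
  have "(\<lambda>w. indicator ({0<..} \<times> UNIV) (case w of (t, x) \<Rightarrow> (x, t)) *\<^sub>R (\<lambda>(x, t). F x t) (case w of (t, x) \<Rightarrow> (x, t))) \<in> borel_measurable (borel \<Otimes>\<^sub>M borel)"
    by simp
  also have "(\<lambda>w. indicator ({0<..} \<times> UNIV) (case w of (t, x) \<Rightarrow> (x, t)) *\<^sub>R (\<lambda>(x, t). F x t) (case w of (t, x) \<Rightarrow> (x, t))) = (\<lambda>(t, x). cutoff F t x)"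
    by (auto simp: fun_eq_iff cutoff_def indicator_def)
  finally show ?thesis .
qed

lemma Splus_decay:
  assumes "F \<in> Splus"
  obtains B where "B > 0" "\<And>x t. norm (cutoff F t x) \<le> B * (1 + x\<^sup>2) powr (- real m) * (1 + t\<^sup>2) powr (- real m)"
proof -
  \<comment> \<open>The seminorm of order \<open>4 * m\<close> carries the weight of exponent
    \<open>2 * m\<close>, which dominates the product of an x-weight and a t-weight of exponent
    \<open>m\<close> each.\<close>
  from assms obtain B0 where "\<forall>k l. k + l \<le> 4 * m \<longrightarrow> (\<forall>x>0. \<forall>t.
        (1 + x\<^sup>2 + t\<^sup>2) powr (real (4 * m) / 2) * cmod ((mdx ^^ k) ((pdt ^^ l) F) x t) \<le> B0)"
    unfolding Splus_def by blast
  note * = this[rule_format, of 0 0]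
  have B0: "(1 + x\<^sup>2 + t\<^sup>2) powr (real (4 * m) / 2) * cmod (F x t) \<le> B0" if "x > 0" for x t
    using *[OF _ that, of t] by simp
  have "norm (cutoff F t x) \<le> max B0 1 * (1 + x\<^sup>2) powr (- real m) * (1 + t\<^sup>2) powr (- real m)" for x t
  proof (cases "x > 0")
    case True
    have pos: "1 + x\<^sup>2 > 0" "1 + t\<^sup>2 > 0" by (auto intro: add_pos_nonneg)
    have "(1 + x\<^sup>2) powr real m * (1 + t\<^sup>2) powr real m \<le> (1 + x\<^sup>2 + t\<^sup>2) powr real m * (1 + x\<^sup>2 + t\<^sup>2) powr real m"
      by (intro mult_mono powr_mono2) (auto intro: add_nonneg_nonneg)
    also have "\<dots> = (1 + x\<^sup>2 + t\<^sup>2) powr (real (4 * m) / 2)"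
      by (simp flip: powr_add)
    finally have "(1 + x\<^sup>2) powr real m * (1 + t\<^sup>2) powr real m * cmod (F x t) \<le> (1 + x\<^sup>2 + t\<^sup>2) powr (real (4 * m) / 2) * cmod (F x t)"
      by (rule mult_right_mono) auto
    also have "\<dots> \<le> max B0 1" using B0[OF True] by (rule max.coboundedI1)
    finally show ?thesis using pos True
      by (simp add: cutoff_def powr_minus field_simps)
  qed (simp add: cutoff_def)
  then show ?thesis by (intro that[of "max B0 1"]) auto
qed

text \<open>Used with p = k = 1 for integrability and with p = r', k = q'/r' for the mixed norm. The
  condition \<open>p * k \<ge> 1\<close> ensures that the time decay after taking the power
  \<open>k\<close> is at least that of \<open>1 / (1 + t\<^sup>2)\<close>.\<close>

lemma Splus_integrable:
  assumes F: "F \<in> Splus" and a: "a \<ge> 0" and p: "p \<ge> 1" "k > 0" "p * k \<ge> 1"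
  shows "integrable (pmeas a) (\<lambda>x. norm (cutoff F t x) powr p)"
    and "integrable lborel (\<lambda>t. (\<integral>x. norm (cutoff F t x) powr p \<partial>pmeas a) powr k)"
proof -
  define m where "m = nat \<lceil>a / 2 + 1\<rceil>"
  have m: "real m \<ge> a / 2 + 1" unfolding m_def using a by linarith
  obtain B where B: "B > 0" "\<And>x t. norm (cutoff F t x) \<le> B * (1 + x\<^sup>2) powr (- real m) * (1 + t\<^sup>2) powr (- real m)"
    using Splus_decay[OF F] by blast
  note Splus_measurable[OF F, measurable]
  have [measurable (raw)]: "(\<lambda>w. cutoff F (u w) (v w)) \<in> borel_measurable N"
    if "u \<in> borel_measurable N" "v \<in> borel_measurable N" for u v and N :: "'z measure"
    using measurable_compose[OF measurable_Pair[OF that] Splus_measurable[OF F]] by simp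
  have bd: "norm (cutoff F t x) powr p \<le> B powr p * (1 + t\<^sup>2) powr (- real m * p) * (1 + x\<^sup>2) powr (- real m)" for x t
  proof -
    have "norm (cutoff F t x) powr p \<le> (B * (1 + x\<^sup>2) powr (- real m) * (1 + t\<^sup>2) powr (- real m)) powr p"
      using p by (intro powr_mono2 B) auto
    also have "\<dots> = B powr p * (1 + x\<^sup>2) powr (- real m * p) * (1 + t\<^sup>2) powr (- real m * p)"
      using B by (simp add: powr_mult powr_powr)
    also have "\<dots> \<le> B powr p * (1 + x\<^sup>2) powr (- real m) * (1 + t\<^sup>2) powr (- real m * p)"
      using p by (intro mult_right_mono mult_left_mono powr_mono) (auto simp: mult_le_cancel_left1)
    finally show ?thesis by (simp add: mult_ac)
  qed
  have I: "integrable (pmeas a) (\<lambda>x. (1 + x\<^sup>2) powr (- real m))"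
    by (rule integrable_pmeas_decay[OF m a])
  show int: "integrable (pmeas a) (\<lambda>x. norm (cutoff F t x) powr p)" for t
  proof (rule Bochner_Integration.integrable_bound)
    show "integrable (pmeas a) (\<lambda>x. B powr p * (1 + t\<^sup>2) powr (- real m * p) * (1 + x\<^sup>2) powr (- real m))"
      by (intro integrable_mult_right I)
    show "AE x in pmeas a. norm (norm (cutoff F t x) powr p) \<le> norm (B powr p * (1 + t\<^sup>2) powr (- real m * p) * (1 + x\<^sup>2) powr (- real m))"
      using bd by (intro AE_I2) auto
  qed measurable
  define A where "A = (\<integral>x. (1 + x\<^sup>2) powr (- real m) \<partial>pmeas a)"
  have A: "A \<ge> 0" unfolding A_def by (intro integral_nonneg_AE) auto
  have N: "(\<integral>x. norm (cutoff F t x) powr p \<partial>pmeas a) \<le> B powr p * (1 + t\<^sup>2) powr (- real m * p) * A" for t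
    unfolding A_def integral_mult_right_zero[symmetric]
    by (intro integral_mono int integrable_mult_right I bd)
  have N0: "(\<integral>x. norm (cutoff F t x) powr p \<partial>pmeas a) \<ge> 0" for t by (intro integral_nonneg_AE) auto
  show "integrable lborel (\<lambda>t. (\<integral>x. norm (cutoff F t x) powr p \<partial>pmeas a) powr k)"
  proof (rule Bochner_Integration.integrable_bound)
    show "integrable lborel (\<lambda>t. (B powr p * A) powr k * (1 / (1 + t\<^sup>2)))"
      by (intro integrable_mult_right integrable_inverse_one_plus_square)
    show "AE t in lborel. norm ((\<integral>x. norm (cutoff F t x) powr p \<partial>pmeas a) powr k) \<le> norm ((B powr p * A) powr k * (1 / (1 + t\<^sup>2)))"
    proof (intro AE_I2)
      fix t :: real
      have pos: "1 + t\<^sup>2 > 0" by (simp add: add_pos_nonneg)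
      have "(\<integral>x. norm (cutoff F t x) powr p \<partial>pmeas a) powr k \<le> (B powr p * (1 + t\<^sup>2) powr (- real m * p) * A) powr k"
        using p by (intro powr_mono2 N N0) auto
      also have "\<dots> = (B powr p * A) powr k * (1 + t\<^sup>2) powr (- real m * p * k)"
        using A B by (simp add: powr_mult powr_powr)
      also have "\<dots> \<le> (B powr p * A) powr k * (1 + t\<^sup>2) powr (- 1)"
      proof (intro mult_left_mono powr_mono)
        have "1 * 1 \<le> real m * (p * k)" using m a p by (intro mult_mono) auto
        then show "- real m * p * k \<le> - 1" by (simp add: mult.assoc)
      qed auto
      also have "(1 + t\<^sup>2) powr (- 1) = 1 / (1 + t\<^sup>2)" using pos by (simp add: powr_minus_divide)
      finally show "norm ((\<integral>x. norm (cutoff F t x) powr p \<partial>pmeas a) powr k) \<le> norm ((B powr p * A) powr k * (1 / (1 + t\<^sup>2)))"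
        using pos by simp
    qed
  qed measurable
qed

lemma integral_cutoff_powr:
  assumes F: "F \<in> Splus"
  shows "(LINT x:{0<..}|lborel. cmod (F x t) powr p * x powr a) = (\<integral>x. norm (cutoff F t x) powr p \<partial>pmeas a)"
proof -
  note Splus_measurable[OF F, measurable]
  have [measurable]: "cutoff F t \<in> borel_measurable borel"
    using measurable_compose[OF measurable_Pair1' Splus_measurable[OF F], of t] by simp
  show ?thesis
    by (subst integral_pmeas(1), simp, rule set_lebesgue_integral_cong) (auto simp: cutoff_def)
qed

text \<open>For a > 1 the upper limit on r is a rewriting of 2/q < 1; for a \<le> 1 that inequality
  is automatic, because a + 1 \<le> 2 and 1/2 - 1/r < 1/2. It also gives q > 2, so that q' has the
  form 2 / (2 - \<beta>).\<close>

lemma admissible_exponents: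
  assumes a: "a \<ge> 0" and adm: "admissible a q r"
  shows "1 < conj_exp r" "conj_exp r < 2" "2 / q = (a + 1) / 2 * (2 / conj_exp r - 1)" "0 < 2 / q" "2 / q < 1"
    "conj_exp q = 2 / (2 - 2 / q)"
proof -
  have r: "r > 2" and ra: "a > 1 \<Longrightarrow> r < 2 * (a + 1) / (a - 1)" and q: "2 / q = (a + 1) * (1 / 2 - 1 / r)"
    using adm by (auto simp: admissible_def)
  show "1 < conj_exp r" "conj_exp r < 2" using r by (auto simp: conj_exp_def field_simps)
  show "2 / q = (a + 1) / 2 * (2 / conj_exp r - 1)"
    unfolding q conj_exp_def using r by (simp add: field_simps)
  show pos: "0 < 2 / q" unfolding q using a r by (intro mult_pos_pos) (auto simp: field_simps)
  then have q0: "q > 0" by (simp add: zero_less_divide_iff)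
  show "2 / q < 1"
  proof (cases "a > 1")
    case True
    then have "r * (a - 1) < 2 * (a + 1)" using ra by (simp add: field_simps)
    then show ?thesis unfolding q using r by (simp add: field_simps)
  next
    case False
    have "(a + 1) * (1 / 2 - 1 / r) \<le> 2 * (1 / 2 - 1 / r)"
      using False r by (intro mult_right_mono) (auto simp: field_simps)
    also have "\<dots> < 1" using r by (simp add: field_simps)
    finally show ?thesis unfolding q .
  qed
  then have "q > 2" using q0 by (simp add: field_simps)
  then show "conj_exp q = 2 / (2 - 2 / q)" by (simp add: conj_exp_def field_simps)
qed

text \<open>Integrability is asserted together with the bound: the integral of a non-integrable
  function is 0 by convention, and the inequality alone would then say nothing.\<close>

lemma restriction_estimate:
  assumes a: "a \<ge> 0" and adm: "admissible a q r"
  shows "\<exists>C>0. \<forall>F\<in>Splus.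
     set_integrable lborel {0<..}
       (\<lambda>\<xi>. (cmod (fourier_hankel ((a - 1) / 2) F \<xi> (- \<xi>\<^sup>2 / (2 * pi))))\<^sup>2 * \<xi> powr a) \<and>
     sqrt (LINT \<xi>:{0<..}|lborel.
       (cmod (fourier_hankel ((a - 1) / 2) F \<xi> (- \<xi>\<^sup>2 / (2 * pi))))\<^sup>2 * \<xi> powr a)
     \<le> C * mixed_norm a (conj_exp q) (conj_exp r) F"
proof -
  define s where "s = (a + 1) / 2"
  define \<nu> where "\<nu> = (a - 1) / 2"
  define p where "p = conj_exp r"
  define \<beta> where "\<beta> = 2 / q"
  have s: "s \<ge> 1 / 2" "2 * s - 1 = a" "\<nu> + 1 = s" "\<nu> > - 1" using a by (auto simp: s_def \<nu>_def field_simps)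
  note e = admissible_exponents[OF a adm, folded p_def \<beta>_def s_def]
  obtain K where K: "K > 0" and est: "\<And>f S. (\<lambda>(t, x). f t x) \<in> borel_measurable (borel \<Otimes>\<^sub>M borel) \<Longrightarrow>
      (\<And>t. integrable (pmeas a) (f t)) \<Longrightarrow>
      integrable lborel (\<lambda>t. \<integral>x. norm (f t x) \<partial>pmeas a) \<Longrightarrow>
      (\<And>t. integrable (pmeas a) (\<lambda>x. norm (f t x) powr p)) \<Longrightarrow>
      S \<ge> 0 \<Longrightarrow>
      (\<integral>\<^sup>+t. ennreal ((\<integral>x. norm (f t x) powr p \<partial>pmeas a) powr (2 / (2 - \<beta>) / p)) \<partial>lborel) \<le> ennreal S \<Longrightarrow>
      (\<integral>\<^sup>+\<xi>. ennreal ((norm (\<integral>t. exp (\<i> * of_real (\<xi>\<^sup>2 * t)) * hk s (f t) \<xi> \<partial>lborel))\<^sup>2) \<partial>pmeas a)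
        \<le> ennreal (K * S powr (2 - \<beta>))"
    using fourier_hankel_restriction[OF s(1) e(1-5), unfolded s(2)] by blast
  \<comment> \<open>This is q'/r', the power applied to the inner integral of the mixed norm;
    \<open>p * k\<close> is q'.\<close>
  define k where "k = 2 / (2 - \<beta>) / p"
  have k: "k > 0" "p * k \<ge> 1" using e(1-5) by (auto simp: k_def field_simps)
  show ?thesis
  proof (intro exI[of _ "2 powr (- \<nu>) * sqrt K"] conjI ballI)
    show "2 powr (- \<nu>) * sqrt K > 0" using K by simp
    fix F assume F: "F \<in> Splus"
    have [measurable (raw)]: "(\<lambda>w. cutoff F (u w) (v w)) \<in> borel_measurable N"
      if "u \<in> borel_measurable N" "v \<in> borel_measurable N" for u v and N :: "'z measure"
      using measurable_compose[OF measurable_Pair[OF that] Splus_measurable[OF F]] by simp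
    note int1 = Splus_integrable[OF F a, of 1 1, simplified]
    note intp = Splus_integrable[OF F a, of p k, OF less_imp_le[OF e(1)] k]
    have [measurable]: "cutoff F t \<in> borel_measurable borel" for t by measurable
    have f1: "integrable (pmeas a) (cutoff F t)" for t
      using int1(1)[of t] by (subst (asm) integrable_norm_iff) auto
    define S where "S = (\<integral>t. (\<integral>x. norm (cutoff F t x) powr p \<partial>pmeas a) powr k \<partial>lborel)"
    have S0: "S \<ge> 0" unfolding S_def by (intro integral_nonneg_AE) auto
    define G where "G = (\<lambda>\<xi>. \<integral>t. exp (\<i> * of_real (\<xi>\<^sup>2 * t)) * hk s (cutoff F t) \<xi> \<partial>lborel)"
    have [measurable]: "G \<in> borel_measurable borel" unfolding G_def hk_def by measurable
    have G: "(\<integral>\<^sup>+\<xi>. ennreal ((norm (G \<xi>))\<^sup>2) \<partial>pmeas a) \<le> ennreal (K * S powr (2 - \<beta>))"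
      unfolding G_def
    proof (rule est[OF Splus_measurable[OF F] f1 _ intp(1) S0])
      show "integrable lborel (\<lambda>t. \<integral>x. norm (cutoff F t x) \<partial>pmeas a)"
        using int1(2) by (simp add: integral_nonneg_AE)
      show "(\<integral>\<^sup>+t. ennreal ((\<integral>x. norm (cutoff F t x) powr p \<partial>pmeas a) powr (2 / (2 - \<beta>) / p)) \<partial>lborel) \<le> ennreal S"
        unfolding k_def[symmetric] S_def using intp(2) by (subst nn_integral_eq_integral) auto
    qed
    have Gi: "integrable (pmeas a) (\<lambda>\<xi>. (norm (G \<xi>))\<^sup>2)"
      using G by (intro integrableI_bounded) (auto simp: le_less_trans[OF _ ennreal_less_top])
    have GK: "(\<integral>\<xi>. (norm (G \<xi>))\<^sup>2 \<partial>pmeas a) \<le> K * S powr (2 - \<beta>)"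
      using G K unfolding nn_integral_eq_integral[OF Gi AE_I2[OF zero_le_power2]]
      by (subst (asm) ennreal_le_iff) auto
    have fh: "fourier_hankel \<nu> F \<xi> (- \<xi>\<^sup>2 / (2 * pi)) = of_real (2 powr (- \<nu>)) * G \<xi>" if "\<xi> > 0" for \<xi>
    proof -
      have "hankel \<nu> (\<lambda>y. F y t) \<xi> = of_real (2 powr (- \<nu>)) * hk s (cutoff F t) \<xi>" for t
      proof -
        have cut: "(\<lambda>y. if 0 < y then F y t else 0) = cutoff F t" by (simp add: cutoff_def fun_eq_iff)
        show ?thesis
          using hankel_eq_hk[OF s(4) that, of "\<lambda>y. F y t"] unfolding cut s(3) by simp
      qed
      \<comment> \<open>On the parabola the Fourier phase -2 \<pi> \<tau> t becomes \<xi>^2 t, the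
        phase of the Schroedinger evolution used in \<open>G\<close>.\<close>
      moreover have "exp (- 2 * pi * \<i> * complex_of_real (- \<xi>\<^sup>2 / (2 * pi) * t)) = exp (\<i> * of_real (\<xi>\<^sup>2 * t))" for t
        by (simp add: field_simps)
      ultimately have "fourier_hankel \<nu> F \<xi> (- \<xi>\<^sup>2 / (2 * pi)) = (\<integral>t. of_real (2 powr (- \<nu>)) * (exp (\<i> * of_real (\<xi>\<^sup>2 * t)) * hk s (cutoff F t) \<xi>) \<partial>lborel)"
        unfolding fourier_hankel_def by (simp only: mult.left_commute)
      then show ?thesis unfolding G_def integral_mult_right_zero .
    qed
    have fh2: "(cmod (fourier_hankel \<nu> F \<xi> (- \<xi>\<^sup>2 / (2 * pi))))\<^sup>2 * \<xi> powr a = (2 powr (- \<nu>))\<^sup>2 * ((\<xi> powr a) *\<^sub>R (norm (G \<xi>))\<^sup>2)" if "\<xi> \<in> {0<..}" for \<xi>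
    proof -
      have "\<xi> > 0" using that by simp
      then show ?thesis unfolding fh[OF \<open>\<xi> > 0\<close>] by (simp add: norm_mult power_mult_distrib)
    qed
    have si: "set_integrable lborel {0<..} (\<lambda>\<xi>. (2 powr (- \<nu>))\<^sup>2 * ((\<xi> powr a) *\<^sub>R (norm (G \<xi>))\<^sup>2))"
      using Gi by (intro set_integrable_mult_right) (simp add: integral_pmeas(2)[symmetric] del: real_scaleR_def)
    show "set_integrable lborel {0<..} (\<lambda>\<xi>. (cmod (fourier_hankel ((a - 1) / 2) F \<xi> (- \<xi>\<^sup>2 / (2 * pi))))\<^sup>2 * \<xi> powr a)"
      unfolding \<nu>_def[symmetric] using si
      by (rule set_integrable_cong[THEN iffD1, rotated -1]) (simp_all only: fh2)
    have "(LINT \<xi>:{0<..}|lborel. (cmod (fourier_hankel \<nu> F \<xi> (- \<xi>\<^sup>2 / (2 * pi))))\<^sup>2 * \<xi> powr a)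
        = (LINT \<xi>:{0<..}|lborel. (2 powr (- \<nu>))\<^sup>2 * ((\<xi> powr a) *\<^sub>R (norm (G \<xi>))\<^sup>2))"
      by (intro set_lebesgue_integral_cong allI impI, simp, rule fh2)
    also have "\<dots> = (2 powr (- \<nu>))\<^sup>2 * (\<integral>\<xi>. (norm (G \<xi>))\<^sup>2 \<partial>pmeas a)"
      unfolding set_integral_mult_right by (subst integral_pmeas(1)) auto
    also have "\<dots> \<le> (2 powr (- \<nu>))\<^sup>2 * (K * S powr (2 - \<beta>))"
      by (intro mult_left_mono GK) auto
    finally have "sqrt (LINT \<xi>:{0<..}|lborel. (cmod (fourier_hankel \<nu> F \<xi> (- \<xi>\<^sup>2 / (2 * pi))))\<^sup>2 * \<xi> powr a)
        \<le> sqrt ((2 powr (- \<nu>))\<^sup>2 * (K * S powr (2 - \<beta>)))"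
      by (rule real_sqrt_le_mono)
    also have "\<dots> = 2 powr (- \<nu>) * sqrt K * sqrt (S powr (2 - \<beta>))"
      by (simp add: real_sqrt_mult)
    also have "sqrt (S powr (2 - \<beta>)) = S powr (1 / conj_exp q)"
      using S0 e(5) by (simp add: powr_half_sqrt[symmetric] powr_powr e(6))
    also have "S powr (1 / conj_exp q) = mixed_norm a (conj_exp q) (conj_exp r) F"
      unfolding mixed_norm_def integral_cutoff_powr[OF F] S_def k_def p_def[symmetric] e(6) ..
    finally show "sqrt (LINT \<xi>:{0<..}|lborel. (cmod (fourier_hankel ((a - 1) / 2) F \<xi> (- \<xi>\<^sup>2 / (2 * pi))))\<^sup>2 * \<xi> powr a)
      \<le> 2 powr (- \<nu>) * sqrt K * mixed_norm a (conj_exp q) (conj_exp r) F"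
      unfolding \<nu>_def .
  qed
qed

theorem theoremT:
  fixes a :: real
  assumes "a \<ge> 0"
  shows "(\<forall>q r. admissible a q r \<longrightarrow>
           (\<exists>C>0. \<forall>F\<in>Splus.
              set_integrable lborel {0<..}
                (\<lambda>\<xi>. (cmod (fourier_hankel ((a - 1) / 2) F \<xi> (- \<xi>\<^sup>2 / (2 * pi))))\<^sup>2 * \<xi> powr a) \<and>
              sqrt (LINT \<xi>:{0<..}|lborel.
                 (cmod (fourier_hankel ((a - 1) / 2) F \<xi> (- \<xi>\<^sup>2 / (2 * pi))))\<^sup>2 * \<xi> powr a)
              \<le> C * mixed_norm a (conj_exp q) (conj_exp r) F))
       \<and> (\<exists>C>0. \<forall>F\<in>Splus.
              set_integrable lborel {0<..}
                (\<lambda>\<xi>. (cmod (fourier_hankel ((a - 1) / 2) F \<xi> (- \<xi>\<^sup>2 / (2 * pi))))\<^sup>2 * \<xi> powr a) \<and>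
              sqrt (LINT \<xi>:{0<..}|lborel.
                 (cmod (fourier_hankel ((a - 1) / 2) F \<xi> (- \<xi>\<^sup>2 / (2 * pi))))\<^sup>2 * \<xi> powr a)
              \<le> C * (LINT t|lborel. (LINT x:{0<..}|lborel.
                        cmod (F x t) powr (2 * (a + 3) / (a + 5)) * x powr a))
                     powr ((a + 5) / (2 * (a + 3))))"
proof (rule conjI)
  show "\<forall>q r. admissible a q r \<longrightarrow>
           (\<exists>C>0. \<forall>F\<in>Splus.
              set_integrable lborel {0<..}
                (\<lambda>\<xi>. (cmod (fourier_hankel ((a - 1) / 2) F \<xi> (- \<xi>\<^sup>2 / (2 * pi))))\<^sup>2 * \<xi> powr a) \<and>
              sqrt (LINT \<xi>:{0<..}|lborel.
                 (cmod (fourier_hankel ((a - 1) / 2) F \<xi> (- \<xi>\<^sup>2 / (2 * pi))))\<^sup>2 * \<xi> powr a)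
              \<le> C * mixed_norm a (conj_exp q) (conj_exp r) F)"
    using restriction_estimate[OF assms] by blast
next
  \<comment> \<open>The solution of the admissibility relation on the diagonal q = r, where the
    mixed norm is an ordinary Lebesgue norm.\<close>
  define q where "q = 2 * (a + 3) / (a + 1)"
  have adm: "admissible a q q"
    unfolding admissible_def
  proof (intro conjI impI)
    show "2 < q" using assms by (simp add: q_def field_simps)
    show "q < 2 * (a + 1) / (a - 1)" if "a > 1"
      using that by (simp add: q_def field_simps)
    show "2 / q = (a + 1) * (1 / 2 - 1 / q)" using assms by (simp add: q_def field_simps)
  qed
  have c: "conj_exp q = 2 * (a + 3) / (a + 5)"
  proof -
    have "q - 1 = (a + 5) / (a + 1)" using assms by (simp add: q_def field_simps)
    then show ?thesis using assms by (simp add: conj_exp_def q_def)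
  qed
  have c0: "conj_exp q \<noteq> 0" unfolding c using assms by simp
  have "mixed_norm a (conj_exp q) (conj_exp q) F = (LINT t|lborel. (LINT x:{0<..}|lborel.
                        cmod (F x t) powr (2 * (a + 3) / (a + 5)) * x powr a))
                     powr ((a + 5) / (2 * (a + 3)))" if "F \<in> Splus" for F
  proof -
    \<comment> \<open>On the diagonal the inner exponent is 1, and \<open>powr 1\<close> is the
      identity only on nonnegative numbers.\<close>
    have "(LINT x:{0<..}|lborel. cmod (F x t) powr conj_exp q * x powr a) \<ge> 0" for t
      unfolding integral_cutoff_powr[OF that] by (intro integral_nonneg_AE) auto
    then have "mixed_norm a (conj_exp q) (conj_exp q) F = (LINT t|lborel. (LINT x:{0<..}|lborel. cmod (F x t) powr conj_exp q * x powr a)) powr (1 / conj_exp q)"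
      using c0 by (simp add: mixed_norm_def)
    then show ?thesis unfolding c by simp
  qed
  with restriction_estimate[OF assms adm]
  show "\<exists>C>0. \<forall>F\<in>Splus.
              set_integrable lborel {0<..}
                (\<lambda>\<xi>. (cmod (fourier_hankel ((a - 1) / 2) F \<xi> (- \<xi>\<^sup>2 / (2 * pi))))\<^sup>2 * \<xi> powr a) \<and>
              sqrt (LINT \<xi>:{0<..}|lborel.
                 (cmod (fourier_hankel ((a - 1) / 2) F \<xi> (- \<xi>\<^sup>2 / (2 * pi))))\<^sup>2 * \<xi> powr a)
              \<le> C * (LINT t|lborel. (LINT x:{0<..}|lborel.
                        cmod (F x t) powr (2 * (a + 3) / (a + 5)) * x powr a))
                     powr ((a + 5) / (2 * (a + 3)))"
    by auto
qed

end
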